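(* Let $K$ be an imaginary quadratic number field, i.e. $K=\mathbb{Q}(\sqrt{d})$ for a square-free integer $d<0$. Restricted to hypergeometric sequences whose polynomial coefficients $p,q\in\mathbb{Z}[x]$ are monic and split (into linear factors) over $K$, the Hypergeometric Membership Problem and the Hypergeometric Threshold Problem are both decidable.
   Context: A hypergeometric sequence is a sequence $(u_n)_{n\ge 0}$ of rational numbers satisfying $p(n)u_{n+1}=q(n)u_n$ for all $n\ge 0$, where $p,q\in\mathbb{Z}[x]$ and $p$ has no non-negative integer zeros; it is specified by $p$, $q$ and the initial value $u_0\in\mathbb{Q}$. The polynomials $p,q$ are called its polynomial coefficients. An instance of either problem is a hypergeometric sequence $(u_n)_n$ together with a non-zero rational $t$. The Hypergeometric Membership Problem asks whether there exists $n\in\mathbb{N}_0$ with $u_n=t$. The Hypergeometric Threshold Problem asks whether $u_n\ge t$ for every $n\in\mathbb{N}_0$. *)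

theory Defs
  imports
    Complex_Main
    "HOL-Library.Nat_Bijection"
    "HOL-Computational_Algebra.Polynomial"
    "HOL-Computational_Algebra.Squarefree"
begin

section \<open>Partial recursive functions and decidability\<close>

datatype recf =
    Zero
  | Succ
  | Proj nat
  | Comp recf "recf list"
  | PrimRec recf recf
  | Mu recf

text \<open>
  \<open>computes f xs y\<close>: the program \<open>f\<close> halts on input \<open>xs\<close> with output \<open>y\<close>.
  No \<open>y\<close> exists if the arity does not fit or the computation diverges.
  In \<open>Mu\<close>, \<open>f\<close> has to halt on all arguments below the returned one.
\<close>

inductive computes :: "recf \<Rightarrow> nat list \<Rightarrow> nat \<Rightarrow> bool" where
  computes_Zero: "computes Zero xs 0"
| computes_Succ: "computes Succ [x] (Suc x)"
| computes_Proj: "i < length xs \<Longrightarrow> computes (Proj i) xs (xs ! i)"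
| computes_Comp:
    "list_all2 (\<lambda>g y. computes g xs y) gs ys \<Longrightarrow> computes f ys z \<Longrightarrow> computes (Comp f gs) xs z"
| computes_PrimRec_0:
    "computes f xs y \<Longrightarrow> computes (PrimRec f g) (0 # xs) y"
| computes_PrimRec_Suc:
    "computes (PrimRec f g) (n # xs) r \<Longrightarrow> computes g (n # r # xs) y \<Longrightarrow>
     computes (PrimRec f g) (Suc n # xs) y"
| computes_Mu:
    "computes f (n # xs) 0 \<Longrightarrow> (\<And>m. m < n \<Longrightarrow> \<exists>k. computes f (m # xs) (Suc k)) \<Longrightarrow>
     computes (Mu f) xs n"

inductive_cases computes_ZeroE: "computes Zero xs y"
inductive_cases computes_SuccE: "computes Succ xs y"
inductive_cases computes_ProjE: "computes (Proj i) xs y"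
inductive_cases computes_CompE: "computes (Comp f gs) xs y"
inductive_cases computes_PrimRec_0E: "computes (PrimRec f g) (0 # xs) y"
inductive_cases computes_PrimRec_SucE: "computes (PrimRec f g) (Suc n # xs) y"
inductive_cases computes_MuE: "computes (Mu f) xs y"

lemma computes_deterministic:
  "computes f xs y \<Longrightarrow> computes f xs z \<Longrightarrow> y = z"
proof (induction f xs y arbitrary: z rule: computes.induct)
  case (computes_Zero xs)
  then show ?case by (rule computes_ZeroE) simp
next
  case (computes_Succ x)
  then show ?case by (rule computes_SuccE) simp
next
  case (computes_Proj i xs)
  from computes_Proj.prems show ?case by (rule computes_ProjE) simp
next
  case (computes_Comp xs gs ys f y)
  from computes_Comp.prems obtain zs where
    zs: "list_all2 (\<lambda>g y. computes g xs y) gs zs" and fz: "computes f zs z"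
    by (rule computes_CompE)
  have "ys = zs"
  proof (rule nth_equalityI)
    show "length ys = length zs"
      using computes_Comp.IH(1) zs by (simp add: list_all2_conv_all_nth)
    show "ys ! i = zs ! i" if "i < length ys" for i
      using computes_Comp.IH(1) zs that by (simp add: list_all2_conv_all_nth)
  qed
  then show ?case
    using computes_Comp.IH(2) fz by blast
next
  case (computes_PrimRec_0 f xs y g)
  from computes_PrimRec_0.prems show ?case
    by (rule computes_PrimRec_0E) (rule computes_PrimRec_0.IH)
next
  case (computes_PrimRec_Suc f g n xs r y)
  from computes_PrimRec_Suc.prems obtain r' where
    r': "computes (PrimRec f g) (n # xs) r'" and z: "computes g (n # r' # xs) z"
    by (rule computes_PrimRec_SucE)
  from computes_PrimRec_Suc.IH(1)[OF r'] z show ?case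
    by (intro computes_PrimRec_Suc.IH(2)) simp
next
  case (computes_Mu f n xs)
  from computes_Mu.prems have z: "computes f (z # xs) 0"
    by (rule computes_MuE)
  from computes_Mu.prems have below: "\<forall>m<z. \<exists>k. computes f (m # xs) (Suc k)"
    by (rule computes_MuE) blast
  show ?case
  proof (cases n z rule: linorder_cases)
    case less
    with below obtain k where "computes f (n # xs) (Suc k)" by blast
    from computes_Mu.IH(1)[OF this] show ?thesis by simp
  next
    case greater
    from computes_Mu.IH(2)[OF this] z show ?thesis by blast
  qed
qed

text \<open>
  A decision problem consists of a set \<open>I\<close> of instances and a predicate \<open>P\<close> on them.
  A decision procedure must halt with the correct answer on (the code of) every instance;
  nothing is required on inputs that do not encode an instance.
\<close>

definition decidable_on :: "('a \<Rightarrow> nat) \<Rightarrow> 'a set \<Rightarrow> ('a \<Rightarrow> bool) \<Rightarrow> bool" where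
  "decidable_on enc I P \<longleftrightarrow> (\<exists>f. \<forall>x\<in>I. computes f [enc x] (if P x then 1 else 0))"


section \<open>Hypergeometric sequences\<close>

definition hypergeometric :: "int poly \<Rightarrow> int poly \<Rightarrow> (nat \<Rightarrow> rat) \<Rightarrow> bool" where
  "hypergeometric p q u \<longleftrightarrow>
     (\<forall>n::nat. poly p (int n) \<noteq> 0) \<and>
     (\<forall>n. of_int (poly p (int n)) * u (Suc n) = of_int (poly q (int n)) * u n)"

primrec hypergeometric_seq :: "int poly \<Rightarrow> int poly \<Rightarrow> rat \<Rightarrow> nat \<Rightarrow> rat" where
  "hypergeometric_seq p q a 0 = a"
| "hypergeometric_seq p q a (Suc n) =
     of_int (poly q (int n)) / of_int (poly p (int n)) * hypergeometric_seq p q a n"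

lemma hypergeometric_iff:
  "hypergeometric p q u \<longleftrightarrow>
     (\<forall>n::nat. poly p (int n) \<noteq> 0) \<and> u = hypergeometric_seq p q (u 0)"
proof (cases "\<forall>n::nat. poly p (int n) \<noteq> 0")
  case nz: True
  show ?thesis
  proof
    assume u: "hypergeometric p q u"
    have "u n = hypergeometric_seq p q (u 0) n" for n
    proof (induction n)
      case (Suc n)
      from u have "of_int (poly p (int n)) * u (Suc n) = of_int (poly q (int n)) * u n"
        by (simp add: hypergeometric_def)
      with nz Suc show ?case by (simp add: field_simps)
    qed simp
    with nz show "(\<forall>n::nat. poly p (int n) \<noteq> 0) \<and> u = hypergeometric_seq p q (u 0)" by blast
  next
    assume "(\<forall>n::nat. poly p (int n) \<noteq> 0) \<and> u = hypergeometric_seq p q (u 0)"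
    then have "u (Suc n) = of_int (poly q (int n)) / of_int (poly p (int n)) * u n" for n
      by (metis hypergeometric_seq.simps(2))
    with nz show "hypergeometric p q u"
      by (simp add: hypergeometric_def)
  qed
qed (auto simp: hypergeometric_def)


section \<open>Splitting over quadratic fields\<close>

definition quadratic_field :: "int \<Rightarrow> complex set" where
  "quadratic_field d = {a + b * csqrt (of_int d) | a b. a \<in> \<rat> \<and> b \<in> \<rat>}"

definition splits_over :: "complex set \<Rightarrow> int poly \<Rightarrow> bool" where
  "splits_over K p \<longleftrightarrow>
     (\<exists>c\<in>K. \<exists>as. set as \<subseteq> K \<and> map_poly of_int p = smult c (\<Prod>a\<leftarrow>as. [:-a, 1:]))"


section \<open>The two decision problems\<close>

text \<open>An instance \<open>(p, q, a, t)\<close> has polynomial coefficients \<open>p\<close>, \<open>q\<close>, initial value \<open>a\<close>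
  and target \<open>t\<close>.\<close>

type_synonym instance_data = "int poly \<times> int poly \<times> rat \<times> rat"

definition monic_split_instances :: "complex set \<Rightarrow> instance_data set" where
  "monic_split_instances K =
     {(p, q, u 0, t) | p q u t.
        hypergeometric p q u \<and> t \<noteq> 0 \<and>
        lead_coeff p = 1 \<and> lead_coeff q = 1 \<and>
        splits_over K p \<and> splits_over K q}"

definition membership_problem :: "instance_data \<Rightarrow> bool" where
  "membership_problem = (\<lambda>(p, q, a, t). \<exists>n. hypergeometric_seq p q a n = t)"

definition threshold_problem :: "instance_data \<Rightarrow> bool" where
  "threshold_problem = (\<lambda>(p, q, a, t). \<forall>n. hypergeometric_seq p q a n \<ge> t)"

definition rat_code :: "rat \<Rightarrow> nat" where
  "rat_code r = (case quotient_of r of (a, b) \<Rightarrow> prod_encode (int_encode a, int_encode b))"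

definition poly_code :: "int poly \<Rightarrow> nat" where
  "poly_code p = list_encode (map int_encode (coeffs p))"

definition instance_code :: "instance_data \<Rightarrow> nat" where
  "instance_code = (\<lambda>(p, q, a, t). list_encode [poly_code p, poly_code q, rat_code a, rat_code t])"

lemma inj_instance_code: "inj instance_code"
proof -
  have rat: "r = s" if "rat_code r = rat_code s" for r s
    using that by (intro quotient_of_inject)
      (auto simp: rat_code_def inj_eq[OF inj_int_encode] split: prod.splits)
  have poly: "p = q" if "poly_code p = poly_code q" for p q
    using that by (auto simp: poly_code_def coeffs_eq_iff inj_map_eq_map[OF inj_int_encode]
        dest: injD[OF inj_list_encode])
  show ?thesis
    unfolding instance_code_def by (rule injI) (auto dest: rat poly)
qed

end

theory Submission
  imports Defs "HOL-Analysis.Analysis" "HOL-Real_Asymp.Real_Asymp"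
begin

text \<open>
  Both problems and their complements are semidecidable. The only delicate case is that of a
  sequence whose absolute value tends strictly monotonically to a nonzero limit, where one has to
  recognise when this limit equals \<open>\<bar>t\<bar>\<close>. Pairing every root with its conjugate, whose sum with the
  root is an integer, the reflection formula of the Gamma function expresses the fourth power of
  the limit as a rational multiple of \<open>(4 \<pi>\<^sup>2) ^ e * F y\<close> with \<open>e\<close> an integer, \<open>F\<close> a rational function
  and \<open>y = 2 cosh (\<pi> \<surd>(-d))\<close>. Instead of invoking the algebraic independence of \<open>\<pi>\<close> and
  \<open>exp (\<pi> \<surd>(-d))\<close> (Nesterenko), we let the program depend on \<open>d\<close> and hardwire into it a finite
  description of all relations of the form \<open>(4 \<pi>\<^sup>2) ^ e = F y\<close>, whatever these may be.
\<close>

section \<open>Computable functions between encoded types\<close>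

text \<open>The fourth power comes from two squarings. As p(k) is real, p(k)^2 is the product of |k
  - a|^2 over the listed roots a, so conjugates need not be matched within the list. For a single
  root, z = N - a and its conjugate have an integer sum M; reflection leaves sin(pi z) / pi divided
  by a Pochhammer factor, and only after squaring are both explicit: the sine becomes a
  Chebyshev-type polynomial in y, the factor an integer up to a power of -4. A nonzero limit forces
  p and q to agree in degree and in the subleading coefficient, hence in the number and the sum of
  their roots. This cancels the normalising powers of n and 4 in the Gamma products. A limit
  strictly above the bound is certified differently: a corrected term u (x - C) / x increases to the
  same limit, so one of its values above the bound suffices. Sequences of growing absolute value are
  reduced to shrinking ones by exchanging p and q. Equality of the limit with the target is harmless
  for membership, since strict monotonicity keeps the limit from being attained.\<close>

lemma bij_map: "bij f \<Longrightarrow> bij (map f)"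
proof (rule bijI)
  assume f: "bij f"
  then show "inj (map f)" by (simp add: bij_is_inj)
  have "map f (map (inv f) ys) = ys" for ys
    using f by (simp add: bij_is_surj map_idI surj_f_inv_f)
  then show "surj (map f)" by (metis surjI)
qed

text \<open>Encodings are required to be bijective so that an unbounded search over codes is a search
  over the values of the type.\<close>

class enc =
  fixes enc :: "'a \<Rightarrow> nat"
  assumes bij_enc: "bij enc"

instantiation nat :: enc
begin
definition enc_nat :: "nat \<Rightarrow> nat" where "enc_nat n = n"
instance by standard (simp add: enc_nat_def[abs_def] bij_def)
end

instantiation int :: enc
begin
definition enc_int :: "int \<Rightarrow> nat" where "enc_int = int_encode"
instance by standard (simp add: enc_int_def bij_int_encode)
end

instantiation prod :: (enc, enc) enc
begin
definition enc_prod :: "'a \<times> 'b \<Rightarrow> nat" where "enc_prod = prod_encode \<circ> map_prod enc enc"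
instance
proof
  have "bij (map_prod enc enc :: 'a \<times> 'b \<Rightarrow> _)"
    by (auto intro!: bijI prod.inj_map map_prod_surj simp: bij_is_inj bij_is_surj bij_enc)
  then show "bij (enc :: 'a \<times> 'b \<Rightarrow> nat)"
    unfolding enc_prod_def using bij_prod_encode by (rule bij_comp)
qed
end

instantiation list :: (enc) enc
begin
definition enc_list :: "'a list \<Rightarrow> nat" where "enc_list = list_encode \<circ> map enc"
instance
proof
  show "bij (enc :: 'a list \<Rightarrow> nat)"
    unfolding enc_list_def using bij_map[OF bij_enc] bij_list_encode by (rule bij_comp)
qed
end

definition dec :: "nat \<Rightarrow> 'a::enc" where "dec = inv enc"

lemma dec_enc [simp]: "dec (enc x) = x"
  by (simp add: dec_def bij_is_inj bij_enc)

lemma enc_dec [simp]: "enc (dec n) = n"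
  by (simp add: dec_def bij_is_surj bij_enc surj_f_inv_f)

lemma enc_eq_iff [simp]: "enc x = enc y \<longleftrightarrow> x = y"
  by (metis dec_enc)

lemma enc_simps:
  "enc (n::nat) = n"
  "enc (a, b) = prod_encode (enc a, enc b)"
  "enc ([]::'a::enc list) = 0"
  "enc (h # t) = Suc (prod_encode (enc h, enc t))"
  by (simp_all add: enc_nat_def enc_prod_def enc_list_def)

lemma enc_int_simps: "enc (i::int) = (if 0 \<le> i then 2 * nat i else Suc (2 * nat (- i - 1)))"
  by (simp add: enc_int_def int_encode_def sum_encode_def)

lemma computes_Comp1:
  "computes g xs a \<Longrightarrow> computes f [a] z \<Longrightarrow> computes (Comp f [g]) xs z"
  by (auto intro!: computes_Comp)

lemma computes_Comp2:
  "computes g xs a \<Longrightarrow> computes h xs b \<Longrightarrow> computes f [a, b] z \<Longrightarrow> computes (Comp f [g, h]) xs z"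
  by (auto intro!: computes_Comp)

lemma computes_Proj':
  "computes (Proj 0) (a # xs) a"
  "computes (Proj 1) (a # b # xs) b"
  "computes (Proj 2) (a # b # c # xs) c"
  using computes_Proj[of 0 "a # xs"] computes_Proj[of 1 "a # b # xs"]
    computes_Proj[of 2 "a # b # c # xs"] by simp_all

lemma computes_PrimRec:
  assumes "computes f xs (h 0)" and "\<And>n. computes g (n # h n # xs) (h (Suc n))"
  shows "computes (PrimRec f g) (n # xs) (h n)"
  by (induction n) (auto intro: computes.intros assms)

definition computable2 :: "(nat \<Rightarrow> nat \<Rightarrow> nat) \<Rightarrow> bool" where
  "computable2 g \<longleftrightarrow> (\<exists>r. \<forall>x y. computes r [x, y] (g x y))"

definition computable :: "('a::enc \<Rightarrow> 'b::enc) \<Rightarrow> bool" where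
  "computable f \<longleftrightarrow> (\<exists>r. \<forall>x. computes r [enc x] (enc (f x)))"

lemma computableI: "(\<And>x. computes r [enc x] (enc (f x))) \<Longrightarrow> computable f"
  by (auto simp: computable_def)

lemma computable_cong: "(\<And>x. f x = g x) \<Longrightarrow> computable g \<Longrightarrow> computable f"
  by presburger


section \<open>Programs for arithmetic and Cantor pairing\<close>

lemma computable2_add: "computable2 (+)"
  unfolding computable2_def
proof (intro exI allI)
  fix x y :: nat
  show "computes (PrimRec (Proj 0) (Comp Succ [Proj 1])) [x, y] (x + y)"
    by (rule computes_PrimRec[where h = "\<lambda>x. x + y"])
      (auto intro!: computes_Proj' computes_Comp1 computes_Succ[of "_ + _", simplified] simp del: One_nat_def)
qed

lemma computable2_mult: "computable2 (*)"
proof -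
  obtain p where p: "\<And>x y. computes p [x, y] (x + y)"
    using computable2_add unfolding computable2_def by auto
  have "computes (PrimRec Zero (Comp p [Proj 2, Proj 1])) [x, y] (x * y)" for x y
    by (rule computes_PrimRec[where h = "\<lambda>x. x * y"])
      (auto intro!: computes_Proj' computes_Comp2 computes_Zero p simp del: One_nat_def)
  then show ?thesis unfolding computable2_def by blast
qed

lemma computable2_diff: "computable2 (-)"
proof -
  have pred: "computes (PrimRec Zero (Proj 0)) [x] (x - 1)" for x
    by (rule computes_PrimRec[where h = "\<lambda>x. x - 1"])
      (auto intro!: computes_Proj' computes_Zero)
  have diff: "computes (PrimRec (Proj 0) (Comp (PrimRec Zero (Proj 0)) [Proj 1])) [y, x] (x - y)" for x y
  proof (rule computes_PrimRec[where h = "\<lambda>y. x - y"])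
    fix n
    have "computes (Comp (PrimRec Zero (Proj 0)) [Proj 1]) [n, x - n, x] (x - n - 1)"
      by (rule computes_Comp1 computes_Proj' pred)+
    then show "computes (Comp (PrimRec Zero (Proj 0)) [Proj 1]) [n, x - n, x] (x - Suc n)"
      by simp
  qed (auto intro: computes_Proj')
  have "computes (Comp (PrimRec (Proj 0) (Comp (PrimRec Zero (Proj 0)) [Proj 1])) [Proj 1, Proj 0])
      [x, y] (x - y)" for x y
    by (rule computes_Comp2 computes_Proj' diff)+
  then show ?thesis unfolding computable2_def by blast
qed

lemma computable2_prod_encode: "computable2 (\<lambda>a b. prod_encode (a, b))"
  and prod_decode_program:
    "\<exists>r. \<forall>a b. computes r [prod_encode (a, b)] a" "\<exists>r. \<forall>a b. computes r [prod_encode (a, b)] b"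
proof -
  obtain p where p: "\<And>x y. computes p [x, y] (x + y)"
    using computable2_add unfolding computable2_def by auto
  obtain s where s: "\<And>x y. computes s [x, y] (x - y)"
    using computable2_diff unfolding computable2_def by auto
  define t where "t = PrimRec Zero (Comp p [Proj 1, Comp Succ [Proj 0]])"
  have t: "computes t [x] (triangle x)" for x
    unfolding t_def
    by (rule computes_PrimRec[where h = triangle], unfold triangle_0 triangle_Suc)
      (rule computes_Zero computes_Comp2 computes_Comp1 computes_Proj' computes_Succ p)+
  have "computes (Comp p [Comp t [p], Proj 0]) [a, b] (prod_encode (a, b))" for a b
    unfolding prod_encode_def prod.case
    by (rule computes_Comp2 computes_Comp1 computes_Proj' t p)+
  then show "computable2 (\<lambda>a b. prod_encode (a, b))"
    unfolding computable2_def by blast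
  \<comment> \<open>\<open>k\<close> recovers \<open>a + b\<close>: since
    \<open>prod_encode (a, b)\<close> is \<open>triangle (a + b) + a\<close>, this sum is the least
    \<open>m\<close> with \<open>x < triangle (Suc m)\<close>, and truncated subtraction turns that
    inequality into a value 0 for \<open>Mu\<close>.\<close>
  define k where "k = Mu (Comp s [Comp Succ [Proj 1], Comp t [Comp Succ [Proj 0]]])"
  have step: "computes (Comp s [Comp Succ [Proj 1], Comp t [Comp Succ [Proj 0]]]) [m, x]
      (Suc x - triangle (Suc m))" for m x
    by (rule computes_Comp2 computes_Comp1 computes_Proj' computes_Succ t s)+
  have k: "computes k [prod_encode (a, b)] (a + b)" for a b
    unfolding k_def
  proof (rule computes_Mu)
    have "Suc (prod_encode (a, b)) - triangle (Suc (a + b)) = 0"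
      by (simp add: prod_encode_def)
    then show "computes (Comp s [Comp Succ [Proj 1], Comp t [Comp Succ [Proj 0]]])
        [a + b, prod_encode (a, b)] 0"
      using step by metis
    fix m assume "m < a + b"
    moreover have "mono triangle" by (rule incseq_SucI) (simp add: triangle_Suc)
    ultimately have "triangle (Suc m) \<le> triangle (a + b)" by (intro monoD[of triangle] Suc_leI)
    then have "Suc (prod_encode (a, b)) - triangle (Suc m)
        = Suc (prod_encode (a, b) - triangle (Suc m))"
      by (intro Suc_diff_le) (simp add: prod_encode_def)
    then show "\<exists>k. computes (Comp s [Comp Succ [Proj 1], Comp t [Comp Succ [Proj 0]]])
        [m, prod_encode (a, b)] (Suc k)"
      using step by metis
  qed
  have left: "computes (Comp s [Proj 0, Comp t [k]]) [prod_encode (a, b)] a" for a b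
  proof -
    have "computes (Comp s [Proj 0, Comp t [k]]) [prod_encode (a, b)]
        (prod_encode (a, b) - triangle (a + b))"
      by (rule computes_Comp2 computes_Comp1 computes_Proj' k t s)+
    then show ?thesis by (simp add: prod_encode_def)
  qed
  then show "\<exists>r. \<forall>a b. computes r [prod_encode (a, b)] a" by blast
  have "computes (Comp s [k, Comp s [Proj 0, Comp t [k]]]) [prod_encode (a, b)] (a + b - a)" for a b
    by (rule computes_Comp2 computes_Comp1 k left s)+
  then show "\<exists>r. \<forall>a b. computes r [prod_encode (a, b)] b" by auto
qed

section \<open>Closure properties of computable functions\<close>

lemma computable_id: "computable (\<lambda>x. x)"
  by (rule computableI) (rule computes_Proj')

lemma computable_compose:
  assumes "computable f" and "computable g"
  shows "computable (\<lambda>x. f (g x))"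
proof -
  obtain r where "\<And>x. computes r [enc x] (enc (f x))" using assms(1) unfolding computable_def by (auto simp: enc_simps)
  moreover obtain s where "\<And>x. computes s [enc x] (enc (g x))" using assms(2) unfolding computable_def by (auto simp: enc_simps)
  ultimately show ?thesis by (intro computableI) (rule computes_Comp1)
qed

lemma computable_const: "computable (\<lambda>x. c)"
proof -
  have "\<exists>r. \<forall>xs. computes r xs n" for n
  proof (induction n)
    case (Suc n)
    then show ?case using computes_Comp1 computes_Succ by metis
  qed (use computes_Zero in blast)
  then show ?thesis unfolding computable_def by metis
qed

lemma computable_lift2:
  assumes "computable2 g" and "computable A" and "computable B"
  shows "computable (\<lambda>x. g (A x) (B x))"
proof -
  obtain r where "\<And>x y. computes r [x, y] (g x y)" using assms(1) by (auto simp: computable2_def)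
  moreover obtain a where "\<And>x. computes a [enc x] (A x)"
    using assms(2) unfolding computable_def by (auto simp: enc_simps)
  moreover obtain b where "\<And>x. computes b [enc x] (B x)"
    using assms(3) unfolding computable_def by (auto simp: enc_simps)
  ultimately show ?thesis
    by (intro computableI, unfold enc_simps) (rule computes_Comp2)
qed

text \<open>Programs only see codes, so passing between a value and its code costs nothing. Together
  with the next two rules this allows a construction to work on codes and return to values.\<close>

lemma computable_enc: "computable A \<Longrightarrow> computable (\<lambda>x. enc (A x))"
  by (simp add: computable_def enc_simps)

lemma computable_dec: "computable A \<Longrightarrow> computable (\<lambda>x. dec (A x))"
  by (simp add: computable_def enc_simps)

lemma computable_from_enc: "computable (\<lambda>x. enc (A x)) \<Longrightarrow> computable A"
  by (simp add: computable_def enc_simps)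

named_theorems computable_intros

lemmas [computable_intros] = computable_enc computable_dec
  computable_lift2[OF computable2_add] computable_lift2[OF computable2_mult]
  computable_lift2[OF computable2_diff]

lemma computable_Suc [computable_intros]: "computable A \<Longrightarrow> computable (\<lambda>x. Suc (A x))"
  using computable_lift2[OF computable2_add _ computable_const[of 1]] by simp

lemma computable_Pair [computable_intros]:
  "computable A \<Longrightarrow> computable B \<Longrightarrow> computable (\<lambda>x. (A x, B x))"
  by (rule computable_from_enc)
    (auto simp: enc_simps intro: computable_lift2[OF computable2_prod_encode] computable_enc)

lemma computable_fst [computable_intros]: "computable A \<Longrightarrow> computable (\<lambda>x. fst (A x))"
  by (rule computable_compose[of fst])
    (use prod_decode_program(1) in \<open>auto simp: computable_def enc_simps\<close>)

lemma computable_snd [computable_intros]: "computable A \<Longrightarrow> computable (\<lambda>x. snd (A x))"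
  by (rule computable_compose[of snd])
    (use prod_decode_program(2) in \<open>auto simp: computable_def enc_simps\<close>)

text \<open>Premises about functions of several arguments are phrased through projections of one
  encoded tuple; this rule instantiates such a premise at computed arguments.\<close>

lemma computable_uncurry:
  assumes "computable (\<lambda>e. F (fst e) (snd e))" and "computable A" and "computable B"
  shows "computable (\<lambda>x. F (A x) (B x))"
  using computable_compose[OF assms(1) computable_Pair[OF assms(2,3)]] by simp

lemma computable_uncurry3:
  assumes "computable (\<lambda>e. F (fst e) (fst (snd e)) (snd (snd e)))"
    and "computable A" and "computable B" and "computable C"
  shows "computable (\<lambda>x. F (A x) (B x) (C x))"
  using computable_compose[OF assms(1) computable_Pair[OF assms(2) computable_Pair[OF assms(3,4)]]]
  by simp

lemma computable_rec_nat [computable_intros]: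
  assumes A: "computable A" and N: "computable N"
    and S: "computable (\<lambda>e. S (fst e) (fst (snd e)) (snd (snd e)))"
  shows "computable (\<lambda>x. rec_nat (A x) (\<lambda>n r. S x n r) (N x))"
proof -
  obtain a where a: "\<And>x. computes a [enc x] (enc (A x))" using A unfolding computable_def by (auto simp: enc_simps)
  obtain n where n: "\<And>x. computes n [enc x] (N x)"
    using N unfolding computable_def by (auto simp: enc_simps)
  obtain s where s': "\<And>e. computes s [enc e] (enc (S (fst e) (fst (snd e)) (snd (snd e))))"
    using S unfolding computable_def by blast
  have s: "computes s [prod_encode (enc x, prod_encode (n, enc r))] (enc (S x n r))" for x n r
    using s'[of "(x, n, r)"] by (simp add: enc_simps)
  obtain p where p: "\<And>x y. computes p [x, y] (prod_encode (x, y))"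
    using computable2_prod_encode by (auto simp: computable2_def)
  \<comment> \<open>\<open>PrimRec\<close> supplies counter and accumulator before the parameter,
    whereas \<open>s\<close> expects the code of \<open>(x, n, r)\<close>; the projections reorder
    them.\<close>
  define f where "f = PrimRec a (Comp s [Comp p [Proj 2, Comp p [Proj 0, Proj 1]]])"
  have f: "computes f [n, enc x] (enc (rec_nat (A x) (S x) n))" for n x
    unfolding f_def
    by (rule computes_PrimRec[where h = "\<lambda>n. enc (rec_nat (A x) (S x) n)"], unfold old.nat.rec)
      (rule a computes_Comp1 computes_Comp2 computes_Proj' p s)+
  show ?thesis
    by (rule computableI[of "Comp f [n, Proj 0]"]) (rule computes_Comp2 computes_Proj' n f)+
qed


subsection \<open>Decidable predicates\<close>

definition checkable :: "('a::enc \<Rightarrow> bool) \<Rightarrow> bool" where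
  "checkable P \<longleftrightarrow> computable (\<lambda>x. if P x then 1 else 0 :: nat)"

lemma checkable_cong: "(\<And>x. P x \<longleftrightarrow> Q x) \<Longrightarrow> checkable Q \<Longrightarrow> checkable P"
  by presburger

text \<open>Both branches are total, so branching is a recursion of length 0 or 1 that starts from
  \<open>B x\<close> and overwrites it by \<open>A x\<close>.\<close>

lemma computable_if [computable_intros]:
  assumes "checkable P" and "computable A" and "computable B"
  shows "computable (\<lambda>x. if P x then A x else B x)"
proof -
  have "(if P x then A x else B x) = rec_nat (B x) (\<lambda>_ _. A x) (if P x then 1 else 0)" for x
    by simp
  moreover have "computable (\<lambda>x. rec_nat (B x) (\<lambda>_ _. A x) (if P x then 1 else 0))"
    using assms unfolding checkable_def
    by (intro computable_rec_nat computable_compose[OF assms(2)] computable_fst computable_id)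
  ultimately show ?thesis by presburger
qed

lemma checkable_eq_0: "computable A \<Longrightarrow> checkable (\<lambda>x. A x = (0::nat))"
proof -
  assume "computable A"
  then have "computable (\<lambda>x. 1 - A x)" by (intro computable_intros computable_const)
  moreover have "(if A x = 0 then 1 else 0) = 1 - A x" for x by simp
  ultimately show ?thesis unfolding checkable_def by presburger
qed

lemma checkable_le [computable_intros]:
  "computable A \<Longrightarrow> computable B \<Longrightarrow> checkable (\<lambda>x. A x \<le> (B x :: nat))"
  using checkable_eq_0[of "\<lambda>x. A x - B x"] by (simp add: computable_intros)

text \<open>Injectivity of \<open>enc\<close> reduces equality in any encoded type to equality of
  numbers, which truncated subtraction in both directions detects.\<close>

lemma checkable_eq [computable_intros]:
  assumes "computable A" and "computable B"
  shows "checkable (\<lambda>x. A x = B x)"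
proof -
  have "A x = B x \<longleftrightarrow> (enc (A x) - enc (B x)) + (enc (B x) - enc (A x)) = 0" for x
    by (auto simp del: enc_eq_iff simp flip: enc_eq_iff[of "A x"])
  moreover have "checkable (\<lambda>x. (enc (A x) - enc (B x)) + (enc (B x) - enc (A x)) = 0)"
    by (intro checkable_eq_0 computable_intros assms)
  ultimately show ?thesis by presburger
qed

lemma checkable_not [computable_intros]: "checkable P \<Longrightarrow> checkable (\<lambda>x. \<not> P x)"
  by (rule checkable_cong[OF _ checkable_eq_0[of "\<lambda>x. if P x then 1 else 0"]])
    (auto simp: checkable_def)

lemma checkable_conj [computable_intros]:
  assumes "checkable P" and "checkable Q" shows "checkable (\<lambda>x. P x \<and> Q x)"
proof -
  have "computable (\<lambda>x. (if P x then 1 else 0) * (if Q x then 1 else 0 :: nat))"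
    by (intro computable_intros computable_const assms)
  moreover have "(if P x \<and> Q x then 1 else 0) = (if P x then 1 else 0) * (if Q x then 1 else 0 :: nat)" for x
    by simp
  ultimately show ?thesis unfolding checkable_def by presburger
qed

lemma checkable_disj [computable_intros]:
  assumes "checkable P" and "checkable Q" shows "checkable (\<lambda>x. P x \<or> Q x)"
  using checkable_not[OF checkable_conj[OF assms[THEN checkable_not]]] by simp

lemma checkable_compose: "checkable P \<Longrightarrow> computable A \<Longrightarrow> checkable (\<lambda>x. P (A x))"
  unfolding checkable_def by (rule computable_compose)

lemma checkable_uncurry:
  assumes "checkable (\<lambda>e. P (fst e) (snd e))" and "computable A" and "computable B"
  shows "checkable (\<lambda>x. P (A x) (B x))"
  using checkable_compose[OF assms(1) computable_Pair[OF assms(2,3)]] by simp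

lemma checkable_all_less [computable_intros]:
  assumes P: "checkable (\<lambda>e. P (fst e) (snd e))" and N: "computable (N :: _ \<Rightarrow> nat)"
  shows "checkable (\<lambda>x. \<forall>k<N x. P x k)"
proof -
  let ?r = "\<lambda>x n. rec_nat (1::nat) (\<lambda>k r. if P x k then r else 0) (n::nat)"
  have "?r x n = (if \<forall>k<n. P x k then 1 else 0)" for x n
    by (induction n) (auto simp: less_Suc_eq)
  moreover have "computable (\<lambda>x. ?r x (N x))"
    by (intro checkable_uncurry[OF P] computable_intros computable_id computable_const N)
  ultimately show ?thesis unfolding checkable_def by simp
qed


subsection \<open>Lists\<close>

lemma computable_Cons [computable_intros]:
  "computable A \<Longrightarrow> computable B \<Longrightarrow> computable (\<lambda>x. A x # B x)"
  by (rule computable_from_enc)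
    (auto simp: enc_simps intro!: computable_lift2[OF computable2_prod_encode] computable_intros)

text \<open>On the code level both branches are total, as every number is the code of some pair.\<close>

lemma computable_case_list:
  fixes L :: "'a::enc \<Rightarrow> 'b::enc list"
  assumes L: "computable L" and A: "computable A"
    and B: "computable (\<lambda>e. B (fst e) (fst (snd e)) (snd (snd e)))"
  shows "computable (\<lambda>x. case L x of [] \<Rightarrow> A x | h # t \<Rightarrow> B x h t)"
proof -
  let ?p = "\<lambda>x. dec (enc (L x) - 1) :: 'b \<times> 'b list"
  have "(case L x of [] \<Rightarrow> A x | h # t \<Rightarrow> B x h t)
      = (if enc (L x) = 0 then A x else B x (fst (?p x)) (snd (?p x)))" for x
  proof (cases "L x")
    case (Cons h t)
    have "dec (prod_encode (enc h, enc t)) = (h, t)"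
      by (metis dec_enc enc_simps(2))
    with Cons show ?thesis by (simp add: enc_simps)
  qed (simp add: enc_simps)
  moreover have "computable (\<lambda>x. B x (fst (?p x)) (snd (?p x)))"
    by (intro computable_uncurry3[OF B] computable_intros computable_id computable_const L)
  then have "computable (\<lambda>x. if enc (L x) = 0 then A x else B x (fst (?p x)) (snd (?p x)))"
    by (intro computable_intros checkable_eq_0 L A)
  ultimately show ?thesis by presburger
qed

text \<open>The fold is an iteration on pairs of accumulator and remaining list. The code of a list
  bounds its length, so \<open>enc (L x)\<close> rounds suffice, and rounds after exhaustion leave
  the state unchanged.\<close>

lemma computable_foldl:
  fixes L :: "'a::enc \<Rightarrow> 'b::enc list" and A :: "'a \<Rightarrow> 'c::enc"
  assumes L: "computable L" and A: "computable A"
    and F: "computable (\<lambda>e. F (fst e) (fst (snd e)) (snd (snd e)))"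
  shows "computable (\<lambda>x. foldl (F x) (A x) (L x))"
proof -
  let ?step = "\<lambda>x s. case snd s of [] \<Rightarrow> s | h # t \<Rightarrow> (F x (fst s) h, t)"
  have inv: "rec_nat (a, xs) (\<lambda>_. ?step x) n = (foldl (F x) a (take n xs), drop n xs)" for x a xs n
  proof (induction n)
    case (Suc n)
    then show ?case
      by (cases "n < length xs")
        (auto simp: take_Suc_conv_app_nth Cons_nth_drop_Suc[symmetric])
  qed simp
  have length: "length xs \<le> enc xs" for xs :: "'b list"
  proof (induction xs)
    case (Cons h t)
    then show ?case
      using le_prod_encode_2[of "enc t" "enc h"] by (simp add: enc_simps)
  qed simp
  have "foldl (F x) (A x) (L x) = fst (rec_nat (A x, L x) (\<lambda>n. ?step x) (enc (L x)))" for x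
    unfolding inv using length[of "L x"] by simp
  moreover have "computable (\<lambda>x. fst (rec_nat (A x, L x) (\<lambda>n. ?step x) (enc (L x))))"
    by (intro computable_uncurry3[OF F] computable_intros L A computable_case_list computable_id)
  ultimately show ?thesis by presburger
qed

lemma computable_rev: "computable L \<Longrightarrow> computable (\<lambda>x. rev (L x))"
proof -
  assume L: "computable L"
  have "foldl (\<lambda>r h. h # r) ys xs = rev xs @ ys" for xs ys :: "'b list"
    by (induction xs arbitrary: ys) auto
  from this[of "[]"] have "rev (L x) = foldl (\<lambda>r h. h # r) [] (L x)" for x by simp
  moreover have "computable (\<lambda>x. foldl (\<lambda>r h. h # r) [] (L x))"
    by (intro computable_foldl computable_intros computable_id computable_const L)
  ultimately show ?thesis by presburger
qed

lemma computable_foldr [computable_intros]: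
  assumes L: "computable L" and A: "computable A"
    and F: "computable (\<lambda>e. F (fst e) (fst (snd e)) (snd (snd e)))"
  shows "computable (\<lambda>x. foldr (\<lambda>h r. F x h r) (L x) (A x))"
proof -
  have "computable (\<lambda>e. F (fst e) (snd (snd e)) (fst (snd e)))"
    by (intro computable_uncurry3[OF F] computable_intros computable_id)
  then have "computable (\<lambda>x. foldl (\<lambda>r h. F x h r) (A x) (rev (L x)))"
    by (intro computable_foldl computable_rev L A)
  then show ?thesis by (simp add: foldl_conv_foldr)
qed

lemma computable_length [computable_intros]: "computable L \<Longrightarrow> computable (\<lambda>x. length (L x))"
proof -
  have "length xs = foldr (\<lambda>_ r. Suc r) xs 0" for xs :: "'b list" by (induction xs) auto
  then show "computable L \<Longrightarrow> ?thesis"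
    by (auto intro!: computable_intros computable_id computable_const)
qed

lemma checkable_list_all [computable_intros]:
  assumes P: "checkable (\<lambda>e. P (fst e) (snd e))" and L: "computable L"
  shows "checkable (\<lambda>x. \<forall>a\<in>set (L x). P x a)"
proof -
  have "(if \<forall>a\<in>set xs. P x a then 1 else 0) = foldr (\<lambda>a r. if P x a then r else 0) xs (1::nat)" for x xs
    by (induction xs) auto
  moreover have "computable (\<lambda>x. foldr (\<lambda>a r. if P x a then r else 0) (L x) (1::nat))"
    by (intro checkable_uncurry[OF P] computable_intros L computable_id computable_const)
  ultimately show ?thesis unfolding checkable_def by presburger
qed


subsection \<open>Integers\<close>

lemma computable_half: "computable A \<Longrightarrow> computable (\<lambda>x. A x div 2 :: nat)"
proof -
  have "n div 2 = rec_nat 0 (\<lambda>n r. if 2 * r = n then r else Suc r) n" for n :: nat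
  proof (induction n)
    case (Suc n)
    then have "rec_nat 0 (\<lambda>n r. if 2 * r = n then r else Suc r) (Suc n)
        = (if 2 * (n div 2) = n then n div 2 else Suc (n div 2))" by simp
    also have "\<dots> = Suc n div 2" by presburger
    finally show ?case by simp
  qed simp
  then show "computable A \<Longrightarrow> ?thesis"
    by (auto intro!: computable_intros computable_id computable_const)
qed

lemma checkable_even [computable_intros]: "computable A \<Longrightarrow> checkable (\<lambda>x. even (A x :: nat))"
proof -
  assume A: "computable A"
  show ?thesis
  proof (rule checkable_cong)
    show "even (A x) \<longleftrightarrow> 2 * (A x div 2) = A x" for x by presburger
    show "checkable (\<lambda>x. 2 * (A x div 2) = A x)"
      by (intro computable_intros computable_half computable_const A)
  qed
qed

lemma computable_nat [computable_intros]: "computable A \<Longrightarrow> computable (\<lambda>x. nat (A x))"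
proof -
  have "nat i = (if even (enc i) then enc i div 2 else 0)" for i :: int
    by (auto simp: enc_int_simps)
  then show "computable A \<Longrightarrow> ?thesis"
    by (auto intro!: computable_intros computable_half computable_const)
qed

lemma computable_nat_uminus: "computable A \<Longrightarrow> computable (\<lambda>x. nat (- A x))"
proof -
  assume A: "computable A"
  show ?thesis
  proof (rule computable_cong)
    show "nat (- A x) = (if even (enc (A x)) then 0 else Suc (enc (A x) div 2))" for x
      by (auto simp: enc_int_simps)
    show "computable (\<lambda>x. if even (enc (A x)) then 0 else Suc (enc (A x) div 2))"
      by (intro computable_intros computable_half computable_const A)
  qed
qed

text \<open>The ring operations on integers are reduced to differences of natural numbers built from
  \<open>nat i\<close> and \<open>nat (- i)\<close>, so a signed code has to be produced only
  here.\<close>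

lemma computable_int_diff:
  assumes "computable A" and "computable B"
  shows "computable (\<lambda>x. int (A x) - int (B x))"
proof (rule computable_from_enc)
  have "enc (int m - int n) = (if n \<le> m then 2 * (m - n) else 2 * (n - m) - 1)" for m n
    by (auto simp: enc_int_simps nat_diff_distrib' simp flip: of_nat_diff)
  moreover have "computable (\<lambda>x. if B x \<le> A x then 2 * (A x - B x) else 2 * (B x - A x) - 1)"
    by (intro computable_intros computable_const assms)
  ultimately show "computable (\<lambda>x. enc (int (A x) - int (B x)))" by presburger
qed

lemma computable_int [computable_intros]: "computable A \<Longrightarrow> computable (\<lambda>x. int (A x))"
  using computable_int_diff[OF _ computable_const[of 0]] by simp

lemma computable_int_add [computable_intros]:
  assumes "computable A" and "computable B"
  shows "computable (\<lambda>x. A x + B x :: int)"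
proof -
  have "i + j = int (nat i + nat j) - int (nat (- i) + nat (- j))" for i j :: int by simp
  then show ?thesis
    by (auto intro!: computable_int_diff computable_intros computable_nat_uminus assms
        simp del: of_nat_add)
qed

lemma computable_int_uminus [computable_intros]:
  "computable A \<Longrightarrow> computable (\<lambda>x. - A x :: int)"
proof -
  assume A: "computable A"
  show ?thesis
  proof (rule computable_cong)
    show "- A x = int (nat (- A x)) - int (nat (A x))" for x by simp
    show "computable (\<lambda>x. int (nat (- A x)) - int (nat (A x)))"
      by (intro computable_int_diff computable_intros computable_nat_uminus A)
  qed
qed

lemma computable_int_minus [computable_intros]:
  "computable A \<Longrightarrow> computable B \<Longrightarrow> computable (\<lambda>x. A x - B x :: int)"
  using computable_int_add[OF _ computable_int_uminus[of B], of A] by simp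

lemma computable_int_mult [computable_intros]:
  assumes "computable A" and "computable B"
  shows "computable (\<lambda>x. A x * B x :: int)"
proof -
  have "i * j = int (nat i * nat j + nat (- i) * nat (- j)) - int (nat i * nat (- j) + nat (- i) * nat j)"
    for i j :: int
    by (cases "0 \<le> i"; cases "0 \<le> j") auto
  then show ?thesis
    by (auto intro!: computable_int_diff computable_intros computable_nat_uminus assms
        simp del: of_nat_add of_nat_mult)
qed

lemma computable_int_abs [computable_intros]: "computable A \<Longrightarrow> computable (\<lambda>x. \<bar>A x :: int\<bar>)"
proof -
  have "\<bar>i\<bar> = int (nat i + nat (- i))" for i :: int by simp
  then show "computable A \<Longrightarrow> ?thesis"
    by (auto intro!: computable_intros computable_nat_uminus simp del: of_nat_add)
qed

lemma checkable_int_le [computable_intros]: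
  assumes "computable A" and "computable B"
  shows "checkable (\<lambda>x. A x \<le> (B x :: int))"
proof -
  have "i \<le> j \<longleftrightarrow> nat (i - j) = 0" for i j :: int by simp
  then show ?thesis by (auto intro!: checkable_eq_0 computable_intros assms simp del: nat_0_iff)
qed

lemma checkable_int_less [computable_intros]:
  assumes "computable A" and "computable B"
  shows "checkable (\<lambda>x. A x < (B x :: int))"
  using checkable_not[OF checkable_int_le[OF assms(2,1)]] by (simp add: not_le)

lemma checkable_int_even [computable_intros]: "computable A \<Longrightarrow> checkable (\<lambda>x. even (A x :: int))"
proof -
  assume A: "computable A"
  show ?thesis
  proof (rule checkable_cong)
    show "even (A x) \<longleftrightarrow> even (nat \<bar>A x\<bar>)" for x by (simp add: even_nat_iff)
    show "checkable (\<lambda>x. even (nat \<bar>A x\<bar>))" by (intro computable_intros A)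
  qed
qed

lemma computable_power [computable_intros]:
  assumes A: "computable (A :: 'a::enc \<Rightarrow> int)" and N: "computable N"
  shows "computable (\<lambda>x. A x ^ N x)"
proof -
  have "i ^ n = rec_nat 1 (\<lambda>_ r. i * r) n" for i :: int and n by (induction n) auto
  then show ?thesis
    by (auto intro!: computable_intros computable_compose[OF A] computable_id computable_const N)
qed

lemma computable_prod_lessThan [computable_intros]:
  assumes F: "computable (\<lambda>e. F (fst e) (snd e))" and N: "computable (N :: _ \<Rightarrow> nat)"
  shows "computable (\<lambda>x. \<Prod>k<N x. F x k :: int)"
proof -
  have "(\<Prod>k<n. F x k) = rec_nat 1 (\<lambda>k r. F x k * r) n" for x and n :: nat by (induction n) auto
  then show ?thesis
    by (simp only:) (intro computable_uncurry[OF F] computable_intros computable_id computable_const N)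
qed

lemma computable_prod_list [computable_intros]:
  assumes F: "computable (\<lambda>e. F (fst e) (snd e))" and L: "computable L"
  shows "computable (\<lambda>x. \<Prod>a\<leftarrow>L x. F x a :: int)"
proof -
  have "(\<Prod>a\<leftarrow>xs. F x a) = foldr (\<lambda>a r. F x a * r) xs 1" for x xs by (induction xs) auto
  then show ?thesis
    by (simp only:) (intro computable_uncurry[OF F] computable_intros computable_id computable_const L)
qed

lemma computable_sum_list_int [computable_intros]:
  assumes F: "computable (\<lambda>e. F (fst e) (snd e))" and L: "computable L"
  shows "computable (\<lambda>x. \<Sum>a\<leftarrow>L x. F x a :: int)"
proof -
  have "(\<Sum>a\<leftarrow>xs. F x a) = foldr (\<lambda>a r. F x a + r) xs 0" for x xs by (induction xs) auto
  then show ?thesis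
    by (simp only:) (intro computable_uncurry[OF F] computable_intros computable_id computable_const L)
qed

lemma computable_sum_list_nat [computable_intros]:
  assumes F: "computable (\<lambda>e. F (fst e) (snd e))" and L: "computable L"
  shows "computable (\<lambda>x. \<Sum>a\<leftarrow>L x. F x a :: nat)"
proof -
  have "(\<Sum>a\<leftarrow>xs. F x a) = foldr (\<lambda>a r. F x a + r) xs 0" for x xs by (induction xs) auto
  then show ?thesis
    by (simp only:) (intro computable_uncurry[OF F] computable_intros computable_id computable_const L)
qed


subsection \<open>Semidecidable predicates\<close>

definition semidecidable :: "('a::enc \<Rightarrow> bool) \<Rightarrow> bool" where
  "semidecidable P \<longleftrightarrow> (\<exists>R. checkable R \<and> (\<forall>x. P x \<longleftrightarrow> (\<exists>c::nat. R (x, c))))"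

lemma semidecidable_checkable: "checkable P \<Longrightarrow> semidecidable P"
  unfolding semidecidable_def
  by (rule exI[of _ "\<lambda>e. P (fst e)"])
    (auto intro: checkable_compose[OF _ computable_fst[OF computable_id]])

text \<open>A single number encodes the witness \<open>y\<close> together with its own certificate;
  decoding is total, so every number names such a pair.\<close>

lemma semidecidable_ex:
  assumes "semidecidable (\<lambda>e. P (fst e) (snd e))"
  shows "semidecidable (\<lambda>x. \<exists>y. P x y)"
proof -
  obtain R where R: "checkable R" and P: "\<And>x y. P x y \<longleftrightarrow> (\<exists>c::nat. R ((x, y), c))"
    using assms unfolding semidecidable_def by auto
  let ?R = "\<lambda>e::'a \<times> nat. R ((fst e, fst (dec (snd e) :: 'b \<times> nat)), snd (dec (snd e) :: 'b \<times> nat))"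
  have "(\<exists>y. P x y) \<longleftrightarrow> (\<exists>c. ?R (x, c))" for x
  proof
    assume "\<exists>y. P x y"
    then obtain y c where "R ((x, y), c)" unfolding P by blast
    then have "?R (x, enc (y, c))" by simp
    then show "\<exists>c. ?R (x, c)" by blast
  qed (auto simp: P)
  moreover have "checkable ?R"
    by (intro checkable_compose[OF R] computable_intros computable_id)
  ultimately show ?thesis
    unfolding semidecidable_def by (intro exI[of _ ?R] conjI allI)
qed

lemma semidecidable_disj:
  assumes "semidecidable P" and "semidecidable Q"
  shows "semidecidable (\<lambda>x. P x \<or> Q x)"
proof -
  obtain R where R: "checkable R" and P: "\<And>x. P x \<longleftrightarrow> (\<exists>c::nat. R (x, c))"
    using assms(1) unfolding semidecidable_def by auto
  obtain S where S: "checkable S" and Q: "\<And>x. Q x \<longleftrightarrow> (\<exists>c::nat. S (x, c))"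
    using assms(2) unfolding semidecidable_def by auto
  have "checkable (\<lambda>e. R e \<or> S e)" by (intro computable_intros R S)
  moreover have "\<forall>x. P x \<or> Q x \<longleftrightarrow> (\<exists>c. R (x, c) \<or> S (x, c))"
    unfolding P Q by blast
  ultimately show ?thesis
    unfolding semidecidable_def by (intro exI[of _ "\<lambda>e. R e \<or> S e"] conjI)
qed

lemma semidecidable_conj:
  assumes "semidecidable P" and "semidecidable Q"
  shows "semidecidable (\<lambda>x. P x \<and> Q x)"
proof -
  obtain R where R: "checkable R" and P: "\<And>x. P x \<longleftrightarrow> (\<exists>c::nat. R (x, c))"
    using assms(1) unfolding semidecidable_def by auto
  obtain S where S: "checkable S" and Q: "\<And>x. Q x \<longleftrightarrow> (\<exists>c::nat. S (x, c))"
    using assms(2) unfolding semidecidable_def by auto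
  have "semidecidable (\<lambda>x. \<exists>c d::nat. R (x, c) \<and> S (x, d))"
    by (intro semidecidable_ex semidecidable_checkable computable_intros
        checkable_compose[OF R] checkable_compose[OF S] computable_id)
  moreover have "P x \<and> Q x \<longleftrightarrow> (\<exists>c d. R (x, c) \<and> S (x, d))" for x
    unfolding P Q by blast
  ultimately show ?thesis by presburger
qed

text \<open>Both searches run in parallel: \<open>Mu\<close> stops at the first number certifying
  either \<open>Y\<close> or \<open>N\<close>, which exists on every instance, and testing
  \<open>R\<close> there tells which of the two it was.\<close>

lemma decidable_on_if_semidecidable:
  fixes code :: "'a \<Rightarrow> nat" and data :: "'a \<Rightarrow> 'b::enc"
  assumes conv: "\<exists>r. \<forall>x\<in>I. computes r [code x] (enc (data x))"
    and yes: "semidecidable Y" and no: "semidecidable N"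
    and Y: "\<And>x. x \<in> I \<Longrightarrow> P x \<longleftrightarrow> Y (data x)"
    and N: "\<And>x. x \<in> I \<Longrightarrow> \<not> P x \<longleftrightarrow> N (data x)"
  shows "decidable_on code I P"
proof -
  obtain r where r: "\<And>x. x \<in> I \<Longrightarrow> computes r [code x] (enc (data x))"
    using conv by blast
  obtain R where R: "checkable R" and YR: "\<And>x. Y x \<longleftrightarrow> (\<exists>c::nat. R (x, c))"
    using yes unfolding semidecidable_def by auto
  obtain S where S: "checkable S" and NS: "\<And>x. N x \<longleftrightarrow> (\<exists>c::nat. S (x, c))"
    using no unfolding semidecidable_def by auto
  obtain f where f': "\<And>e. computes f [enc e] (enc (if \<not> (R e \<or> S e) then 1 else 0::nat))"
    using checkable_not[OF checkable_disj[OF R S]] unfolding checkable_def computable_def by blast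
  have f: "computes f [prod_encode (enc x, c)] (if \<not> (R (x, c) \<or> S (x, c)) then 1 else 0)" for x c
    using f'[of "(x, c)"] by (simp only: enc_simps)
  obtain g where g': "\<And>e. computes g [enc e] (enc (if R e then 1 else 0::nat))"
    using R unfolding checkable_def computable_def by blast
  have g: "computes g [prod_encode (enc x, c)] (if R (x, c) then 1 else 0)" for x c
    using g'[of "(x, c)"] by (simp only: enc_simps)
  obtain p where p: "\<And>x y. computes p [x, y] (prod_encode (x, y))"
    using computable2_prod_encode by (auto simp: computable2_def)
  define h where "h = Comp f [Comp p [Proj 1, Proj 0]]"
  have h: "computes h [c, enc x] (if \<not> (R (x, c) \<or> S (x, c)) then 1 else 0)" for c x
    unfolding h_def by (rule computes_Comp1 computes_Comp2 computes_Proj' p f)+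
  have "computes (Comp (Comp g [Comp p [Proj 0, Mu h]]) [r]) [code x] (if P x then 1 else 0)"
    if x: "x \<in> I" for x
  proof -
    let ?T = "\<lambda>c. R (data x, c) \<or> S (data x, c)"
    define c where "c = (LEAST c. ?T c)"
    have "\<exists>c. ?T c" using Y[OF x] N[OF x] YR NS by blast
    then have c: "?T c" unfolding c_def by (rule LeastI_ex)
    have Mu: "computes (Mu h) [enc (data x)] c"
    proof (rule computes_Mu)
      show "computes h [c, enc (data x)] 0" using h[of c "data x"] c by simp
      fix m assume "m < c"
      then have "\<not> ?T m" unfolding c_def by (rule not_less_Least)
      then show "\<exists>k. computes h [m, enc (data x)] (Suc k)"
        using h[of m "data x"] by auto
    qed
    have "R (data x, c) \<longleftrightarrow> P x" using c Y[OF x] N[OF x] YR NS by blast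
    then have "computes g [prod_encode (enc (data x), c)] (if P x then 1 else 0)"
      using g[of "data x" c] by simp
    then show ?thesis
      by (intro computes_Comp1[OF r[OF x]] computes_Comp1[OF computes_Comp2[OF computes_Proj'(1) Mu p]])
  qed
  then show ?thesis unfolding decidable_on_def by blast
qed


section \<open>Integer polynomials\<close>

definition ipoly :: "int poly \<Rightarrow> 'a::comm_ring_1 \<Rightarrow> 'a" where
  "ipoly p x = poly (map_poly of_int p) x"

lemma ipoly_0 [simp]: "ipoly 0 x = 0"
  by (simp add: ipoly_def)

lemma ipoly_pCons [simp]: "ipoly (pCons a p) x = of_int a + x * ipoly p x"
  by (simp add: ipoly_def map_poly_pCons)

lemma ipoly_add [simp]: "ipoly (p + q) x = ipoly p x + ipoly q x"
  by (induction p q rule: poly_induct2) (simp_all add: algebra_simps)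

lemma ipoly_uminus [simp]: "ipoly (- p) x = - ipoly p x"
  by (induction p) simp_all

lemma ipoly_diff [simp]: "ipoly (p - q) x = ipoly p x - ipoly q x"
  using ipoly_add[of p "- q" x] by simp

lemma ipoly_smult [simp]: "ipoly (smult c p) x = of_int c * ipoly p x"
  by (induction p) (simp_all add: algebra_simps)

lemma ipoly_mult [simp]: "ipoly (p * q) x = ipoly p x * ipoly q x"
  by (induction p) (simp_all add: algebra_simps)

lemma ipoly_1 [simp]: "ipoly 1 x = 1"
  by (simp add: one_pCons)

lemma ipoly_power [simp]: "ipoly (p ^ n) x = ipoly p x ^ n"
  by (induction n) simp_all

lemma ipoly_prod_list: "ipoly (prod_list ps) x = (\<Prod>p\<leftarrow>ps. ipoly p x)"
  by (induction ps) simp_all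

lemma ipoly_of_int: "ipoly p (of_int k) = of_int (poly p k)"
  by (induction p) simp_all

text \<open>This makes a polynomial identity with a known degree bound checkable by a program that
  only evaluates at integers.\<close>

lemma poly_eq_if_eq_on_nats:
  fixes p q :: "int poly"
  assumes "degree p < n" and "degree q < n" and "\<And>k. k < n \<Longrightarrow> poly p (int k) = poly q (int k)"
  shows "p = q"
proof (rule poly_eqI_degree[of "int ` {..<n}"])
  show "card (int ` {..<n}) > degree p" "card (int ` {..<n}) > degree q"
    using assms(1,2) by (simp_all add: card_image)
qed (use assms(3) in auto)

lemma degree_prod_list_less_eq:
  "(\<And>x. x \<in> set xs \<Longrightarrow> degree (f x) \<le> g x) \<Longrightarrow> degree (\<Prod>x\<leftarrow>xs. f x) \<le> (\<Sum>x\<leftarrow>xs. g x)"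
  by (induction xs) (auto intro: order.trans[OF degree_mult_le] add_mono)


subsection \<open>Sign of integer polynomials\<close>

text \<open>Serves as an explicit root bound: at every larger integer an integer polynomial has the
  sign of its leading coefficient, so one evaluation settles all later signs.\<close>

definition pnorm :: "int poly \<Rightarrow> int" where
  "pnorm p = (\<Sum>a\<leftarrow>coeffs p. \<bar>a\<bar>)"

lemma pnorm_0 [simp]: "pnorm 0 = 0"
  by (simp add: pnorm_def)

lemma pnorm_pCons [simp]: "pnorm (pCons a p) = \<bar>a\<bar> + pnorm p"
  by (cases "p = 0"; cases "a = 0") (simp_all add: pnorm_def cCons_def)

lemma pnorm_nonneg [simp]: "0 \<le> pnorm p"
  by (induction p) simp_all

lemma pnorm_add: "pnorm (p + q) \<le> pnorm p + pnorm q"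
  by (induction p q rule: poly_induct2) simp_all

lemma pnorm_smult: "pnorm (smult c p) = \<bar>c\<bar> * pnorm p"
  by (induction p) (simp_all add: abs_mult algebra_simps)

lemma pnorm_diff: "pnorm (p - q) \<le> pnorm p + pnorm q"
  using pnorm_add[of p "smult (-1) q"] pnorm_smult[of "-1" q] by simp

lemma sgn_poly_eq_lead_coeff:
  assumes "pnorm p < k"
  shows "sgn (poly p k) = sgn (lead_coeff p)"
proof (cases "p = 0")
  case False
  \<comment> \<open>The strengthening by 1, available because values are integers, carries the
    Horner step: \<open>k * poly p k\<close> then has absolute value at least \<open>k\<close> and
    outweighs the new constant \<open>a\<close>.\<close>
  have "sgn (poly p k) = sgn (lead_coeff p) \<and> 1 \<le> \<bar>poly p k\<bar>"
    using False assms
  proof (induction p)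
    case (pCons a p)
    show ?case
    proof (cases "p = 0")
      case False
      with pCons have IH: "sgn (poly p k) = sgn (lead_coeff p)" "1 \<le> \<bar>poly p k\<bar>"
        by auto
      have k: "\<bar>a\<bar> < k"
        using pCons.prems pnorm_nonneg[of p] unfolding pnorm_pCons by linarith
      have "\<bar>k\<bar> * 1 \<le> \<bar>k\<bar> * \<bar>poly p k\<bar>"
        by (rule mult_left_mono) (use IH in auto)
      then have "k \<le> \<bar>k * poly p k\<bar>" using k by (simp add: abs_mult)
      then have "sgn (a + k * poly p k) = sgn (k * poly p k)" "1 \<le> \<bar>a + k * poly p k\<bar>"
        using k by (auto simp: sgn_if)
      then show ?thesis
        using IH k False by (auto simp: sgn_mult)
    qed (use pCons in auto)
  qed simp
  then show ?thesis by simp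
qed simp

lemma sgn_poly_eventually_const:
  assumes "pnorm p < k" and "k \<le> l"
  shows "sgn (poly p l) = sgn (poly p k)"
  using assms by (simp add: sgn_poly_eq_lead_coeff)


section \<open>Power relations between two real numbers\<close>

text \<open>Division by an annihilator \<open>m\<close> of least degree leaves remainder 0. Over the
  integers only pseudo-division is available, whence the factor \<open>c\<close>; for transcendental
  \<open>y\<close> the choice \<open>m = 0\<close> works.\<close>

lemma annihilator_principal:
  fixes y :: real
  shows "\<exists>m. ipoly m y = 0 \<and> (\<forall>p. ipoly p y = 0 \<longrightarrow> (\<exists>c h. c \<noteq> 0 \<and> smult c p = m * h))"
proof (cases "\<exists>m. m \<noteq> 0 \<and> ipoly m y = 0")
  case True
  define m where "m = arg_min degree (\<lambda>m. m \<noteq> 0 \<and> ipoly m y = 0)"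
  have m: "m \<noteq> 0" "ipoly m y = 0"
    using arg_min_natI[of "\<lambda>m. m \<noteq> 0 \<and> ipoly m y = 0", of _ degree] True by (auto simp: m_def)
  have least: "degree m \<le> degree p" if "p \<noteq> 0" "ipoly p y = 0" for p
    using that by (auto simp: m_def intro: arg_min_nat_le)
  show ?thesis
  proof (rule exI[of _ m], intro conjI allI impI, rule m(2))
    fix p assume p: "ipoly p y = 0"
    obtain c h where c: "c \<noteq> 0" and h: "smult c p = m * h + pseudo_mod p m"
      using pseudo_mod(1)[OF m(1)] by blast
    have "ipoly (m * h + pseudo_mod p m) y = 0"
      using p by (simp flip: h)
    then have "ipoly (pseudo_mod p m) y = 0"
      using m(2) by simp
    then have "pseudo_mod p m = 0"
      using pseudo_mod(2)[OF m(1), of p] least by fastforce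
    with h have "c \<noteq> 0 \<and> smult c p = m * h" using c by simp
    then show "\<exists>c h. c \<noteq> 0 \<and> smult c p = m * h" by blast
  qed
next
  case False
  show ?thesis
    by (rule exI[of _ 0]) (use False in \<open>auto intro!: exI[of _ 1]\<close>)
qed

text \<open>The exponents \<open>e\<close> with \<open>z ^ e \<in> \<rat>(y)\<close> form a cyclic group, generated by some \<open>l\<close> with
  \<open>z ^ l = g\<^sub>1 y / g\<^sub>2 y\<close>, and the integer polynomials vanishing at \<open>y\<close> are essentially
  the multiples of a single \<open>m\<close>. These finitely many data make all relations
  \<open>z ^ e\<^sub>1 * A y = z ^ e\<^sub>2 * B y\<close> recognisable, whether or not \<open>y\<close> and \<open>z\<close> are algebraically
  independent.\<close>

lemma power_relation:
  fixes y z :: real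
  assumes z: "z \<noteq> 0"
  shows "\<exists>m g1 g2 l. \<forall>A B e1 e2. ipoly A y \<noteq> 0 \<longrightarrow> ipoly B y \<noteq> 0 \<longrightarrow>
      z ^ e1 * ipoly A y = z ^ e2 * ipoly B y \<longleftrightarrow>
      (\<exists>j1 j2 c h. c \<noteq> 0 \<and> e1 + l * j2 = e2 + l * j1 \<and>
        smult c (g1 ^ j1 * g2 ^ j2 * A - g2 ^ j1 * g1 ^ j2 * B) = m * h)"
proof -
  \<comment> \<open>\<open>J n g1 g2\<close> exhibits a positive exponent \<open>n\<close> for which
    \<open>z ^ n\<close> is the value at \<open>y\<close> of the rational function with numerator
    \<open>g1\<close> and denominator \<open>g2\<close>.\<close>
  define J where "J n g1 g2 \<longleftrightarrow> n > (0::nat) \<and> ipoly g1 y \<noteq> 0 \<and> ipoly g2 y \<noteq> 0 \<and>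
      z ^ n * ipoly g2 y = ipoly g1 y" for n g1 g2
  obtain l g1 g2 where nz: "ipoly g1 y \<noteq> 0" "ipoly g2 y \<noteq> 0"
    and gen: "z ^ l * ipoly g2 y = ipoly g1 y"
    and dvd: "\<And>n h1 h2. J n h1 h2 \<Longrightarrow> l dvd n"
  proof (cases "\<exists>n h1 h2. J n h1 h2")
    case True
    define l where "l = (LEAST n. \<exists>h1 h2. J n h1 h2)"
    have "\<exists>h1 h2. J l h1 h2" unfolding l_def by (rule LeastI_ex) (rule True)
    then obtain g1 g2 where g: "J l g1 g2" by blast
    show ?thesis
    proof (rule that[of g1 g2 l])
      fix n h1 h2 assume h: "J n h1 h2"
      define q r where "q = n div l" and "r = n mod l"
      have n: "n = l * q + r" and r: "r < l"
        using g by (auto simp: q_def r_def J_def)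
      show "l dvd n"
      proof (rule ccontr)
        assume "\<not> l dvd n"
        then have "r > 0" by (auto simp: r_def dvd_eq_mod_eq_0)
        \<comment> \<open>Euclidean division of exponents: \<open>z ^ r\<close> is the quotient of
          \<open>z ^ n\<close> and the \<open>q\<close>-th power of \<open>z ^ l\<close>, so a
          nonzero remainder \<open>r\<close> would contradict the minimality of
          \<open>l\<close>.\<close>
        have "z ^ r * ipoly (g1 ^ q * h2) y = ipoly (g2 ^ q * h1) y"
        proof -
          have "z ^ r * (ipoly g1 y ^ q * ipoly h2 y)
              = z ^ r * ((z ^ l * ipoly g2 y) ^ q * ipoly h2 y)"
            using g by (simp add: J_def)
          also have "\<dots> = ipoly g2 y ^ q * (z ^ n * ipoly h2 y)"
            unfolding n by (simp add: power_mult_distrib power_mult power_add mult_ac)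
          also have "z ^ n * ipoly h2 y = ipoly h1 y" using h by (simp add: J_def)
          finally show ?thesis by simp
        qed
        then have "J r (g2 ^ q * h1) (g1 ^ q * h2)"
          using g h \<open>r > 0\<close> by (simp add: J_def)
        then have "l \<le> r" unfolding l_def by (intro Least_le) blast
        with r show False by simp
      qed
    qed (use g in \<open>simp_all add: J_def\<close>)
  next
    \<comment> \<open>If no positive exponent occurs, \<open>l = 0\<close> and
      \<open>g1 = g2 = 1\<close> make the criterion demand \<open>e1 = e2\<close>.\<close>
    case False
    show ?thesis
    proof (rule that[of 1 1 0])
      show "0 dvd n" if "J n h1 h2" for n h1 h2 using False that by blast
    qed simp_all
  qed
  obtain m where m: "ipoly m y = 0"
    and ann: "\<And>p. ipoly p y = 0 \<Longrightarrow> \<exists>c h. c \<noteq> 0 \<and> smult c p = m * h"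
    using annihilator_principal[of y] by auto
  let ?P = "\<lambda>A B j1 j2. g1 ^ j1 * g2 ^ j2 * A - g2 ^ j1 * g1 ^ j2 * B"
  have multiple: "\<exists>j. e = l * j" if "z ^ e * ipoly A y = ipoly B y" "ipoly A y \<noteq> 0" "ipoly B y \<noteq> 0"
    for e A B
  proof (cases "e = 0")
    case False
    with that have "J e B A" by (simp add: J_def)
    from dvd[OF this] show ?thesis by (auto simp: dvd_def)
  qed auto
  show ?thesis
  proof (rule exI[of _ m], rule exI[of _ g1], rule exI[of _ g2], rule exI[of _ l], intro allI impI)
    fix A B :: "int poly" and e1 e2 :: nat
    assume A: "ipoly A y \<noteq> 0" and B: "ipoly B y \<noteq> 0"
    show "z ^ e1 * ipoly A y = z ^ e2 * ipoly B y \<longleftrightarrow>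
      (\<exists>j1 j2 c h. c \<noteq> 0 \<and> e1 + l * j2 = e2 + l * j1 \<and> smult c (?P A B j1 j2) = m * h)"
      (is "?L \<longleftrightarrow> ?R")
    proof
      assume L: ?L
      \<comment> \<open>The integer \<open>(e1 - e2) / l\<close> is split into natural parts
        \<open>j1 - j2\<close>; the sign of \<open>e1 - e2\<close> decides which part is 0.\<close>
      have "\<exists>j1 j2. e1 + l * j2 = e2 + l * j1 \<and> ipoly (?P A B j1 j2) y = 0"
      proof (cases "e2 \<le> e1")
        case True
        then have "z ^ e2 * (z ^ (e1 - e2) * ipoly A y) = z ^ e2 * ipoly B y"
          using L by (simp flip: power_add mult.assoc)
        then have e: "z ^ (e1 - e2) * ipoly A y = ipoly B y"
          using z by simp
        from multiple[OF e A B] obtain j where j: "e1 - e2 = l * j" by blast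
        have "ipoly (?P A B j 0) y = ipoly g2 y ^ j * ((z ^ l) ^ j * ipoly A y - ipoly B y)"
          by (simp add: gen[symmetric] power_mult_distrib algebra_simps)
        moreover have "(z ^ l) ^ j = z ^ (e1 - e2)" by (simp add: j power_mult)
        ultimately show ?thesis
          using e j True by (intro exI[of _ j] exI[of _ 0]) simp
      next
        case False
        then have "z ^ e1 * ipoly A y = z ^ e1 * (z ^ (e2 - e1) * ipoly B y)"
          using L by (simp flip: power_add mult.assoc)
        then have e: "z ^ (e2 - e1) * ipoly B y = ipoly A y"
          using z by simp
        from multiple[OF e B A] obtain j where j: "e2 - e1 = l * j" by blast
        have "ipoly (?P A B 0 j) y = ipoly g2 y ^ j * (ipoly A y - (z ^ l) ^ j * ipoly B y)"
          by (simp add: gen[symmetric] power_mult_distrib algebra_simps)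
        moreover have "(z ^ l) ^ j = z ^ (e2 - e1)" by (simp add: j power_mult)
        ultimately show ?thesis
          using e j False by (intro exI[of _ 0] exI[of _ j]) simp
      qed
      then obtain j1 j2 where j: "e1 + l * j2 = e2 + l * j1" "ipoly (?P A B j1 j2) y = 0"
        by blast
      from ann[OF j(2)] j(1) show ?R by blast
    next
      assume ?R
      then obtain j1 j2 c h where c: "c \<noteq> 0" and j: "e1 + l * j2 = e2 + l * j1"
        and h: "smult c (?P A B j1 j2) = m * h" by blast
      have "of_int c * ipoly (?P A B j1 j2) y = ipoly m y * ipoly h y"
        using arg_cong[OF h, of "\<lambda>p. ipoly p y"] by (simp only: ipoly_smult ipoly_mult)
      then have "ipoly (?P A B j1 j2) y = 0"
        using c m by simp
      \<comment> \<open>Substituting \<open>z ^ l * g2\<close> for \<open>g1\<close> produces the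
        common nonzero factor \<open>g2 ^ (j1 + j2)\<close> on both sides.\<close>
      then have "ipoly g2 y ^ (j1 + j2) * (z ^ (l * j1) * ipoly A y)
          = ipoly g2 y ^ (j1 + j2) * (z ^ (l * j2) * ipoly B y)"
        unfolding power_mult by (simp add: gen[symmetric] power_mult_distrib power_add mult_ac)
      then have AB: "z ^ (l * j1) * ipoly A y = z ^ (l * j2) * ipoly B y"
        using nz(2) by simp
      have "z ^ (l * (j1 + j2)) * (z ^ e1 * ipoly A y) = z ^ (e1 + l * j2) * (z ^ (l * j1) * ipoly A y)"
        by (simp add: power_add distrib_left mult_ac)
      also have "\<dots> = z ^ (e2 + l * j1) * (z ^ (l * j2) * ipoly B y)"
        by (simp only: AB j)
      also have "\<dots> = z ^ (l * (j1 + j2)) * (z ^ e2 * ipoly B y)"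
        by (simp add: power_add distrib_left mult_ac)
      finally show ?L using z by simp
    qed
  qed
qed


section \<open>Roots in an imaginary quadratic field\<close>

text \<open>A pair \<open>(m, b)\<close> stands for the root \<open>(m + b \<surd>d) / 2\<close>; \<open>quad d (m, b) k\<close> is the squared
  absolute value of \<open>2 k - (m + b \<surd>d)\<close>, an integer even when the root is not.\<close>

definition quad :: "int \<Rightarrow> int \<times> nat \<Rightarrow> int \<Rightarrow> int" where
  "quad d = (\<lambda>(m, b) k. (2 * k - m)\<^sup>2 - d * (int b)\<^sup>2)"

definition quad_root :: "int \<Rightarrow> int \<times> nat \<Rightarrow> complex" where
  "quad_root d = (\<lambda>(m, b). (of_int m + \<i> * of_nat b * of_real (sqrt (- of_int d))) / 2)"

lemma quad_factor:
  assumes "d < 0"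
  shows "of_int (quad d r k) = 4 * (of_int k - quad_root d r) * (of_int k - cnj (quad_root d r))"
proof -
  obtain m b where r: "r = (m, b)" by (cases r)
  let ?s = "sqrt (- real_of_int d)"
  have s: "?s * ?s = - of_int d" using assms by simp
  have "complex_of_real ?s * complex_of_real ?s = - of_int d"
    unfolding of_real_mult[symmetric] s by simp
  then show ?thesis
    by (simp add: r quad_def quad_root_def field_simps power2_eq_square)
qed

text \<open>With \<open>r\<close> in lowest terms, the square of its denominator divides
  \<open>d\<close>, so the denominator is 1.\<close>

lemma squarefree_rational_square:
  fixes d k :: int and r :: real
  assumes "squarefree d" and "r \<in> \<rat>" and "of_int d * r\<^sup>2 = of_int k"
  shows "r \<in> \<int>"
proof -
  obtain a b :: int where b: "b > 0" "coprime a b" and r: "r = of_int a / of_int b"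
    using \<open>r \<in> \<rat>\<close> by (auto elim: Rats_cases')
  have "real_of_int (d * a\<^sup>2) = of_int (k * b\<^sup>2)"
    using assms(3) b by (simp add: r field_simps)
  then have eq: "d * a\<^sup>2 = k * b\<^sup>2" by (simp only: of_int_eq_iff)
  then have "b\<^sup>2 dvd d * a\<^sup>2" by simp
  moreover have "coprime (b\<^sup>2) (a\<^sup>2)" using b by (simp add: coprime_commute)
  ultimately have "b\<^sup>2 dvd d" by (simp add: coprime_dvd_mult_left_iff)
  then have "b dvd 1" using assms(1) by (rule squarefreeD[rotated])
  then have "b = 1" using b by simp
  then show ?thesis by (simp add: r)
qed

text \<open>Gauss's lemma by hand. The non-real \<alpha> is a root of a primitive quadratic
  \<open>g\<close>; the pseudo-remainder of \<open>p\<close> by \<open>g\<close> has degree at most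
  1 and vanishes at \<alpha>, hence is 0. Then \<open>g\<close> divides the monic \<open>p\<close>,
  its leading coefficient is a unit, and trace and norm of \<alpha> are integers.\<close>

lemma monic_root_quadratic_integer:
  fixes p :: "int poly" and \<alpha> :: complex
  assumes root: "ipoly p \<alpha> = 0" and monic: "lead_coeff p = 1"
    and "Im \<alpha> \<noteq> 0" and u: "Re \<alpha> \<in> \<rat>" and v: "(cmod \<alpha>)\<^sup>2 \<in> \<rat>"
  shows "2 * Re \<alpha> \<in> \<int>" and "(cmod \<alpha>)\<^sup>2 \<in> \<int>"
proof -
  obtain a b :: int where b: "b > 0" and a: "Re \<alpha> = of_int a / of_int b"
    using u by (auto elim: Rats_cases')
  obtain a' b' :: int where b': "b' > 0" and a': "(cmod \<alpha>)\<^sup>2 = of_int a' / of_int b'"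
    using v by (auto elim: Rats_cases')
  have quadratic: "\<alpha>\<^sup>2 - 2 * of_real (Re \<alpha>) * \<alpha> + of_real ((cmod \<alpha>)\<^sup>2) = 0"
    by (simp add: complex_eq_iff cmod_def power2_eq_square)
  have independent: "c0 = 0 \<and> c1 = 0" if "of_real c0 + of_real c1 * \<alpha> = 0" for c0 c1 :: real
    using that \<open>Im \<alpha> \<noteq> 0\<close> by (auto simp: complex_eq_iff)
  define G where "G = [:b * a', - 2 * a * b', b * b':]"
  have "ipoly G \<alpha> = of_int (b * b') * (\<alpha>\<^sup>2 - 2 * of_real (Re \<alpha>) * \<alpha> + of_real ((cmod \<alpha>)\<^sup>2))"
    unfolding a a' G_def using b b' by (simp add: field_simps power2_eq_square)
  then have G: "ipoly G \<alpha> = 0" using quadratic by simp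
  define g where "g = primitive_part G"
  have "G \<noteq> 0" using b b' by (simp add: G_def)
  then have content: "Polynomial.content g = 1" and Gg: "G = smult (Polynomial.content G) g"
    by (simp_all add: g_def)
  have "degree G = 2" using b b' by (simp add: G_def)
  then have deg: "degree g = 2" by (simp add: g_def)
  have g: "ipoly g \<alpha> = 0"
    using G \<open>G \<noteq> 0\<close> by (subst (asm) Gg) simp
  have "g \<noteq> 0" using deg by auto
  obtain c q where c: "c \<noteq> 0" and q: "smult c p = g * q + pseudo_mod p g"
    using pseudo_mod(1)[OF \<open>g \<noteq> 0\<close>] by blast
  have "ipoly (g * q + pseudo_mod p g) \<alpha> = 0" using root by (simp flip: q)
  then have rem: "ipoly (pseudo_mod p g) \<alpha> = 0" using g by simp
  have "pseudo_mod p g = 0"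
  proof (rule ccontr)
    assume nz: "pseudo_mod p g \<noteq> 0"
    then have "degree (pseudo_mod p g) < 2"
      using pseudo_mod(2)[OF \<open>g \<noteq> 0\<close>, of p] deg by simp
    then have "pseudo_mod p g = [:coeff (pseudo_mod p g) 0, coeff (pseudo_mod p g) 1:]"
      by (intro poly_eqI) (auto simp: coeff_pCons coeff_eq_0 split: nat.splits)
    then obtain c0 c1 where r: "pseudo_mod p g = [:c0, c1:]" by blast
    then have "of_real (of_int c0) + of_real (of_int c1) * \<alpha> = 0"
      using rem by (simp add: mult.commute)
    from independent[OF this] nz r show False by simp
  qed
  with q have q: "smult c p = g * q" by simp
  have "Polynomial.content p dvd lead_coeff p" by simp
  then have "Polynomial.content p = 1"
    using monic by (metis is_unit_normalize normalize_content)
  then have "Polynomial.content q = \<bar>c\<bar>"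
    using arg_cong[OF q, of Polynomial.content] content by (simp add: Polynomial.content_mult)
  \<comment> \<open>Multiplicativity of the content lets the constant \<open>c\<close> from
    pseudo-division be cancelled, giving true divisibility over the integers.\<close>
  then have "[:c:] dvd q" by (simp add: const_poly_dvd_iff_dvd_content)
  then obtain q' where "q = smult c q'" by (auto simp: dvd_def)
  with q c have "smult c p = smult c (g * q')" by simp
  then have "smult c (p - g * q') = 0" by (simp only: smult_diff_right right_minus_eq)
  with c have "p = g * q'" by simp
  then have "lead_coeff g * lead_coeff q' = 1" using monic lead_coeff_mult[of g q'] by simp
  then have "lead_coeff g dvd 1" by (metis dvd_triv_left)
  then have lead: "coeff g 2 = 1 \<or> coeff g 2 = -1" using deg by auto
  obtain c0 c1 c2 where gc: "g = [:c0, c1, c2:]"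
  proof
    show "g = [:coeff g 0, coeff g 1, coeff g 2:]"
      using deg by (intro poly_eqI) (auto simp: coeff_pCons coeff_eq_0 numeral_2_eq_2 split: nat.splits)
  qed
  have c2: "c2 * c2 = 1" using lead by (auto simp: gc numeral_2_eq_2)
  have "of_int c0 + of_int c1 * \<alpha> + of_int c2 * \<alpha>\<^sup>2 = 0"
    using g by (simp add: gc algebra_simps power2_eq_square)
  moreover have "\<alpha>\<^sup>2 = 2 * of_real (Re \<alpha>) * \<alpha> - of_real ((cmod \<alpha>)\<^sup>2)"
    using quadratic by (simp add: algebra_simps add_eq_0_iff)
  ultimately have "of_real (of_int c0 - of_int c2 * (cmod \<alpha>)\<^sup>2)
      + of_real (of_int c1 + 2 * of_int c2 * Re \<alpha>) * \<alpha> = 0"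
    by (simp add: algebra_simps)
  from independent[OF this]
  have e: "of_int c0 = of_int c2 * (cmod \<alpha>)\<^sup>2" "of_int c1 = - of_int c2 * (2 * Re \<alpha>)" by auto
  have c2': "real_of_int c2 * of_int c2 = 1" using c2 by (metis of_int_mult of_int_1)
  have "(cmod \<alpha>)\<^sup>2 = of_int (c2 * c0)" "2 * Re \<alpha> = of_int (- c2 * c1)"
    using c2' by (simp_all add: e flip: mult.assoc)
  then show "2 * Re \<alpha> \<in> \<int>" and "(cmod \<alpha>)\<^sup>2 \<in> \<int>" by (metis Ints_of_int)+
qed

text \<open>For \<alpha> = u + v sqrt d the discriminant \<open>(2 * u)^2 - 4 * norm\<close> equals
  \<open>d * (2 * v)^2\<close>, so squarefreeness makes \<open>2 * v\<close> integral. Only its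
  absolute value is stored, which determines \<alpha> up to conjugation. A rational root is an
  integer \<open>n\<close>, stored as \<open>(2 * n, 0)\<close>; this explains the parity
  condition.\<close>

lemma monic_root_quad:
  assumes d: "squarefree d" "d < 0"
    and root: "ipoly p \<alpha> = 0" and monic: "lead_coeff p = 1" and K: "\<alpha> \<in> quadratic_field d"
  obtains r where "quad_root d r = \<alpha> \<or> quad_root d r = cnj \<alpha>" and "snd r = 0 \<Longrightarrow> even (fst r)"
proof -
  let ?s = "sqrt (- of_int d)"
  have csqrt: "csqrt (of_int d) = \<i> * of_real ?s"
    using d(2) csqrt_of_real_nonpos[of "of_int d"] by simp
  obtain a b where ab: "a \<in> \<rat>" "b \<in> \<rat>" "\<alpha> = a + b * csqrt (of_int d)"
    using K by (auto simp: quadratic_field_def)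
  have real: "\<exists>u. u \<in> \<rat> \<and> x = of_real u" if "x \<in> \<rat>" for x :: complex
  proof -
    from that obtain i j :: int where "x = of_int i / of_int j" by (auto elim: Rats_cases')
    then show ?thesis by (intro exI[of _ "of_int i / of_int j"]) simp
  qed
  obtain u v where u: "u \<in> \<rat>" "a = of_real u" and v: "v \<in> \<rat>" "b = of_real v"
    using real[OF ab(1)] real[OF ab(2)] by blast
  have \<alpha>: "Re \<alpha> = u" "Im \<alpha> = v * ?s"
    using ab u v by (simp_all add: csqrt)
  have s: "?s * ?s = - of_int d" "?s > 0" using d(2) by simp_all
  show ?thesis
  proof (cases "v = 0")
    case True
    have "algebraic_int \<alpha>"
      using root monic by (auto simp: algebraic_int_altdef_ipoly ipoly_def)
    moreover have "\<alpha> = of_real u" using \<alpha> True by (simp add: complex_eq_iff)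
    ultimately have "\<alpha> \<in> \<int>"
      using ab True v by (intro rational_algebraic_int_is_int) auto
    then obtain n where "\<alpha> = of_int n" by (auto elim: Ints_cases)
    then show ?thesis by (intro that[of "(2 * n, 0)"]) (simp_all add: quad_root_def)
  next
    case False
    have norm: "(cmod \<alpha>)\<^sup>2 = u\<^sup>2 - of_int d * v\<^sup>2"
      unfolding cmod_power2 \<alpha> power_mult_distrib using s by (simp add: power2_eq_square)
    then have "(cmod \<alpha>)\<^sup>2 \<in> \<rat>" using u v by simp
    with False s(2) u have int: "2 * Re \<alpha> \<in> \<int>" "(cmod \<alpha>)\<^sup>2 \<in> \<int>"
      using monic_root_quadratic_integer[OF root monic] \<alpha> by auto
    obtain m where m: "2 * u = of_int m" using int(1) \<alpha> by (auto elim: Ints_cases)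
    obtain c where c: "u\<^sup>2 - of_int d * v\<^sup>2 = of_int c" using int(2) norm by (auto elim: Ints_cases)
    have "of_int d * (2 * v)\<^sup>2 = (2 * u)\<^sup>2 - 4 * (u\<^sup>2 - of_int d * v\<^sup>2)"
      by (simp add: algebra_simps power2_eq_square)
    also have "\<dots> = of_int (m\<^sup>2 - 4 * c)" unfolding m c by simp
    finally have "2 * v \<in> \<int>"
      by (rule squarefree_rational_square[OF d(1), rotated]) (use v in simp)
    then obtain n where n: "2 * v = of_int n" by (auto elim: Ints_cases)
    have "n \<noteq> 0" using n False by auto
    define k where "k = nat \<bar>n\<bar>"
    have k: "real k = 2 * \<bar>v\<bar>" "k \<noteq> 0"
      using n \<open>n \<noteq> 0\<close> by (auto simp: k_def abs_mult)
    have "quad_root d (m, k) = of_real u + \<i> * of_real (\<bar>v\<bar> * ?s)"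
      using m k by (simp add: quad_root_def complex_eq_iff)
    then have "quad_root d (m, k) = \<alpha> \<or> quad_root d (m, k) = cnj \<alpha>"
      using \<alpha> by (cases "v \<ge> 0") (simp_all add: complex_eq_iff)
    then show ?thesis
      using k by (intro that[of "(m, k)"]) auto
  qed
qed

text \<open>Vieta's formula for the root sum. For the empty list the truncated index
  \<open>length as - 1\<close> is 0 and reads the constant 1.\<close>

lemma coeff_prod_linear:
  fixes as :: "'a::idom list"
  shows "lead_coeff (\<Prod>a\<leftarrow>as. [:-a, 1:]) = 1" "degree (\<Prod>a\<leftarrow>as. [:-a, 1:]) = length as"
    "coeff (\<Prod>a\<leftarrow>as. [:-a, 1:]) (length as - 1) = (if as = [] then 1 else - sum_list as)"
proof -
  have *: "lead_coeff (\<Prod>a\<leftarrow>as. [:-a, 1:]) = 1 \<and> degree (\<Prod>a\<leftarrow>as. [:-a, 1:]) = length as" for as :: "'a list"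
  proof (induction as)
    case (Cons a as)
    let ?R = "\<Prod>a\<leftarrow>as. [:-a, 1:]"
    have nz: "?R \<noteq> 0" using Cons by auto
    have "degree ([:-a, 1:] * ?R) = Suc (length as)"
      by (subst degree_mult_eq) (use Cons nz in auto)
    moreover have "lead_coeff ([:-a, 1:] * ?R) = 1"
      by (subst lead_coeff_mult) (use Cons in auto)
    ultimately show ?case by (simp del: mult_pCons_left)
  qed simp
  show "lead_coeff (\<Prod>a\<leftarrow>as. [:-a, 1:]) = 1" "degree (\<Prod>a\<leftarrow>as. [:-a, 1:]) = length as"
    using *[of as] by auto
  show "coeff (\<Prod>a\<leftarrow>as. [:-a, 1:]) (length as - 1) = (if as = [] then 1 else - sum_list as)"
  proof (induction as)
    case (Cons a as)
    show ?case
    proof (cases as)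
      case as: (Cons a' as')
      have "coeff (\<Prod>a\<leftarrow>as. [:-a, 1:]) (length as) = 1" using *[of as] by metis
      with Cons as show ?thesis by (simp add: coeff_pCons split: nat.split)
    qed simp
  qed simp
qed

lemma of_int_prod_list: "of_int (prod_list xs) = prod_list (map of_int xs)"
  by (induction xs) simp_all

text \<open>The value \<open>poly p k\<close> is real, so its square is the product of
  \<open>(k - a) * cnj (k - a)\<close> over the roots. Each factor is a quarter of a
  \<open>quad\<close> value, which is the same for \<open>a\<close> and \<open>cnj a\<close>, so the
  ambiguity in the choice of \<open>f\<close> does no harm.\<close>

lemma splits_over_quadratic_field:
  assumes d: "squarefree d" "d < 0"
    and monic: "lead_coeff p = 1" and splits: "splits_over (quadratic_field d) p"
  shows "\<exists>rs. length rs = degree p \<and>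
    (\<forall>k. 4 ^ length rs * (poly p k)\<^sup>2 = (\<Prod>r\<leftarrow>rs. quad d r k)) \<and>
    (\<forall>r\<in>set rs. snd r = 0 \<longrightarrow> even (fst r)) \<and>
    (degree p > 0 \<longrightarrow> (\<Sum>r\<leftarrow>rs. fst r) = - 2 * coeff p (degree p - 1))"
proof -
  obtain c as where as: "set as \<subseteq> quadratic_field d"
    and p: "map_poly of_int p = smult c (\<Prod>a\<leftarrow>as. [:-a, 1:])"
    using splits by (auto simp: splits_over_def)
  have lc: "lead_coeff (map_poly of_int p :: complex poly) = 1"
    using monic by (simp add: coeff_map_poly degree_map_poly)
  have "lead_coeff (smult c (\<Prod>a\<leftarrow>as. [:-a, 1:])) = c"
    by (simp only: lead_coeff_smult coeff_prod_linear(1) mult_1_right)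
  then have "c = 1" using lc unfolding p by metis
  with p have p: "map_poly of_int p = (\<Prod>a\<leftarrow>as. [:-a, 1:])" by simp
  have deg: "degree p = length as"
    using arg_cong[OF p, of degree] coeff_prod_linear(2)[of as] by (simp add: degree_map_poly)
  have eval: "ipoly p x = (\<Prod>a\<leftarrow>as. x - a)" for x :: complex
    by (simp add: ipoly_def p poly_prod_list[of "map _ _", simplified] o_def)
  have "\<exists>r. (quad_root d r = a \<or> quad_root d r = cnj a) \<and> (snd r = 0 \<longrightarrow> even (fst r))" if "a \<in> set as" for a
  proof -
    have "ipoly p a = 0" unfolding eval using that by (auto simp: prod_list_zero_iff)
    from monic_root_quad[OF d this monic] that as show ?thesis by (metis subsetD)
  qed
  then obtain f where f: "\<And>a. a \<in> set as \<Longrightarrow> quad_root d (f a) = a \<or> quad_root d (f a) = cnj a"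
    "\<And>a. a \<in> set as \<Longrightarrow> snd (f a) = 0 \<Longrightarrow> even (fst (f a))" by metis
  show ?thesis
  proof (intro exI[of _ "map f as"] conjI allI ballI impI)
    show "length (map f as) = degree p" by (simp add: deg)
    show "even (fst r)" if "r \<in> set (map f as)" "snd r = 0" for r
      using that f(2) by auto
    show "4 ^ length (map f as) * (poly p k)\<^sup>2 = (\<Prod>r\<leftarrow>map f as. quad d r k)" for k
    proof -
      have cnj: "cnj (ipoly p (of_int k)) = ipoly p (of_int k)"
        by (simp add: ipoly_of_int)
      have "complex_of_int (quad d (f a) k) = 4 * (of_int k - a) * cnj (of_int k - a)" if "a \<in> set as" for a
        using f(1)[OF that] by (auto simp: quad_factor[OF d(2)] algebra_simps)
      then have "(\<Prod>a\<leftarrow>as. complex_of_int (quad d (f a) k))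
          = (\<Prod>a\<leftarrow>as. 4 * (of_int k - a) * cnj (of_int k - a))"
        by (intro arg_cong[of _ _ prod_list] map_cong) auto
      also have "\<dots> = 4 ^ length as * (\<Prod>a\<leftarrow>as. of_int k - a) * cnj (\<Prod>a\<leftarrow>as. of_int k - a)"
        by (induction as) simp_all
      also have "\<dots> = 4 ^ length as * (of_int (poly p k))\<^sup>2"
        using cnj by (simp add: eval[symmetric] ipoly_of_int power2_eq_square)
      finally have "complex_of_int (4 ^ length as * (poly p k)\<^sup>2) = of_int (\<Prod>a\<leftarrow>as. quad d (f a) k)"
        by (simp add: of_int_prod_list o_def)
      then show ?thesis by (simp only: of_int_eq_iff length_map) (simp add: o_def)
    qed
    assume "degree p > 0"
    then have "coeff (\<Prod>a\<leftarrow>as. [:-a, 1:]) (length as - 1) = - sum_list as"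
      using coeff_prod_linear(3)[of as] deg by auto
    then have "complex_of_int (coeff p (degree p - 1)) = - sum_list as"
      using p deg by (metis coeff_map_poly of_int_0)
    moreover have Re_sum_list: "Re (sum_list as) = (\<Sum>a\<leftarrow>as. Re a)" by (induction as) simp_all
    ultimately have "of_int (coeff p (degree p - 1)) = - (\<Sum>a\<leftarrow>as. Re a)"
      using Re_sum_list by (metis complex_Re_of_int uminus_complex.sel(1))
    moreover have "2 * Re a = of_int (fst (f a))" if "a \<in> set as" for a
    proof -
      have "Re (quad_root d (f a)) = of_int (fst (f a)) / 2"
        by (simp add: quad_root_def split: prod.split)
      with f(1)[OF that] show ?thesis by auto
    qed
    then have "2 * (\<Sum>a\<leftarrow>as. Re a) = of_int (\<Sum>a\<leftarrow>as. fst (f a))"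
      by (induction as) auto
    ultimately have "real_of_int (\<Sum>a\<leftarrow>as. fst (f a)) = of_int (- 2 * coeff p (degree p - 1))"
      by simp
    then show "(\<Sum>r\<leftarrow>map f as. fst r) = - 2 * coeff p (degree p - 1)"
      by (simp only: of_int_eq_iff) (simp add: o_def)
  qed
qed


section \<open>The limit of the products\<close>

text \<open>For z = N - root this is the integer z + cnj z, the sum of the two Gamma arguments
  belonging to one pair \<open>r\<close>.\<close>

definition quad_index :: "nat \<Rightarrow> int \<times> nat \<Rightarrow> nat" where
  "quad_index N = (\<lambda>(m, b). nat (2 * int N - m))"

text \<open>The integer denominator left by the reflection formula. For a non-real root it is
  \<open>(-4) ^ (M - 1)\<close> times the square of a Pochhammer symbol, where
  \<open>M = quad_index N r\<close>. For a real root that product and the sine both vanish, so the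
  reciprocal Gamma value is taken from the factorial directly, with the same normalisation
  \<open>4 ^ (M - 1)\<close>.\<close>

definition quad_weight :: "int \<Rightarrow> nat \<Rightarrow> int \<times> nat \<Rightarrow> int" where
  "quad_weight d N r =
     (if snd r = 0
      then 4 ^ (quad_index N r - 1) * (\<Prod>k<quad_index N r div 2 - 1. int (Suc k)) ^ 4
      else \<Prod>i<quad_index N r - 1. quad d r (int N - 1 - int i))"

text \<open>The transcendental factor of one pair. In the non-real case it is sin(pi z)^2 / pi^2 up
  to sign, written with the double angle formula.\<close>

definition quad_limit :: "int \<Rightarrow> int \<times> nat \<Rightarrow> real" where
  "quad_limit d = (\<lambda>(m, b). if b = 0 then 1 else
     (2 * cosh (real b * (pi * sqrt (- of_int d))) - (if even m then 2 else - 2)) / (4 * pi\<^sup>2))"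

lemma quad_limit_pos: "d < 0 \<Longrightarrow> quad_limit d r > 0"
proof -
  assume d: "d < 0"
  have "1 < cosh (real b * (pi * sqrt (- of_int d)))" if "b \<noteq> 0" for b :: nat
    using cosh_real_strict_mono[of 0 "real b * (pi * sqrt (- of_int d))"] that d by simp
  then show ?thesis
    by (auto simp: quad_limit_def split: prod.splits intro!: divide_pos_pos) (smt (verit) cosh_real_pos)
qed

lemma quad_weight_pos:
  assumes "d < 0"
  shows "quad_weight d N r > 0"
proof (cases "snd r = 0")
  case False
  have "quad d r k > 0" for k
    using False assms by (cases r) (auto simp: quad_def intro!: add_nonneg_pos mult_neg_pos
        simp flip: add_uminus_conv_diff)
  with False show ?thesis by (auto simp: quad_weight_def intro!: prod_pos)
qed (auto simp: quad_weight_def intro!: prod_pos)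

lemma cos_add_int_pi:
  fixes x :: complex
  shows "cos (of_nat M * of_real pi + x) = (-1) ^ M * cos x"
  by (induction M) (simp_all add: distrib_right add.assoc cos_add)

text \<open>As M - z exceeds 1 - z by the integer M - 1, the reflection formula applies after
  removing the Pochhammer factor \<open>P\<close>. Squaring then makes both the sine and
  \<open>P\<close> explicit.\<close>

lemma rGamma_pair:
  assumes d: "d < 0" and m: "fst r < 2 * int N" and even: "snd r = 0 \<Longrightarrow> even (fst r)"
  defines "M \<equiv> quad_index N r"
  defines "z \<equiv> of_nat N - quad_root d r"
  shows "(rGamma z * rGamma (of_nat M - z))\<^sup>2
    = of_real (4 ^ (M - 1) * quad_limit d r / of_int (quad_weight d N r))"
proof -
  obtain m b where r: "r = (m, b)" by (cases r)
  let ?w = "quad_weight d N r"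
  have M: "int M = 2 * int N - m" "M \<ge> 1"
    using m by (auto simp: M_def quad_index_def r)
  have w: "?w \<noteq> 0" using quad_weight_pos[OF d, of N r] by simp
  have "(rGamma z * rGamma (of_nat M - z))\<^sup>2 * of_int ?w = of_real (4 ^ (M - 1) * quad_limit d r)"
  proof (cases "b = 0")
    case True
    with even have "even m" by (simp add: r)
    then obtain c where c: "m = 2 * c" by blast
    define h where "h = M div 2"
    have h: "M = 2 * h" "h \<ge> 1" "int h = int N - c"
      using M c unfolding h_def by presburger+
    have z: "z = of_nat h"
    proof -
      have "complex_of_int (int h) = of_int (int N - c)" using h(3) by simp
      then show ?thesis by (simp add: z_def r quad_root_def True c)
    qed
    obtain h' where h': "h = Suc h'" using h(2) by (cases h) auto
    have "Gamma (of_nat h :: complex) = fact h'"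
      using Gamma_fact[of h', where 'a = complex] by (simp add: h')
    then have "rGamma (of_nat h :: complex) = inverse (fact h')"
      by (simp add: rGamma_inverse_Gamma)
    moreover have "(\<Prod>k<h'. int (Suc k)) = fact h'"
      by (induction h') (simp_all add: algebra_simps)
    moreover have "M div 2 - 1 = h'" by (simp add: h(1) h')
    ultimately have "?w = 4 ^ (M - 1) * fact h' ^ 4"
      unfolding quad_weight_def M_def[symmetric] using True by (simp add: r)
    then show ?thesis
      using True unfolding z h(1)
      by (simp add: \<open>rGamma (of_nat h) = inverse (fact h')\<close> quad_limit_def r field_simps eval_nat_numeral)
  next
    case False
    define P where "P = pochhammer (1 - z) (M - 1)"
    have "rGamma (1 - z) = P * rGamma (of_nat M - z)"
      using pochhammer_rGamma[of "1 - z" "M - 1"] M by (simp add: P_def of_nat_diff)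
    then have HP: "(rGamma z * rGamma (of_nat M - z)) * P = sin (of_real pi * z) / of_real pi"
      using rGamma_reflection_complex[of z] by (simp add: mult_ac)
    have P: "P = (\<Prod>i<M - 1. of_nat (Suc i) - z)"
      by (simp add: P_def pochhammer_prod lessThan_atLeast0 algebra_simps)
    \<comment> \<open>Reading the factors backwards replaces \<open>Suc i\<close> by
      \<open>M - Suc i\<close>; the two conjugate products inside the weight therefore coincide up
      to sign, and the weight becomes a power of -4 times \<open>P\<^sup>2\<close>.\<close>
    have P': "P = (\<Prod>i<M - 1. of_nat M - of_nat (Suc i) - z)"
    proof -
      have "P = (\<Prod>i<M - 1. of_nat (Suc (M - 1 - Suc i)) - z)"
        unfolding P by (rule prod.nat_diff_reindex[symmetric])
      also have "\<dots> = (\<Prod>i<M - 1. of_nat M - of_nat (Suc i) - z)"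
      proof (rule prod.cong)
        fix i assume "i \<in> {..<M - 1}"
        then have "Suc (M - 1 - Suc i) = M - Suc i" "Suc i \<le> M" by auto
        then show "of_nat (Suc (M - 1 - Suc i)) - z = of_nat M - of_nat (Suc i) - z"
          by (simp add: of_nat_diff)
      qed simp
      finally show ?thesis .
    qed
    have sum: "quad_root d r + cnj (quad_root d r) = of_int m"
      by (simp add: quad_root_def r complex_eq_iff)
    have Mz: "of_nat M - z = of_nat N - cnj (quad_root d r)"
    proof -
      have "complex_of_nat M = 2 * of_nat N - of_int m"
        using M(1) by (metis of_int_diff of_int_mult of_int_numeral of_int_of_nat_eq)
      with sum show ?thesis by (simp add: z_def algebra_simps)
    qed
    have "of_int ?w = (\<Prod>i<M - 1. - 4 * ((of_nat (Suc i) - z) * (of_nat M - of_nat (Suc i) - z)))"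
    proof -
      have "of_int (quad d r (int N - 1 - int i))
          = - 4 * ((of_nat (Suc i) - z) * (of_nat M - of_nat (Suc i) - z))" for i
      proof -
        have "of_nat M - of_nat (Suc i) - z = (of_nat M - z) - of_nat (Suc i)" by simp
        then have eq: "of_nat M - of_nat (Suc i) - z
            = of_nat N - cnj (quad_root d r) - of_nat (Suc i)" unfolding Mz .
        show ?thesis unfolding eq unfolding quad_factor[OF d] z_def by (simp add: algebra_simps)
      qed
      then show ?thesis using False by (simp add: quad_weight_def r M_def)
    qed
    also have "\<dots> = (- 4) ^ (M - 1) * (P * P)"
      by (subst (1) P, subst P') (simp only: prod.distrib prod_constant card_lessThan)
    finally have weight: "of_int ?w = (- 4) ^ (M - 1) * P\<^sup>2" by (simp add: power2_eq_square)
    let ?c = "cosh (real b * (pi * sqrt (- of_int d)))"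
    have double: "(sin x)\<^sup>2 = (1 - cos (2 * x)) / 2" for x :: complex
      using cos_double_sin[of x] by simp
    \<comment> \<open>Only after doubling is the real part an integer multiple of pi, as the real
      part of \<open>z\<close> may be half an odd integer. This is why the sine is squared.\<close>
    have "2 * (of_real pi * z) = of_nat M * of_real pi - \<i> * of_real (real b * (pi * sqrt (- of_int d)))"
    proof -
      have "2 * z = of_nat M - \<i> * of_nat b * of_real (sqrt (- of_int d))"
      proof -
        have M': "complex_of_nat M = 2 * of_nat N - of_int m"
          using M(1) by (metis of_int_diff of_int_mult of_int_numeral of_int_of_nat_eq)
        show ?thesis unfolding M' by (simp add: z_def quad_root_def r field_simps)
      qed
      then have "of_real pi * (2 * z) = of_real pi * (of_nat M - \<i> * of_nat b * of_real (sqrt (- of_int d)))"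
        by simp
      then show ?thesis by (simp add: algebra_simps)
    qed
    then have "cos (2 * (of_real pi * z))
        = cos (of_nat M * of_real pi + - (\<i> * of_real (real b * (pi * sqrt (- of_int d)))))"
      by simp
    also have "\<dots> = (- 1) ^ M * cosh (of_real (real b * (pi * sqrt (- of_int d))))"
      unfolding cos_add_int_pi cosh_conv_cos by simp
    also have "\<dots> = (- 1) ^ M * of_real ?c" by (simp add: cosh_def scaleR_conv_of_real exp_of_real flip: of_real_minus of_real_mult)
    finally have sin: "(sin (of_real pi * z))\<^sup>2 = (1 - (- 1) ^ M * of_real ?c) / 2"
      unfolding double by (simp only:)
    have "(- 1) ^ M = (if even m then 1 else - 1 :: complex)"
    proof -
      have "even M \<longleftrightarrow> even m" using M(1) by presburger
      then show ?thesis by simp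
    qed
    moreover have "(- 1 :: complex) ^ (M - 1) = - ((- 1) ^ M)"
      using M(2) by (cases M) auto
    ultimately have sign: "(- 1 :: complex) ^ (M - 1) * (1 - (- 1) ^ M * of_real ?c)
        = of_real ?c - (if even m then 1 else - 1)"
      by auto
    have "(rGamma z * rGamma (of_nat M - z))\<^sup>2 * of_int ?w
        = (- 4) ^ (M - 1) * ((rGamma z * rGamma (of_nat M - z)) * P)\<^sup>2"
      unfolding weight by (simp add: power_mult_distrib)
    also have "\<dots> = 4 ^ (M - 1) * ((- 1) ^ (M - 1) * (1 - (- 1) ^ M * of_real ?c)) / (2 * (of_real pi)\<^sup>2)"
      unfolding HP power_divide sin by (simp add: power_minus[of "4::complex"])
    also have "\<dots> = of_real (4 ^ (M - 1) * quad_limit d r)"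
      unfolding sign using False by (simp add: quad_limit_def r field_simps)
    finally show ?thesis .
  qed
  then show ?thesis using w by (simp add: field_simps)
qed

text \<open>By \<open>quad_factor\<close> the product is \<open>4 ^ Suc n\<close> times two
  Pochhammer symbols. These are the numerators of the Gamma series at \<open>z\<close> and
  \<open>M - z\<close>, whose normalising powers of \<open>n\<close> have exponents adding up to
  \<open>M\<close>.\<close>

lemma quad_product_limit:
  assumes d: "d < 0" and m: "fst r < 2 * int N" and even: "snd r = 0 \<Longrightarrow> even (fst r)"
  defines "M \<equiv> quad_index N r"
  shows "(\<lambda>n. ((\<Prod>k<Suc n. of_int (quad d r (int (N + k)))) / (4 ^ Suc n * fact n ^ 2 * real n ^ M))\<^sup>2)
    \<longlonglongrightarrow> 4 ^ (M - 1) * quad_limit d r / of_int (quad_weight d N r)"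
    (is "(\<lambda>n. (?h n)\<^sup>2) \<longlonglongrightarrow> ?L")
proof -
  define z where "z = of_nat N - quad_root d r"
  have M: "int M = 2 * int N - fst r"
    using m by (auto simp: M_def quad_index_def split: prod.split)
  have Mz: "of_nat M - z = of_nat N - cnj (quad_root d r)"
  proof -
    have "quad_root d r + cnj (quad_root d r) = of_int (fst r)"
      by (cases r) (simp add: quad_root_def complex_eq_iff)
    moreover have "complex_of_nat M = 2 * of_nat N - of_int (fst r)"
      using M(1) by (metis of_int_diff of_int_mult of_int_numeral of_int_of_nat_eq)
    ultimately show ?thesis by (simp add: z_def algebra_simps)
  qed
  have eq: "complex_of_real (?h n) = rGamma_series z n * rGamma_series (of_nat M - z) n" if "n > 0" for n
  proof -
    have "(\<Prod>k<Suc n. complex_of_int (quad d r (int (N + k))))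
        = (\<Prod>k<Suc n. 4 * ((z + of_nat k) * (of_nat M - z + of_nat k)))"
    proof (rule prod.cong)
      show "complex_of_int (quad d r (int (N + k))) = 4 * ((z + of_nat k) * (of_nat M - z + of_nat k))" for k
        unfolding quad_factor[OF d] Mz unfolding z_def by (simp add: algebra_simps)
    qed simp
    also have "\<dots> = 4 ^ Suc n * (pochhammer z (Suc n) * pochhammer (of_nat M - z) (Suc n))"
      by (simp add: prod.distrib pochhammer_prod lessThan_atLeast0 del: prod.lessThan_Suc prod.op_ivl_Suc power_Suc)
    finally have "(\<Prod>k<Suc n. complex_of_int (quad d r (int (N + k))))
        = 4 ^ Suc n * (pochhammer z (Suc n) * pochhammer (of_nat M - z) (Suc n))" .
    moreover have "exp (z * of_real (ln (real n))) * exp ((of_nat M - z) * of_real (ln (real n)))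
        = complex_of_nat n ^ M"
    proof -
      have "exp (z * of_real (ln (real n))) * exp ((of_nat M - z) * of_real (ln (real n)))
          = exp (of_nat M * complex_of_real (ln (real n)))"
        by (simp add: algebra_simps flip: exp_add)
      also have "\<dots> = exp (complex_of_real (ln (real n))) ^ M" by (simp add: exp_of_nat_mult)
      also have "exp (complex_of_real (ln (real n))) = of_nat n"
        using that by (simp add: exp_of_real)
      finally show ?thesis .
    qed
    ultimately show ?thesis
      by (simp add: rGamma_series_def of_real_prod power2_eq_square mult_ac
          del: prod.lessThan_Suc power_Suc of_nat_Suc)
  qed
  have "(\<lambda>n. (rGamma_series z n * rGamma_series (of_nat M - z) n)\<^sup>2)
      \<longlonglongrightarrow> (rGamma z * rGamma (of_nat M - z))\<^sup>2"
    by (intro tendsto_intros)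
  also have "(rGamma z * rGamma (of_nat M - z))\<^sup>2 = of_real ?L"
    unfolding M_def z_def by (rule rGamma_pair[OF d m even])
  finally have "(\<lambda>n. complex_of_real ((?h n)\<^sup>2)) \<longlonglongrightarrow> of_real ?L"
    by (rule Lim_transform_eventually)
      (use eventually_gt_at_top[of 0] in eventually_elim, simp only: of_real_power eq)
  then show ?thesis by (simp only: tendsto_of_real_iff)
qed

lemma tendsto_prod_list:
  fixes f :: "'a \<Rightarrow> nat \<Rightarrow> real"
  assumes "\<And>x. x \<in> set xs \<Longrightarrow> f x \<longlonglongrightarrow> l x"
  shows "(\<lambda>n. \<Prod>x\<leftarrow>xs. f x n) \<longlonglongrightarrow> (\<Prod>x\<leftarrow>xs. l x)"
  using assms by (induction xs) (auto intro!: tendsto_mult)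

lemma prod_list_divide:
  "(\<Prod>x\<leftarrow>xs. f x / g x) = (\<Prod>x\<leftarrow>xs. f x) / (\<Prod>x\<leftarrow>xs. g x :: real)"
  by (induction xs) simp_all

lemma prod_list_power_distrib: "(\<Prod>x\<leftarrow>xs. f x ^ n) = (\<Prod>x\<leftarrow>xs. f x :: 'a::comm_monoid_mult) ^ n"
  by (induction xs) (simp_all add: power_mult_distrib)

lemma prod_list_mult: "(\<Prod>x\<leftarrow>xs. f x * g x) = (\<Prod>x\<leftarrow>xs. f x) * (\<Prod>x\<leftarrow>xs. g x :: 'a::comm_monoid_mult)"
  by (induction xs) (simp_all add: mult_ac)

lemma prod_list_power_sum: "(\<Prod>x\<leftarrow>xs. a ^ f x) = (a::'a::comm_monoid_mult) ^ (\<Sum>x\<leftarrow>xs. f x)"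
  by (induction xs) (simp_all add: power_add)

lemma prod_swap_list:
  "(\<Prod>k<n. \<Prod>x\<leftarrow>xs. f x k) = (\<Prod>x\<leftarrow>xs. \<Prod>k<(n::nat). f x k :: 'a::comm_monoid_mult)"
  by (induction xs) (simp_all add: prod.distrib)

text \<open>The first condition makes \<open>quad_index N r\<close> positive; the second says that
  real roots are integers.\<close>

definition admissible :: "nat \<Rightarrow> (int \<times> nat) list \<Rightarrow> bool" where
  "admissible N rs \<longleftrightarrow> (\<forall>r\<in>set rs. fst r < 2 * int N \<and> (snd r = 0 \<longrightarrow> even (fst r)))"

lemma sum_quad_index:
  "admissible N rs \<Longrightarrow> int (\<Sum>r\<leftarrow>rs. quad_index N r) = 2 * int N * int (length rs) - (\<Sum>r\<leftarrow>rs. fst r)"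
  "admissible N rs \<Longrightarrow> (\<Sum>r\<leftarrow>rs. quad_index N r) = (\<Sum>r\<leftarrow>rs. quad_index N r - 1) + length rs"
  by (induction rs) (auto simp: admissible_def quad_index_def algebra_simps split: prod.splits)

text \<open>Equal lengths cancel the factors \<open>4 ^ Suc n * fact n ^ 2\<close>; equal root sums
  make the total indices equal, cancelling the powers of \<open>n\<close> and the constants
  \<open>4 ^ (quad_index N r - 1)\<close>.\<close>

lemma quad_ratio_limit:
  assumes d: "d < 0" and P: "admissible N P" and Q: "admissible N Q"
    and len: "length P = length Q" and sum: "(\<Sum>r\<leftarrow>P. fst r) = (\<Sum>r\<leftarrow>Q. fst r)"
  shows "(\<lambda>n. (\<Prod>k<n. of_int (\<Prod>r\<leftarrow>Q. quad d r (int (N + k))) / of_int (\<Prod>r\<leftarrow>P. quad d r (int (N + k)))) ^ 2)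
    \<longlonglongrightarrow> (\<Prod>r\<leftarrow>Q. quad_limit d r / of_int (quad_weight d N r)) / (\<Prod>r\<leftarrow>P. quad_limit d r / of_int (quad_weight d N r))"
proof -
  define h where "h r n = (\<Prod>k<Suc n. real_of_int (quad d r (int (N + k)))) /
      (4 ^ Suc n * fact n ^ 2 * real n ^ quad_index N r)" for r n
  define l where "l r = quad_limit d r / of_int (quad_weight d N r)" for r
  have l: "l r > 0" for r
    using quad_limit_pos[OF d] quad_weight_pos[OF d] by (simp add: l_def)
  have lim: "(\<lambda>n. \<Prod>r\<leftarrow>R. (h r n)\<^sup>2) \<longlonglongrightarrow> (\<Prod>r\<leftarrow>R. 4 ^ (quad_index N r - 1) * l r)"
    if "admissible N R" for R
    unfolding h_def l_def times_divide_eq_right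
    using that by (intro tendsto_prod_list quad_product_limit[OF d]) (auto simp: admissible_def)
  have idx: "(\<Sum>r\<leftarrow>P. quad_index N r) = (\<Sum>r\<leftarrow>Q. quad_index N r)"
    using sum_quad_index(1)[OF P] sum_quad_index(1)[OF Q] len sum by simp
  have idx': "(\<Sum>r\<leftarrow>P. quad_index N r - 1) = (\<Sum>r\<leftarrow>Q. quad_index N r - 1)"
    using idx sum_quad_index(2)[OF P] sum_quad_index(2)[OF Q] len by simp
  have prod_l: "(\<Prod>r\<leftarrow>R. 4 ^ (quad_index N r - 1) * l r)
      = 4 ^ (\<Sum>r\<leftarrow>R. quad_index N r - 1) * (\<Prod>r\<leftarrow>R. l r)" for R
    by (simp only: prod_list_mult prod_list_power_sum)
  have nz: "(\<Prod>r\<leftarrow>R. l r) \<noteq> 0" for R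
  proof (induction R)
    case (Cons r R)
    then show ?case using l[of r] by simp
  qed simp
  have "(\<lambda>n. (\<Prod>r\<leftarrow>Q. (h r n)\<^sup>2) / (\<Prod>r\<leftarrow>P. (h r n)\<^sup>2))
      \<longlonglongrightarrow> (\<Prod>r\<leftarrow>Q. 4 ^ (quad_index N r - 1) * l r) / (\<Prod>r\<leftarrow>P. 4 ^ (quad_index N r - 1) * l r)"
    by (intro tendsto_divide lim P Q, unfold prod_l) (use nz in simp)
  also have "(\<Prod>r\<leftarrow>Q. 4 ^ (quad_index N r - 1) * l r) / (\<Prod>r\<leftarrow>P. 4 ^ (quad_index N r - 1) * l r)
      = (\<Prod>r\<leftarrow>Q. l r) / (\<Prod>r\<leftarrow>P. l r)"
    unfolding prod_l idx' by simp
  finally have *: "(\<lambda>n. (\<Prod>r\<leftarrow>Q. (h r n)\<^sup>2) / (\<Prod>r\<leftarrow>P. (h r n)\<^sup>2)) \<longlonglongrightarrow> (\<Prod>r\<leftarrow>Q. l r) / (\<Prod>r\<leftarrow>P. l r)" .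
  let ?u = "\<lambda>n. (\<Prod>k<n. of_int (\<Prod>r\<leftarrow>Q. quad d r (int (N + k))) / of_int (\<Prod>r\<leftarrow>P. quad d r (int (N + k)))) ^ 2"
  have "(\<Prod>r\<leftarrow>Q. (h r n)\<^sup>2) / (\<Prod>r\<leftarrow>P. (h r n)\<^sup>2) = ?u (Suc n)" if "n > 0" for n
  proof -
    define c where "c r = (\<Prod>k<Suc n. real_of_int (quad d r (int (N + k))))" for r
    define K where "K = (4::real) ^ Suc n * fact n ^ 2"
    have h: "(\<Prod>r\<leftarrow>R. h r n) = (\<Prod>r\<leftarrow>R. c r) / (K ^ length R * real n ^ (\<Sum>r\<leftarrow>R. quad_index N r))" for R
      unfolding h_def c_def[symmetric] K_def[symmetric] prod_list_divide prod_list_mult prod_list_power_sum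
      by (simp add: map_replicate_const prod_list_replicate)
    have "K \<noteq> 0" by (simp add: K_def)
    then have "(\<Prod>r\<leftarrow>Q. h r n) / (\<Prod>r\<leftarrow>P. h r n) = (\<Prod>r\<leftarrow>Q. c r) / (\<Prod>r\<leftarrow>P. c r)"
      unfolding h idx len using that by simp
    moreover have "(\<Prod>r\<leftarrow>R. c r) = (\<Prod>k<Suc n. real_of_int (\<Prod>r\<leftarrow>R. quad d r (int (N + k))))" for R
      unfolding c_def of_int_prod_list map_map o_def by (rule prod_swap_list[symmetric])
    ultimately show ?thesis
      by (simp only: prod_list_power_distrib power_divide[symmetric] prod_dividef)
  qed
  with * have "(\<lambda>n. ?u (Suc n)) \<longlonglongrightarrow> (\<Prod>r\<leftarrow>Q. l r) / (\<Prod>r\<leftarrow>P. l r)"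
    by (rule Lim_transform_eventually[OF _ eventually_mono[OF eventually_gt_at_top[of 0]]])
  then show ?thesis unfolding l_def by (rule LIMSEQ_imp_Suc)
qed


section \<open>Lower bounds for decreasing products\<close>

definition ratio :: "int poly \<Rightarrow> int poly \<Rightarrow> nat \<Rightarrow> nat \<Rightarrow> real" where
  "ratio p q N n = (\<Prod>k<n. of_int (poly q (int (N + k))) / of_int (poly p (int (N + k))))"

lemma ratio_0 [simp]: "ratio p q N 0 = 1"
  by (simp add: ratio_def)

lemma ratio_Suc: "ratio p q N (Suc n)
    = ratio p q N n * (of_int (poly q (int (N + n))) / of_int (poly p (int (N + n))))"
  by (simp add: ratio_def)

text \<open>Integers \<open>v\<close>, \<open>w\<close> encode the bound \<open>w / v\<close>. An
  upper bound on a growing product is expressed by exchanging \<open>p\<close> with \<open>q\<close>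
  and \<open>v\<close> with \<open>w\<close>.\<close>

definition bounded_below :: "int poly \<Rightarrow> int poly \<Rightarrow> int \<Rightarrow> int \<Rightarrow> nat \<Rightarrow> bool" where
  "bounded_below p q v w N \<longleftrightarrow>
     poly q (int N) < poly p (int N) \<and> (\<forall>n. of_int w \<le> of_int v * ratio p q N n)"

lemma pnorm_mult: "pnorm (p * q) \<le> pnorm p * pnorm q"
proof (induction p)
  case (pCons a p)
  have "pnorm (pCons a p * q) \<le> pnorm (smult a q) + pnorm (pCons 0 (p * q))"
    by (simp only: mult_pCons_left pnorm_add)
  also have "\<dots> \<le> \<bar>a\<bar> * pnorm q + pnorm p * pnorm q"
    using pCons by (simp add: pnorm_smult)
  finally show ?case by (simp add: distrib_right)
qed simp

lemma eventually_poly_pos: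
  fixes p :: "int poly"
  assumes "lead_coeff p > 0"
  shows "\<forall>\<^sub>F n in sequentially. poly p (int (N + n)) > 0"
  using eventually_ge_at_top[of "nat (pnorm p + 1)"]
proof eventually_elim
  case (elim n)
  then have "pnorm p < int (N + n)" by linarith
  from sgn_poly_eq_lead_coeff[OF this] assms show ?case by (simp add: sgn_if split: if_splits)
qed

text \<open>Since \<open>N\<close> is beyond the root bounds of \<open>p\<close>, \<open>q\<close>
  and \<open>p - q\<close>, the single comparison at \<open>N\<close> persists, so the ratios are
  positive and strictly decreasing.\<close>

locale decreasing_ratio =
  fixes p q :: "int poly" and N :: nat
  assumes monic: "lead_coeff p = 1" "lead_coeff q = 1"
    and N: "pnorm p + pnorm q < int N"
    and less_N: "poly q (int N) < poly p (int N)"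
begin

lemma pos: "poly p (int (N + k)) > 0" "poly q (int (N + k)) > 0"
  using sgn_poly_eq_lead_coeff[of p "int (N + k)"] sgn_poly_eq_lead_coeff[of q "int (N + k)"] N
    monic pnorm_nonneg[of p] pnorm_nonneg[of q]
  by (auto simp: sgn_if split: if_splits)

lemma diff_lead_coeff: "lead_coeff (p - q) > 0"
proof -
  have "pnorm (p - q) < int N" using N pnorm_diff[of p q] by simp
  from sgn_poly_eq_lead_coeff[OF this] show ?thesis
    using less_N by (simp add: sgn_if split: if_splits)
qed

lemma less: "poly q (int (N + k)) < poly p (int (N + k))"
proof -
  have "pnorm (p - q) < int (N + k)" using N pnorm_diff[of p q] by simp
  from sgn_poly_eq_lead_coeff[OF this] show ?thesis
    using diff_lead_coeff by (simp add: sgn_if split: if_splits)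
qed

abbreviation u :: "nat \<Rightarrow> real" where "u \<equiv> ratio p q N"

lemma u_pos: "u n > 0"
  using pos by (simp add: ratio_def prod_pos)

lemma u_decreasing: "u (Suc n) < u n"
proof -
  have "real_of_int (poly q (int (N + n))) / of_int (poly p (int (N + n))) < 1"
    using less[of n] pos[of n] by simp
  then show ?thesis
    unfolding ratio_Suc using mult_strict_left_mono[OF _ u_pos[of n]] by fastforce
qed

lemma u_antimono: "decseq u"
  by (intro decseq_SucI less_imp_le u_decreasing)

lemma convergent: "\<exists>L. u \<longlonglongrightarrow> L \<and> (\<forall>n. L \<le> u n)"
proof -
  have "bdd_below (range u)" using u_pos by (intro bdd_belowI[of _ 0]) (auto intro: less_imp_le)
  with u_antimono have "u \<longlonglongrightarrow> (INF n. u n)" by (intro LIMSEQ_decseq_INF)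
  moreover have "(INF n. u n) \<le> u n" for n by (intro cINF_lower \<open>bdd_below (range u)\<close>) simp
  ultimately show ?thesis by blast
qed

text \<open>If \<open>q x / p x \<le> 1 - 1 / (2 x)\<close> eventually, then \<open>u\<^sup>2 (2 x - 1)\<close> is eventually decreasing,
  so \<open>u\<close> tends to \<open>0\<close>.\<close>

lemma degree_diff:
  assumes "\<tau> > 0" and "\<And>n. \<tau> \<le> u n"
  shows "degree (q - p) + 2 \<le> degree p"
proof (rule ccontr)
  assume "\<not> ?thesis"
  moreover have "degree (q - p) = degree (p - q)" by (metis degree_minus minus_diff_eq)
  ultimately have deg: "degree p \<le> Suc (degree (p - q))" by simp
  define f where "f = p - q"
  define G where "G = [:0, 2:] * f - p"
  have f: "degree p \<le> Suc (degree f)" "lead_coeff f > 0"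
    using deg diff_lead_coeff by (simp_all add: f_def)
  \<comment> \<open>The integer leading coefficient of \<open>f\<close> is at least 1, so its double
    beats the corresponding coefficient of the monic \<open>p\<close>. Hence \<open>G\<close> is
    eventually positive, which is the inequality \<open>q / p < 1 - 1 / (2 * x)\<close>.\<close>
  have "coeff p (Suc (degree f)) \<le> 1"
    using monic(1) f(1) by (cases "degree p = Suc (degree f)") (auto simp: coeff_eq_0)
  then have coeff: "coeff G (Suc (degree f)) > 0"
    using f(2) by (simp add: G_def)
  have "degree G \<le> Suc (degree f)"
    unfolding G_def by (intro degree_diff_le order.trans[OF degree_mult_le] f(1)) simp
  with coeff have "lead_coeff G > 0"
    by (metis le_antisym le_degree less_irrefl)
  then have "\<forall>\<^sub>F n in sequentially. poly G (int (N + n)) > 0" by (rule eventually_poly_pos)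
  then obtain n0 where n0: "\<And>n. n \<ge> n0 \<Longrightarrow> poly G (int (N + n)) > 0"
    by (auto simp: eventually_sequentially)
  define T where "T n = (u n)\<^sup>2 * (2 * real (N + n) - 1)" for n
  have "int N > 0" using N pnorm_nonneg[of p] pnorm_nonneg[of q] by linarith
  then have N1: "real N \<ge> 1" by simp
  have step: "T (Suc n) \<le> T n" if "n \<ge> n0" for n
  proof -
    define x P Q where "x = real (N + n)" and "P = real_of_int (poly p (int (N + n)))"
      and "Q = real_of_int (poly q (int (N + n)))"
    have x: "x \<ge> 1" using N1 by (simp add: x_def)
    have PQ: "P > 0" "Q > 0" using pos[of n] by (simp_all add: P_def Q_def)
    have "real_of_int (poly G (int (N + n))) > 0" using n0[OF that] by simp
    then have "2 * x * (P - Q) - P > 0"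
      by (simp add: G_def f_def x_def P_def Q_def algebra_simps)
    then have "2 * x * Q \<le> (2 * x - 1) * P" by (simp add: algebra_simps)
    then have "(2 * x * Q)\<^sup>2 \<le> ((2 * x - 1) * P)\<^sup>2"
      using PQ x by (intro power_mono) auto
    then have *: "Q\<^sup>2 * (4 * x\<^sup>2) \<le> P\<^sup>2 * (2 * x - 1)\<^sup>2"
      by (simp add: power_mult_distrib mult_ac)
    \<comment> \<open>Multiplying by \<open>2 * x + 1\<close> allows one factor
      \<open>2 * x - 1\<close> on the right to be traded away through
      \<open>(2 * x - 1) * (2 * x + 1) = 4 * x\<^sup>2 - 1\<close>.\<close>
    have "Q\<^sup>2 * (2 * x + 1) * (4 * x\<^sup>2) \<le> P\<^sup>2 * (2 * x - 1)\<^sup>2 * (2 * x + 1)"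
      using mult_right_mono[OF *, of "2 * x + 1"] x by (simp add: algebra_simps)
    also have "\<dots> = P\<^sup>2 * (2 * x - 1) * (4 * x\<^sup>2 - 1)"
      by (simp add: algebra_simps power2_eq_square)
    also have "\<dots> \<le> P\<^sup>2 * (2 * x - 1) * (4 * x\<^sup>2)"
      using x by (intro mult_left_mono) auto
    finally have "Q\<^sup>2 * (2 * x + 1) \<le> P\<^sup>2 * (2 * x - 1)"
      using x by (simp add: mult_le_cancel_right)
    then have "(u n)\<^sup>2 * (Q\<^sup>2 * (2 * x + 1)) / P\<^sup>2 \<le> (u n)\<^sup>2 * (P\<^sup>2 * (2 * x - 1)) / P\<^sup>2"
      by (intro divide_right_mono mult_left_mono) auto
    moreover have "T (Suc n) = (u n)\<^sup>2 * (Q\<^sup>2 * (2 * x + 1)) / P\<^sup>2"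
      by (simp add: T_def ratio_Suc P_def Q_def x_def power_mult_distrib power_divide)
    moreover have "T n = (u n)\<^sup>2 * (P\<^sup>2 * (2 * x - 1)) / P\<^sup>2"
      using PQ by (simp add: T_def x_def)
    ultimately show ?thesis by simp
  qed
  have T: "T (n0 + n) \<le> T n0" for n
  proof (induction n)
    case (Suc n)
    with step[of "n0 + n"] show ?case by simp
  qed simp
  obtain n :: nat where n: "T n0 / \<tau>\<^sup>2 < real n" using reals_Archimedean2 by blast
  have "\<tau>\<^sup>2 * real n \<le> (u (n0 + n))\<^sup>2 * (2 * real (N + (n0 + n)) - 1)"
    using assms N1 by (intro mult_mono power_mono) (auto intro: less_imp_le)
  also have "\<dots> \<le> T n0" using T[of n] by (simp add: T_def)
  finally show False using n assms(1) by (simp add: field_simps)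
qed

subsection \<open>Certificates for limits above a bound\<close>

definition slack :: "nat \<Rightarrow> int poly" where
  "slack C = q * [:0, 1 - int C, 1:] - p * [:- int C, 1 - int C, 1:]"

lemma poly_slack:
  "poly (slack C) x = poly q x * x * (x + 1 - int C) - poly p x * (x + 1) * (x - int C)"
  by (simp add: slack_def algebra_simps)

text \<open>Supplies the threshold in the slack certificate: beyond it the sign of the slack
  polynomial is settled, so a test at one point covers the whole tail.\<close>

lemma pnorm_slack: "pnorm (slack C) \<le> 2 * (int C + 2) * (pnorm p + pnorm q)"
proof -
  have "pnorm (slack C) \<le> pnorm q * pnorm [:0, 1 - int C, 1:] + pnorm p * pnorm [:- int C, 1 - int C, 1:]"
    unfolding slack_def
    by (intro order.trans[OF pnorm_diff] add_mono pnorm_mult)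
  also have "\<dots> \<le> pnorm q * (2 * (int C + 2)) + pnorm p * (2 * (int C + 2))"
    by (intro add_mono mult_left_mono) auto
  finally show ?thesis by (simp add: algebra_simps)
qed

text \<open>The quantity \<open>u (x - C) / x\<close>, which bounds \<open>u\<close> from below and has the same limit, increases as
  long as the slack polynomial is nonnegative.\<close>

lemma slack_sound:
  assumes n: "2 * (int C + 2) * (pnorm p + pnorm q) < int (N + n)"
    and slack: "0 \<le> poly (slack C) (int (N + n))"
    and vw: "v > 0" "w \<le> v * (u n * (real (N + n) - real C) / real (N + n))"
  shows "w \<le> v * u k"
proof -
  define V where "V n = u n * (real (N + n) - real C) / real (N + n)" for n
  have pn: "pnorm p + pnorm q \<ge> 1"
  proof -
    have "p \<noteq> 0" using monic(1) by auto
    then have "pnorm p \<noteq> 0"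
      by (induction p) (use pnorm_nonneg in \<open>auto simp: add_nonneg_eq_0_iff\<close>)
    then show ?thesis using pnorm_nonneg[of p] pnorm_nonneg[of q] by linarith
  qed
  have "2 * (int C + 2) * 1 \<le> 2 * (int C + 2) * (pnorm p + pnorm q)"
    using pn by (intro mult_left_mono) auto
  also note n
  finally have "C < N + k" if "k \<ge> n" for k using that by presburger
  then have C: "real C < real (N + k)" if "k \<ge> n" for k
    using that by (simp only: of_nat_less_iff)
  have N1: "real (N + k) > 0" if "k \<ge> n" for k using C[OF that] by linarith
  have step: "V k \<le> V (Suc k)" if "k \<ge> n" for k
  proof -
    define x P Q where "x = real (N + k)" and "P = real_of_int (poly p (int (N + k)))"
      and "Q = real_of_int (poly q (int (N + k)))"
    have x: "x > 0" using N1[OF that] by (simp add: x_def)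
    have PQ: "P > 0" "Q > 0" using pos[of k] by (simp_all add: P_def Q_def)
    have "pnorm (slack C) < int (N + n)" using pnorm_slack[of C] n by linarith
    then have "sgn (poly (slack C) (int (N + k))) = sgn (poly (slack C) (int (N + n)))"
      using that by (intro sgn_poly_eventually_const) auto
    then have "0 \<le> real_of_int (poly (slack C) (int (N + k)))"
      using slack by (auto simp: sgn_if split: if_splits)
    then have "P * (x + 1) * (x - real C) \<le> Q * x * (x + 1 - real C)"
      by (simp add: poly_slack P_def Q_def x_def)
    then have *: "(x - real C) * (P * (x + 1)) \<le> Q * (x + 1 - real C) * x"
      by (simp add: mult_ac)
    have "a / b \<le> c / e" if "a * e \<le> c * b" "b > 0" "e > 0" for a b c e :: real
      using that by (simp add: field_simps)
    from this[OF *] have "(x - real C) / x \<le> Q / P * (x + 1 - real C) / (x + 1)"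
      using PQ x by simp
    then have "u k * ((x - real C) / x) \<le> u k * (Q / P * (x + 1 - real C) / (x + 1))"
      using u_pos[of k] by (intro mult_left_mono) auto
    then show ?thesis
      by (simp add: V_def ratio_Suc P_def Q_def x_def add.commute add.left_commute)
  qed
  have V: "V n \<le> V k" if "n \<le> k" for k
    using that by (induction k rule: dec_induct) (auto intro: order.trans step)
  have Vu: "V k \<le> u k" if "k \<ge> n" for k
  proof -
    have "(real (N + k) - real C) / real (N + k) \<le> 1" using N1[OF that] by simp
    then show ?thesis
      using mult_left_mono[OF _ less_imp_le[OF u_pos[of k]]] by (fastforce simp: V_def)
  qed
  have "V n \<le> u k"
  proof (cases "n \<le> k")
    case True
    with V Vu show ?thesis by (meson order.trans)
  next
    case False
    then have "u n \<le> u k" using u_antimono by (simp add: decseq_def)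
    with Vu[of n] show ?thesis by simp
  qed
  then have "v * V n \<le> v * u k" using vw(1) by (intro mult_left_mono) auto
  with vw(2) show ?thesis by (simp add: V_def)
qed

text \<open>The slack polynomial is \<open>q - p\<close> times a monic quadratic, plus
  \<open>C * p\<close>. By the degree gap its coefficient at \<open>degree p\<close> is a fixed
  coefficient of \<open>q - p\<close> plus \<open>C\<close>, so a large enough \<open>C\<close>
  makes it eventually positive. The correction factor tends to 1, so the strict inequality
  survives.\<close>

lemma slack_complete:
  assumes deg: "degree (q - p) + 2 \<le> degree p"
    and L: "u \<longlonglongrightarrow> L" and vw: "v > 0" "w < v * L"
  shows "\<exists>n C. 2 * (int C + 2) * (pnorm p + pnorm q) < int (N + n) \<and>
    0 \<le> poly (slack C) (int (N + n)) \<and> w \<le> v * (u n * (real (N + n) - real C) / real (N + n))"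
proof -
  define f where "f = q - p"
  define C where "C = nat \<bar>coeff f (degree p - 2)\<bar> + 1"
  have f: "degree f + 2 \<le> degree p" using deg by (simp add: f_def)
  have slack: "slack C = f * [:0, 1 - int C, 1:] + smult (int C) p"
  proof -
    have "q * X - p * (X - [:c:]) = (q - p) * X + smult c p" for X c
      by (simp add: algebra_simps)
    from this[of "[:0, 1 - int C, 1:]" "int C"] show ?thesis
      by (simp add: slack_def f_def)
  qed
  obtain D where D: "degree p = Suc (Suc D)" using f by (metis add_2_eq_Suc' le_Suc_ex add_Suc_shift add_Suc)
  have "coeff f (Suc D) = 0" using f D by (intro coeff_eq_0) simp
  then have "coeff (f * [:0, 1 - int C, 1:]) (degree p) = coeff f D"
    by (simp add: D mult.commute[of f])
  then have "coeff (slack C) (degree p) = coeff f D + int C"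
    using monic(1) by (simp add: slack)
  then have coeff: "coeff (slack C) (degree p) > 0" by (simp add: C_def D)
  have "degree (f * [:0, 1 - int C, 1:]) \<le> degree f + 2"
    by (intro order.trans[OF degree_mult_le]) simp
  then have "degree (slack C) \<le> degree p"
    unfolding slack using f by (intro degree_add_le order.trans[OF degree_smult_le]) auto
  with coeff have "lead_coeff (slack C) > 0" by (metis le_antisym le_degree less_irrefl)
  then have ev1: "\<forall>\<^sub>F n in sequentially. poly (slack C) (int (N + n)) > 0"
    by (rule eventually_poly_pos)
  have ev2: "\<forall>\<^sub>F n in sequentially. 2 * (int C + 2) * (pnorm p + pnorm q) < int (N + n)"
    using eventually_gt_at_top[of "nat (2 * (int C + 2) * (pnorm p + pnorm q))"]
    by eventually_elim linarith
  have "(\<lambda>n. (real n + (real N - real C)) / (real n + real N)) \<longlonglongrightarrow> 1"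
    by real_asymp
  then have "(\<lambda>n. v * (u n * ((real n + (real N - real C)) / (real n + real N)))) \<longlonglongrightarrow> v * (L * 1)"
    by (intro tendsto_intros L)
  then have "\<forall>\<^sub>F n in sequentially. w < v * (u n * ((real n + (real N - real C)) / (real n + real N)))"
    using vw(2) by (intro order_tendstoD(1)) simp_all
  with ev1 ev2 have "\<forall>\<^sub>F n in sequentially. 2 * (int C + 2) * (pnorm p + pnorm q) < int (N + n) \<and>
    0 \<le> poly (slack C) (int (N + n)) \<and> w \<le> v * (u n * (real (N + n) - real C) / real (N + n))"
    by eventually_elim (auto simp: algebra_simps)
  then show ?thesis using eventually_happens trivial_limit_sequentially by blast
qed

end


section \<open>Certificates for the value of the limit\<close>

text \<open>Rescaled Chebyshev polynomials of the first kind, 2 T_n(y / 2); they express 2 cosh (n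
  x) through 2 cosh x.\<close>

fun tau :: "'a::comm_ring_1 \<Rightarrow> nat \<Rightarrow> 'a" where
  "tau y 0 = 2"
| "tau y (Suc 0) = y"
| "tau y (Suc (Suc n)) = y * tau y (Suc n) - tau y n"

lemma tau_cosh: "tau (2 * cosh x) n = 2 * cosh (real n * x)" for x :: real
proof (induction "2 * cosh x" n rule: tau.induct)
  case (3 n)
  have "cosh (real (Suc (Suc n)) * x) + cosh (real n * x) = 2 * cosh x * cosh (real (Suc n) * x)"
    using cosh_add[of "real (Suc n) * x" x] cosh_diff[of "real (Suc n) * x" x]
    by (simp add: algebra_simps)
  with 3 show ?case by (simp del: of_nat_Suc)
qed simp_all

lemma ipoly_numeral [simp]: "ipoly (numeral n) x = numeral n"
  by (simp add: numeral_poly)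

lemma ipoly_tau: "ipoly (tau [:0, 1:] n) y = tau y n"
  by (induction "[:0, 1:] :: int poly" n rule: tau.induct) simp_all

lemma ipoly_int: "ipoly p k = poly p k"
  by (induction p) simp_all

lemma degree_tau: "degree (tau [:0, 1:] n :: int poly) \<le> n"
proof (induction "[:0, 1:] :: int poly" n rule: tau.induct)
  case (3 n)
  then show ?case
    by (auto intro!: degree_diff_le order.trans[OF degree_pCons_le] simp del: tau.simps simp: tau.simps(3))
qed (simp_all add: numeral_poly)

text \<open>Numerator of \<open>quad_limit\<close>. It is generic in the ring so that it serves as a
  real number, as an integer value, and, at \<open>[:0, 1:]\<close>, as a polynomial in
  \<open>y\<close>.\<close>

definition quad_num :: "'a::comm_ring_1 \<Rightarrow> int \<times> nat \<Rightarrow> 'a" where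
  "quad_num y = (\<lambda>(m, b). if b = 0 then 1 else tau y b - (if even m then 2 else - 2))"

lemma ipoly_quad_num: "ipoly (quad_num [:0, 1:] r) y = quad_num y r"
  by (cases r) (simp add: quad_num_def ipoly_tau)

lemma degree_quad_num: "degree (quad_num [:0, 1:] r :: int poly) \<le> snd r"
  using degree_tau[of "snd r"]
  by (cases r) (auto simp: quad_num_def numeral_poly intro!: degree_diff_le degree_add_le)

abbreviation num_nonreal :: "(int \<times> nat) list \<Rightarrow> nat" where
  "num_nonreal rs \<equiv> (\<Sum>r\<leftarrow>rs. if snd r = 0 then 0 else 1)"

lemma quad_limit_eq:
  "quad_limit d r = quad_num (2 * cosh (pi * sqrt (- of_int d))) r / (4 * pi\<^sup>2) ^ (if snd r = 0 then 0 else 1)"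
  by (cases r) (simp add: quad_limit_def quad_num_def tau_cosh)

lemma prod_quad_limit:
  "(\<Prod>r\<leftarrow>rs. quad_limit d r / of_int (quad_weight d N r))
    = (\<Prod>r\<leftarrow>rs. quad_num (2 * cosh (pi * sqrt (- of_int d))) r)
      / (4 * pi\<^sup>2) ^ num_nonreal rs / of_int (\<Prod>r\<leftarrow>rs. quad_weight d N r)"
  unfolding quad_limit_eq prod_list_divide prod_list_power_sum of_int_prod_list by (simp add: o_def)

text \<open>One side of \<open>v ^ 4 * L ^ 4 = w ^ 4\<close> after clearing denominators and without
  its power of 4 pi^2. Weights are denominators, so those of \<open>P\<close> meet the numerators of
  \<open>Q\<close>; the other side exchanges \<open>P\<close> with \<open>Q\<close> and
  \<open>v\<close> with \<open>w\<close>.\<close>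

definition side :: "int \<Rightarrow> nat \<Rightarrow> int \<Rightarrow> (int \<times> nat) list \<Rightarrow> (int \<times> nat) list \<Rightarrow> int \<Rightarrow> int" where
  "side d N v P Q k = v ^ 4 * (\<Prod>r\<leftarrow>P. quad_weight d N r) * (\<Prod>r\<leftarrow>Q. quad_num k r)"

definition side_poly :: "int \<Rightarrow> nat \<Rightarrow> int \<Rightarrow> (int \<times> nat) list \<Rightarrow> (int \<times> nat) list \<Rightarrow> int poly" where
  "side_poly d N v P Q = smult (v ^ 4 * (\<Prod>r\<leftarrow>P. quad_weight d N r)) (\<Prod>r\<leftarrow>Q. quad_num [:0, 1:] r)"

lemma ipoly_side_poly:
  "ipoly (side_poly d N v P Q) y
    = of_int (v ^ 4 * (\<Prod>r\<leftarrow>P. quad_weight d N r)) * (\<Prod>r\<leftarrow>Q. quad_num y r)"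
  unfolding side_poly_def ipoly_smult ipoly_prod_list map_map o_def ipoly_quad_num ..

lemma poly_side_poly: "poly (side_poly d N v P Q) k = side d N v P Q k"
  by (simp add: side_def ipoly_side_poly flip: ipoly_int)

lemma degree_side_poly: "degree (side_poly d N v P Q) \<le> (\<Sum>r\<leftarrow>Q. snd r)"
  unfolding side_poly_def
  by (intro order.trans[OF degree_smult_le] degree_prod_list_less_eq degree_quad_num)

text \<open>The number of test points exceeds both \<open>2 * length rs\<close> and
  \<open>2 * length ps\<close>, which bound the degrees of the two sides. Coefficient lists stand
  for polynomials because programs operate on lists.\<close>

definition quad_factors :: "int \<Rightarrow> int list \<Rightarrow> (int \<times> nat) list \<Rightarrow> bool" where
  "quad_factors d ps rs \<longleftrightarrow> (\<forall>k<2 * length rs + 2 * length ps + 1.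
     4 ^ length rs * (poly (Poly ps) (int k))\<^sup>2 = (\<Prod>r\<leftarrow>rs. quad d r (int k)))"

lemma degree_Poly_le: "degree (Poly ps) \<le> length ps"
  by (induction ps) auto

lemma quad_factors_iff:
  "quad_factors d ps rs \<longleftrightarrow> (\<forall>k. 4 ^ length rs * (poly (Poly ps) k)\<^sup>2 = (\<Prod>r\<leftarrow>rs. quad d r k))"
proof
  assume f: "quad_factors d ps rs"
  define Q where "Q r = [:(fst r)\<^sup>2 - d * (int (snd r))\<^sup>2, - 4 * fst r, 4:]" for r
  have Q: "poly (Q r) k = quad d r k" for r k
    by (cases r) (simp add: Q_def quad_def algebra_simps power2_eq_square)
  have Qs: "poly (\<Prod>r\<leftarrow>rs. Q r) k = (\<Prod>r\<leftarrow>rs. quad d r k)" for k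
    by (induction rs) (simp_all add: Q)
  have "smult (4 ^ length rs) (Poly ps ^ 2) = (\<Prod>r\<leftarrow>rs. Q r)"
  proof (rule poly_eq_if_eq_on_nats[of _ "2 * length rs + 2 * length ps + 1"])
    have "degree (Poly ps ^ 2) \<le> degree (Poly ps) * 2" by (rule degree_power_le)
    then show "degree (smult (4 ^ length rs) ((Poly ps)\<^sup>2)) < 2 * length rs + 2 * length ps + 1"
      using degree_smult_le[of "4 ^ length rs" "(Poly ps)\<^sup>2"] degree_Poly_le[of ps] by linarith
    have "degree (\<Prod>r\<leftarrow>rs. Q r) \<le> (\<Sum>r\<leftarrow>rs. 2)"
      by (rule degree_prod_list_less_eq) (simp add: Q_def)
    then show "degree (\<Prod>r\<leftarrow>rs. Q r) < 2 * length rs + 2 * length ps + 1"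
      by (simp add: sum_list_triv)
  qed (use f in \<open>simp add: quad_factors_def Qs\<close>)
  then have "poly (smult (4 ^ length rs) (Poly ps ^ 2)) k = (\<Prod>r\<leftarrow>rs. quad d r k)" for k
    by (simp only: Qs)
  then show "\<forall>k. 4 ^ length rs * (poly (Poly ps) k)\<^sup>2 = (\<Prod>r\<leftarrow>rs. quad d r k)" by simp
qed (simp add: quad_factors_def)

text \<open>The parameters \<open>m\<close>, \<open>g1\<close>, \<open>g2\<close>, \<open>l\<close> are those of \<open>power_relation\<close> for
  \<open>y = 2 cosh (\<pi> \<surd>(-d))\<close> and \<open>z = 4 \<pi>\<^sup>2\<close>. Polynomial identities are checked at sufficiently many
  integers.\<close>

definition relation_check ::
  "int poly \<Rightarrow> int poly \<Rightarrow> int poly \<Rightarrow> int \<Rightarrow> nat \<Rightarrow> int \<Rightarrow> int \<Rightarrow> (int \<times> nat) list \<Rightarrow> (int \<times> nat) list \<Rightarrow>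
    nat \<Rightarrow> nat \<Rightarrow> int \<Rightarrow> int list \<Rightarrow> bool" where
  "relation_check m g1 g2 d N v w P Q j1 j2 c h \<longleftrightarrow>
     (\<forall>k<(j1 + j2) * (degree g1 + degree g2) + (\<Sum>r\<leftarrow>P. snd r) + (\<Sum>r\<leftarrow>Q. snd r) + degree m + length h + 1.
        c * (poly g1 (int k) ^ j1 * poly g2 (int k) ^ j2 * side d N v P Q (int k)
           - poly g2 (int k) ^ j1 * poly g1 (int k) ^ j2 * side d N w Q P (int k))
        = poly m (int k) * poly (Poly h) (int k))"

lemma relation_check_iff:
  "relation_check m g1 g2 d N v w P Q j1 j2 c h \<longleftrightarrow>
    smult c (g1 ^ j1 * g2 ^ j2 * side_poly d N v P Q - g2 ^ j1 * g1 ^ j2 * side_poly d N w Q P) = m * Poly h"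
    (is "?L \<longleftrightarrow> ?lhs = ?rhs")
proof
  assume L: ?L
  let ?B = "(j1 + j2) * (degree g1 + degree g2) + (\<Sum>r\<leftarrow>P. snd r) + (\<Sum>r\<leftarrow>Q. snd r) + degree m + length h + 1"
  have deg: "degree (f ^ i * g ^ j * s) \<le> (i + j) * (degree f + degree g) + degree s" for f g s :: "int poly" and i j
  proof -
    have "degree (f ^ i * g ^ j * s) \<le> degree f * i + degree g * j + degree s"
      by (intro order.trans[OF degree_mult_le] add_mono degree_power_le order_refl)
    also have "\<dots> \<le> (i + j) * (degree f + degree g) + degree s" by (simp add: algebra_simps)
    finally show ?thesis .
  qed
  show "?lhs = ?rhs"
  proof (rule poly_eq_if_eq_on_nats[of _ ?B])
    show "degree ?lhs < ?B"
    proof (rule le_less_trans[OF degree_smult_le], rule degree_diff_less)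
      show "degree (g1 ^ j1 * g2 ^ j2 * side_poly d N v P Q) < ?B"
        using deg[of g1 j1 g2 j2 "side_poly d N v P Q"] degree_side_poly[of d N v P Q] by simp
      show "degree (g2 ^ j1 * g1 ^ j2 * side_poly d N w Q P) < ?B"
        using deg[of g2 j1 g1 j2 "side_poly d N w Q P"] degree_side_poly[of d N w Q P]
        by (simp add: add.commute[of "degree g2"])
    qed
    show "degree ?rhs < ?B"
      using degree_mult_le[of m "Poly h"] degree_Poly_le[of h] by simp
    show "poly ?lhs (int k) = poly ?rhs (int k)" if "k < ?B" for k
      using L that unfolding relation_check_def by (simp add: poly_side_poly)
  qed
next
  assume "?lhs = ?rhs"
  then have "poly ?lhs (int k) = poly ?rhs (int k)" for k by simp
  then show ?L by (simp add: relation_check_def poly_side_poly)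
qed

text \<open>The root lists are guessed and verified by the search, so no factorisation algorithm has
  to be implemented.\<close>

definition limit_certificate ::
  "int poly \<times> int poly \<times> int poly \<times> nat \<Rightarrow> int \<Rightarrow> int list \<Rightarrow> int list \<Rightarrow> int \<Rightarrow> int \<Rightarrow> nat \<Rightarrow> bool" where
  "limit_certificate = (\<lambda>(m, g1, g2, l) d ps qs v w N. \<exists>P Q j1 j2 c h.
     quad_factors d ps P \<and> quad_factors d qs Q \<and> admissible N P \<and> admissible N Q \<and>
     length P = length Q \<and> (\<Sum>r\<leftarrow>P. fst r) = (\<Sum>r\<leftarrow>Q. fst r) \<and> c \<noteq> 0 \<and>
     num_nonreal P + l * j2 = num_nonreal Q + l * j1 \<and> relation_check m g1 g2 d N v w P Q j1 j2 c h)"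

definition relation_data :: "int \<Rightarrow> int poly \<times> int poly \<times> int poly \<times> nat \<Rightarrow> bool" where
  "relation_data d = (\<lambda>(m, g1, g2, l). let y = 2 * cosh (pi * sqrt (- of_int d)) in
     \<forall>A B e1 e2. ipoly A y \<noteq> 0 \<longrightarrow> ipoly B y \<noteq> 0 \<longrightarrow>
       (4 * pi\<^sup>2) ^ e1 * ipoly A y = (4 * pi\<^sup>2) ^ e2 * ipoly B y \<longleftrightarrow>
       (\<exists>j1 j2 c h. c \<noteq> 0 \<and> e1 + l * j2 = e2 + l * j1 \<and>
         smult c (g1 ^ j1 * g2 ^ j2 * A - g2 ^ j1 * g1 ^ j2 * B) = m * h))"

lemma ex_relation_data: "\<exists>R. relation_data d R"
proof -
  let ?y = "2 * cosh (pi * sqrt (- of_int d))"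
  have "4 * pi\<^sup>2 \<noteq> 0" by simp
  from power_relation[OF this, of ?y]
  obtain m g1 g2 l where "\<forall>A B e1 e2. ipoly A ?y \<noteq> 0 \<longrightarrow> ipoly B ?y \<noteq> 0 \<longrightarrow>
      (4 * pi\<^sup>2) ^ e1 * ipoly A ?y = (4 * pi\<^sup>2) ^ e2 * ipoly B ?y \<longleftrightarrow>
      (\<exists>j1 j2 c h. c \<noteq> 0 \<and> e1 + l * j2 = e2 + l * j1 \<and>
        smult c (g1 ^ j1 * g2 ^ j2 * A - g2 ^ j1 * g1 ^ j2 * B) = m * h)"
    by blast
  then show ?thesis
    by (intro exI[of _ "(m, g1, g2, l)"]) (simp add: relation_data_def Let_def)
qed

text \<open>Nonnegativity of \<open>L\<close> and positivity of \<open>v\<close>, \<open>w\<close>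
  allow passing to fourth powers, where the Gamma limit turns the question into a relation of the
  kind governed by \<open>R\<close>.\<close>

lemma limit_certificate_iff:
  assumes d: "d < 0" and R: "relation_data d R" and vw: "v > 0" "w > 0"
    and PQ: "quad_factors d ps P" "quad_factors d qs Q" "admissible N P" "admissible N Q"
      "length P = length Q" "(\<Sum>r\<leftarrow>P. fst r) = (\<Sum>r\<leftarrow>Q. fst r)"
    and L: "ratio (Poly ps) (Poly qs) N \<longlonglongrightarrow> L" "L \<ge> 0"
  shows "v * L = w \<longleftrightarrow> (\<exists>j1 j2 c h. c \<noteq> 0 \<and>
    num_nonreal P + snd (snd (snd R)) * j2 = num_nonreal Q + snd (snd (snd R)) * j1 \<and>
    relation_check (fst R) (fst (snd R)) (fst (snd (snd R))) d N v w P Q j1 j2 c h)"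
proof -
  let ?y = "2 * cosh (pi * sqrt (- real_of_int d))" and ?z = "4 * pi\<^sup>2"
  let ?n = "\<lambda>rs. \<Prod>r\<leftarrow>rs. quad_num ?y r" and ?w = "\<lambda>rs. real_of_int (\<Prod>r\<leftarrow>rs. quad_weight d N r)"
  let ?A = "side_poly d N v P Q" and ?B = "side_poly d N w Q P"
  have num: "quad_num ?y r > 0" for r
    using quad_limit_pos[OF d, of r] by (simp add: quad_limit_eq zero_less_divide_iff split: if_splits)
  have n: "?n rs > 0" for rs
    by (induction rs) (simp_all add: num)
  have "(\<Prod>r\<leftarrow>rs. quad_weight d N r) > 0" for rs
    by (induction rs) (simp_all add: quad_weight_pos[OF d])
  then have w: "?w rs > 0" for rs by (simp only: of_int_0_less_iff)
  have "(\<lambda>n. ratio (Poly ps) (Poly qs) N n ^ 4) \<longlonglongrightarrow> L ^ 4"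
    by (intro tendsto_intros L)
  moreover have "(\<lambda>n. ratio (Poly ps) (Poly qs) N n ^ 4)
      = (\<lambda>n. (\<Prod>k<n. of_int (\<Prod>r\<leftarrow>Q. quad d r (int (N + k))) / of_int (\<Prod>r\<leftarrow>P. quad d r (int (N + k)))) ^ 2)"
  proof
    fix n
    have "ratio (Poly ps) (Poly qs) N n ^ 2
        = (\<Prod>k<n. of_int (4 ^ length Q * (poly (Poly qs) (int (N + k)))\<^sup>2) / of_int (4 ^ length P * (poly (Poly ps) (int (N + k)))\<^sup>2))"
      by (simp add: ratio_def PQ(5) power_divide prod_power_distrib)
    also have "\<dots> = (\<Prod>k<n. of_int (\<Prod>r\<leftarrow>Q. quad d r (int (N + k))) / of_int (\<Prod>r\<leftarrow>P. quad d r (int (N + k))))"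
      using PQ(1,2) unfolding quad_factors_iff by (simp only:)
    finally show "ratio (Poly ps) (Poly qs) N n ^ 4
        = (\<Prod>k<n. of_int (\<Prod>r\<leftarrow>Q. quad d r (int (N + k))) / of_int (\<Prod>r\<leftarrow>P. quad d r (int (N + k)))) ^ 2"
      by (metis power_mult mult_2 numeral_Bit0)
  qed
  ultimately have "L ^ 4 = (\<Prod>r\<leftarrow>Q. quad_limit d r / of_int (quad_weight d N r)) / (\<Prod>r\<leftarrow>P. quad_limit d r / of_int (quad_weight d N r))"
    using LIMSEQ_unique[OF _ quad_ratio_limit[OF d PQ(3-6)]] by simp
  then have L4: "L ^ 4 = ?n Q / ?z ^ num_nonreal Q / ?w Q / (?n P / ?z ^ num_nonreal P / ?w P)"
    by (simp only: prod_quad_limit)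
  have "v * L = w \<longleftrightarrow> (real_of_int v * L) ^ 4 = real_of_int w ^ 4"
    using L(2) vw by (intro power_eq_iff_eq_base[symmetric]) auto
  also have "\<dots> \<longleftrightarrow> v ^ 4 * L ^ 4 = w ^ 4" by (simp add: power_mult_distrib)
  also have "\<dots> \<longleftrightarrow> ?z ^ num_nonreal P * ipoly ?A ?y = ?z ^ num_nonreal Q * ipoly ?B ?y"
  proof -
    define a b c e f g h i where "a = ?n Q" and "b = ?z ^ num_nonreal Q" and "c = ?w Q"
      and "e = ?n P" and "f = ?z ^ num_nonreal P" and "g = ?w P"
      and "h = real_of_int v ^ 4" and "i = real_of_int w ^ 4"
    have nz: "a \<noteq> 0" "b \<noteq> 0" "c \<noteq> 0" "e \<noteq> 0" "f \<noteq> 0" "g \<noteq> 0"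
      using n[of Q] n[of P] w[of Q] w[of P] by (simp_all add: a_def b_def c_def e_def f_def g_def)
    have "h * (a / b / c / (e / f / g)) = i \<longleftrightarrow> f * (h * g * a) = b * (i * c * e)"
      using nz by (simp add: field_simps)
    then show ?thesis
      unfolding L4 ipoly_side_poly of_int_mult of_int_power a_def b_def c_def e_def f_def g_def h_def i_def .
  qed
  also have "\<dots> \<longleftrightarrow> (\<exists>j1 j2 c h. c \<noteq> 0 \<and>
      num_nonreal P + snd (snd (snd R)) * j2 = num_nonreal Q + snd (snd (snd R)) * j1 \<and>
      smult c (fst (snd R) ^ j1 * fst (snd (snd R)) ^ j2 * ?A - fst (snd (snd R)) ^ j1 * fst (snd R) ^ j2 * ?B) = fst R * h)"
  proof -
    have "ipoly ?A ?y \<noteq> 0" "ipoly ?B ?y \<noteq> 0"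
      unfolding ipoly_side_poly of_int_mult of_int_power
      using n[of Q] n[of P] w[of Q] w[of P] vw by simp_all
    then show ?thesis using R by (cases R) (simp add: relation_data_def Let_def)
  qed
  also have "\<dots> \<longleftrightarrow> (\<exists>j1 j2 c h. c \<noteq> 0 \<and>
      num_nonreal P + snd (snd (snd R)) * j2 = num_nonreal Q + snd (snd (snd R)) * j1 \<and>
      relation_check (fst R) (fst (snd R)) (fst (snd (snd R))) d N v w P Q j1 j2 c h)"
    unfolding relation_check_iff by (metis Poly_coeffs)
  finally show ?thesis .
qed

text \<open>Cross-multiplied integer form of the slack conditions; it is equivalent to them once the
  values of \<open>p\<close> in the product are positive.\<close>

definition slack_certificate :: "int poly \<Rightarrow> int poly \<Rightarrow> int \<Rightarrow> int \<Rightarrow> nat \<Rightarrow> bool" where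
  "slack_certificate p q v w N \<longleftrightarrow> (\<exists>n C::nat. let x = int (N + n) in
     2 * (int C + 2) * (pnorm p + pnorm q) < x \<and>
     poly p x * (x + 1) * (x - int C) \<le> poly q x * x * (x + 1 - int C) \<and>
     w * (\<Prod>k<n. poly p (int (N + k))) * x \<le> v * (\<Prod>k<n. poly q (int (N + k))) * (x - int C))"

lemma (in decreasing_ratio) slack_certificate_iff:
  "slack_certificate p q v w N \<longleftrightarrow> (\<exists>n C. 2 * (int C + 2) * (pnorm p + pnorm q) < int (N + n) \<and>
    0 \<le> poly (slack C) (int (N + n)) \<and>
    real_of_int w \<le> real_of_int v * (u n * (real (N + n) - real C) / real (N + n)))"
proof -
  have "w * (\<Prod>k<n. poly p (int (N + k))) * int (N + n) \<le> v * (\<Prod>k<n. poly q (int (N + k))) * (int (N + n) - int C)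
    \<longleftrightarrow> real_of_int w \<le> real_of_int v * (u n * (real (N + n) - real C) / real (N + n))" for n C
  proof -
    define Pp Pq where "Pp = (\<Prod>k<n. real_of_int (poly p (int (N + k))))"
      and "Pq = (\<Prod>k<n. real_of_int (poly q (int (N + k))))"
    have "Pp > 0" unfolding Pp_def using pos by (intro prod_pos) simp
    have "int N > 0" using N pnorm_nonneg[of p] pnorm_nonneg[of q] by linarith
    then have x: "real (N + n) > 0" by simp
    have field: "a * Pp * x \<le> b * Pq * (x - c) \<longleftrightarrow> a \<le> b * (Pq / Pp * (x - c) / x)"
      if "x > 0" for a b c x
      using that \<open>Pp > 0\<close> by (simp add: field_simps)
    have u: "u n = Pq / Pp" by (simp add: ratio_def Pp_def Pq_def prod_dividef)
    have "w * (\<Prod>k<n. poly p (int (N + k))) * int (N + n) \<le> v * (\<Prod>k<n. poly q (int (N + k))) * (int (N + n) - int C)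
      \<longleftrightarrow> real_of_int (w * (\<Prod>k<n. poly p (int (N + k))) * int (N + n)) \<le> real_of_int (v * (\<Prod>k<n. poly q (int (N + k))) * (int (N + n) - int C))"
      by (simp only: of_int_le_iff)
    also have "\<dots> \<longleftrightarrow> real_of_int w * Pp * real (N + n) \<le> real_of_int v * Pq * (real (N + n) - real C)"
      by (simp add: Pp_def Pq_def)
    also have "\<dots> \<longleftrightarrow> real_of_int w \<le> real_of_int v * (u n * (real (N + n) - real C) / real (N + n))"
      unfolding u by (rule field[OF x])
    finally show ?thesis .
  qed
  then show ?thesis
    unfolding slack_certificate_def Let_def poly_slack by (simp only: diff_ge_0_iff_ge)
qed

definition bound_certificate ::
  "int poly \<times> int poly \<times> int poly \<times> nat \<Rightarrow> int \<Rightarrow> int list \<Rightarrow> int list \<Rightarrow> int \<Rightarrow> int \<Rightarrow> nat \<Rightarrow> bool" where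
  "bound_certificate R d ps qs v w N \<longleftrightarrow> poly (Poly qs) (int N) < poly (Poly ps) (int N) \<and>
     (slack_certificate (Poly ps) (Poly qs) v w N \<or> limit_certificate R d ps qs v w N)"

lemma bound_certificate_sound:
  assumes d: "d < 0" and R: "relation_data d R" and vw: "v > 0" "w > 0"
    and monic: "lead_coeff (Poly ps) = 1" "lead_coeff (Poly qs) = 1"
    and N: "pnorm (Poly ps) + pnorm (Poly qs) < int N"
    and cert: "bound_certificate R d ps qs v w N"
  shows "bounded_below (Poly ps) (Poly qs) v w N"
proof -
  interpret decreasing_ratio "Poly ps" "Poly qs" N
    by standard (use monic N cert in \<open>auto simp: bound_certificate_def\<close>)
  consider "slack_certificate (Poly ps) (Poly qs) v w N" | "limit_certificate R d ps qs v w N"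
    using cert by (auto simp: bound_certificate_def)
  then have "of_int w \<le> of_int v * u k" for k
  proof cases
    case 1
    then show ?thesis
      unfolding slack_certificate_iff using slack_sound[of _ _ "real_of_int v" "real_of_int w" k] vw by auto
  next
    case 2
    obtain L where L: "u \<longlonglongrightarrow> L" "\<And>n. L \<le> u n" using convergent by blast
    have "L \<ge> 0" using L(1) u_pos by (intro LIMSEQ_le_const[OF L(1)]) (auto intro: less_imp_le)
    obtain P Q j1 j2 c h where PQ: "quad_factors d ps P" "quad_factors d qs Q" "admissible N P" "admissible N Q"
      "length P = length Q" "(\<Sum>r\<leftarrow>P. fst r) = (\<Sum>r\<leftarrow>Q. fst r)"
      and "c \<noteq> 0 \<and>
        num_nonreal P + snd (snd (snd R)) * j2 = num_nonreal Q + snd (snd (snd R)) * j1 \<and>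
        relation_check (fst R) (fst (snd R)) (fst (snd (snd R))) d N v w P Q j1 j2 c h"
      using 2 unfolding limit_certificate_def by (cases R) auto
    then have "v * L = w" using limit_certificate_iff[OF d R vw PQ L(1) \<open>L \<ge> 0\<close>] by blast
    then show ?thesis using L(2)[of k] vw(1) by (metis mult_left_mono of_int_0_le_iff order_less_imp_le)
  qed
  then show ?thesis using less_N by (simp add: bounded_below_def)
qed

text \<open>A limit strictly above \<open>w / v\<close> has a slack certificate, and a limit equal
  to it has a limit certificate. \<open>N0\<close> must be uniform in \<open>v\<close> and
  \<open>w\<close>, since these are later computed from the term at index \<open>N\<close>.\<close>

lemma bound_certificate_complete:
  assumes d: "squarefree d" "d < 0" and R: "relation_data d R"
    and monic: "lead_coeff (Poly ps) = 1" "lead_coeff (Poly qs) = 1"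
    and splits: "splits_over (quadratic_field d) (Poly ps)" "splits_over (quadratic_field d) (Poly qs)"
  shows "\<exists>N0. \<forall>N\<ge>N0. \<forall>v>0. \<forall>w>0.
    bounded_below (Poly ps) (Poly qs) v w N \<longrightarrow> bound_certificate R d ps qs v w N"
proof -
  obtain P where P: "length P = degree (Poly ps)"
    "\<forall>k. 4 ^ length P * (poly (Poly ps) k)\<^sup>2 = (\<Prod>r\<leftarrow>P. quad d r k)"
    "\<forall>r\<in>set P. snd r = 0 \<longrightarrow> even (fst r)"
    "degree (Poly ps) > 0 \<longrightarrow> (\<Sum>r\<leftarrow>P. fst r) = - 2 * coeff (Poly ps) (degree (Poly ps) - 1)"
    using splits_over_quadratic_field[OF d monic(1) splits(1)] by (elim exE conjE) (rule that)
  obtain Q where Q: "length Q = degree (Poly qs)"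
    "\<forall>k. 4 ^ length Q * (poly (Poly qs) k)\<^sup>2 = (\<Prod>r\<leftarrow>Q. quad d r k)"
    "\<forall>r\<in>set Q. snd r = 0 \<longrightarrow> even (fst r)"
    "degree (Poly qs) > 0 \<longrightarrow> (\<Sum>r\<leftarrow>Q. fst r) = - 2 * coeff (Poly qs) (degree (Poly qs) - 1)"
    using splits_over_quadratic_field[OF d monic(2) splits(2)] by (elim exE conjE) (rule that)
  \<comment> \<open>Including all values \<open>\<bar>fst r\<bar>\<close> puts \<open>N\<close>
    beyond twice the real part of every root, which makes both root lists admissible.\<close>
  define N0 where "N0 = Suc (nat (pnorm (Poly ps) + pnorm (Poly qs) + (\<Sum>r\<leftarrow>P @ Q. \<bar>fst r\<bar>)))"
  have "bound_certificate R d ps qs v w N"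
    if "N \<ge> N0" and vw: "v > 0" "w > 0" and below: "bounded_below (Poly ps) (Poly qs) v w N" for N v w
  proof -
    have large: "pnorm (Poly ps) + pnorm (Poly qs) + (\<Sum>r\<leftarrow>P @ Q. \<bar>fst r\<bar>) < int N"
      using \<open>N \<ge> N0\<close> unfolding N0_def by linarith
    have fst: "\<bar>fst r\<bar> \<le> (\<Sum>r\<leftarrow>P @ Q. \<bar>fst r\<bar>)" if "r \<in> set (P @ Q)" for r
      using that by (intro member_le_sum_list) auto
    have "0 \<le> (\<Sum>r\<leftarrow>P @ Q. \<bar>fst r\<bar>)" by (intro sum_list_nonneg) auto
    with large have N': "pnorm (Poly ps) + pnorm (Poly qs) < int N" by linarith
    interpret decreasing_ratio "Poly ps" "Poly qs" N
      by standard (use monic N' below in \<open>auto simp: bounded_below_def\<close>)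
    have "\<bar>fst r\<bar> < int N" if "r \<in> set (P @ Q)" for r
      using fst[OF that] large pnorm_nonneg[of "Poly ps"] pnorm_nonneg[of "Poly qs"] by linarith
    then have "fst r < 2 * int N" if "r \<in> set (P @ Q)" for r
      using that by (smt (verit))
    then have adm: "admissible N P" "admissible N Q"
      using P(3) Q(3) by (auto simp: admissible_def)
    obtain L where L: "u \<longlonglongrightarrow> L" "\<And>n. L \<le> u n" using convergent by blast
    have "L \<ge> 0" using L(1) u_pos by (intro LIMSEQ_le_const[OF L(1)]) (auto intro: less_imp_le)
    have w: "of_int w \<le> of_int v * u n" for n using below by (simp add: bounded_below_def)
    \<comment> \<open>The positive lower bound \<open>w / v\<close> excludes convergence to 0, so
      the two leading coefficients of \<open>p\<close> and \<open>q\<close> agree; this gives equal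
      lengths and equal root sums.\<close>
    have deg: "degree (Poly qs - Poly ps) + 2 \<le> degree (Poly ps)"
    proof (rule degree_diff)
      show "real_of_int w / of_int v > 0" using vw by simp
      show "real_of_int w / of_int v \<le> u n" for n using w[of n] vw by (simp add: field_simps)
    qed
    have coeff: "coeff (Poly qs) k = coeff (Poly ps) k" if "k > degree (Poly qs - Poly ps)" for k
      using coeff_eq_0[OF that] by simp
    have degree: "degree (Poly qs) = degree (Poly ps)"
    proof (rule antisym)
      have "Poly qs = Poly ps + (Poly qs - Poly ps)" by simp
      then show "degree (Poly qs) \<le> degree (Poly ps)"
        using deg by (metis degree_add_le add_leD1 order_refl)
      show "degree (Poly ps) \<le> degree (Poly qs)"
        using coeff[of "degree (Poly ps)"] deg monic(1) by (intro le_degree) simp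
    qed
    then have len: "length P = length Q" by (simp add: P(1) Q(1))
    have "coeff (Poly qs) (degree (Poly qs) - 1) = coeff (Poly ps) (degree (Poly ps) - 1)"
      unfolding degree using deg by (intro coeff) linarith
    then have sum: "(\<Sum>r\<leftarrow>P. fst r) = (\<Sum>r\<leftarrow>Q. fst r)"
      using P(4) Q(4) degree deg by simp
    have factors: "quad_factors d ps P" "quad_factors d qs Q"
      using P(2) Q(2) by (simp_all add: quad_factors_iff)
    have "of_int w \<le> of_int v * L"
      by (rule LIMSEQ_le_const[of "\<lambda>n. of_int v * u n"]) (auto intro!: tendsto_intros L w)
    then consider "of_int w < of_int v * L" | "of_int v * L = of_int w" by linarith
    then show ?thesis
    proof cases
      case 1
      then have "slack_certificate (Poly ps) (Poly qs) v w N"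
        unfolding slack_certificate_iff using vw by (intro slack_complete[OF deg L(1)]) auto
      then show ?thesis using less_N by (simp add: bound_certificate_def)
    next
      case 2
      then have "\<exists>j1 j2 c h. c \<noteq> 0 \<and>
          num_nonreal P + snd (snd (snd R)) * j2 = num_nonreal Q + snd (snd (snd R)) * j1 \<and>
          relation_check (fst R) (fst (snd R)) (fst (snd (snd R))) d N v w P Q j1 j2 c h"
        using limit_certificate_iff[OF d(2) R vw factors adm len sum L(1) \<open>L \<ge> 0\<close>] by simp
      then have "limit_certificate R d ps qs v w N"
        unfolding limit_certificate_def using factors adm len sum
        by (cases R) (simp only: prod.case fst_conv snd_conv, blast)
      then show ?thesis using less_N by (simp add: bound_certificate_def)
    qed
  qed
  then show ?thesis by blast
qed


section \<open>Certificates for hypergeometric sequences\<close>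

text \<open>The second alternative treats growing absolute values through reciprocals. Each
  alternative itself tests the direction of monotonicity.\<close>

definition limit_side ::
  "int poly \<times> int poly \<times> int poly \<times> nat \<Rightarrow> int \<Rightarrow> int list \<Rightarrow> int list \<Rightarrow> int \<Rightarrow> int \<Rightarrow> nat \<Rightarrow> bool" where
  "limit_side R d ps qs v w N \<longleftrightarrow> bound_certificate R d ps qs v w N \<or> bound_certificate R d qs ps w v N"

definition numer :: "int list \<Rightarrow> int \<Rightarrow> nat \<Rightarrow> int" where
  "numer ps a n = a * (\<Prod>k<n. poly (Poly ps) (int k))"

text \<open>Below, \<open>x\<close> is the numerator of \<open>u n * t'\<close> and \<open>y\<close> that of \<open>t * u'\<close> when \<open>u n\<close> and \<open>t\<close> are
  written as fractions with denominators \<open>u'\<close> and \<open>t'\<close>; so \<open>u n / t = x / y\<close>.\<close>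

definition never_equal ::
  "int poly \<times> int poly \<times> int poly \<times> nat \<Rightarrow> int \<Rightarrow> int list \<Rightarrow> int list \<Rightarrow> int \<times> int \<Rightarrow> int \<times> int \<Rightarrow> bool" where
  "never_equal R d ps qs a t \<longleftrightarrow>
     (let x = \<lambda>n. numer qs (fst a) n * snd t; y = \<lambda>n. fst t * numer ps (snd a) n in
      \<exists>N. (\<forall>n<N. x n \<noteq> y n) \<and>
        (x N = 0 \<or> pnorm (Poly ps) + pnorm (Poly qs) < int N \<and> x N \<noteq> y N \<and>
          (ps = qs \<or> x N * y N < 0 \<or>
           poly (Poly ps) (int N) < poly (Poly qs) (int N) \<and> \<bar>y N\<bar> < \<bar>x N\<bar> \<or>
           poly (Poly qs) (int N) < poly (Poly ps) (int N) \<and> \<bar>x N\<bar> < \<bar>y N\<bar> \<or>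
           limit_side R d ps qs \<bar>x N\<bar> \<bar>y N\<bar> N)))"

text \<open>The denominator of a term may be negative at small indices, so both sides are multiplied
  by it once more. The range \<open>n < Suc N\<close> includes \<open>N\<close>, whose inequality is
  the starting point for the tail.\<close>

definition always_ge ::
  "int poly \<times> int poly \<times> int poly \<times> nat \<Rightarrow> int \<Rightarrow> int list \<Rightarrow> int list \<Rightarrow> int \<times> int \<Rightarrow> int \<times> int \<Rightarrow> bool" where
  "always_ge R d ps qs a t \<longleftrightarrow>
     (let x = \<lambda>n. numer qs (fst a) n * snd t; y = \<lambda>n. fst t * numer ps (snd a) n in
      \<exists>N. (\<forall>n<Suc N. y n * numer ps (snd a) n \<le> x n * numer ps (snd a) n) \<and>
        (x N = 0 \<or> pnorm (Poly ps) + pnorm (Poly qs) < int N \<and>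
          (ps = qs \<or> x N * y N < 0 \<or>
           poly (Poly ps) (int N) < poly (Poly qs) (int N) \<and> 0 < fst t \<or>
           poly (Poly qs) (int N) < poly (Poly ps) (int N) \<and> fst t < 0 \<or>
           limit_side R d ps qs \<bar>x N\<bar> \<bar>y N\<bar> N)))"

lemma ratio_swap: "ratio q p N n = inverse (ratio p q N n)"
  by (simp add: ratio_def prod_inversef[symmetric])

section \<open>Sign and monotonicity of the tail of a hypergeometric sequence\<close>

locale monic_hypergeometric =
  fixes p q :: "int poly" and u :: "nat \<Rightarrow> real"
  assumes monic: "lead_coeff p = 1" "lead_coeff q = 1"
    and p_nz: "\<And>n. poly p (int n) \<noteq> 0"
    and rec: "\<And>n. u (Suc n) = of_int (poly q (int n)) / of_int (poly p (int n)) * u n"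
begin

lemma zero_tail:
  assumes "u N = 0" and "N \<le> n"
  shows "u n = 0"
  using assms(2) by (induction rule: dec_induct) (simp_all add: rec assms(1))

lemma tail: "u (N + n) = u N * ratio p q N n"
  by (induction n) (simp_all add: rec ratio_Suc)

lemma tail_pos:
  assumes "pnorm p + pnorm q < int N"
  shows "ratio p q N n > 0"
proof -
  have "poly p (int (N + k)) > 0 \<and> poly q (int (N + k)) > 0" for k
    using sgn_poly_eq_lead_coeff[of p "int (N + k)"] sgn_poly_eq_lead_coeff[of q "int (N + k)"] assms
      monic pnorm_nonneg[of p] pnorm_nonneg[of q]
    by (auto simp: sgn_if split: if_splits)
  then show ?thesis by (simp add: ratio_def prod_pos)
qed

lemma abs_tail:
  assumes "pnorm p + pnorm q < int N"
  shows "\<bar>u (N + n)\<bar> = \<bar>u N\<bar> * ratio p q N n"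
  using tail_pos[OF assms, of n] by (simp add: tail abs_mult)

lemma sgn_tail:
  assumes "pnorm p + pnorm q < int N"
  shows "sgn (u (N + n)) = sgn (u N)"
  using tail_pos[OF assms, of n] by (simp add: tail sgn_mult)

lemma const_tail: "p = q \<Longrightarrow> u n = u 0"
  using p_nz by (induction n) (simp_all add: rec)

lemma increasing_or_decreasing:
  assumes N: "pnorm p + pnorm q < int N" and "u N \<noteq> 0"
  shows "poly q (int N) < poly p (int N) \<Longrightarrow> \<bar>u (N + Suc n)\<bar> < \<bar>u (N + n)\<bar>"
    and "poly p (int N) < poly q (int N) \<Longrightarrow> \<bar>u (N + n)\<bar> < \<bar>u (N + Suc n)\<bar>"
    and "poly p (int N) = poly q (int N) \<Longrightarrow> p = q"
proof -
  assume less: "poly q (int N) < poly p (int N)"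
  interpret decreasing_ratio p q N by standard (use monic N less in auto)
  show "\<bar>u (N + Suc n)\<bar> < \<bar>u (N + n)\<bar>"
    unfolding abs_tail[OF assms(1)] using u_decreasing[of n] \<open>u N \<noteq> 0\<close> by simp
next
  assume less: "poly p (int N) < poly q (int N)"
  interpret decreasing_ratio q p N by standard (use monic N less in auto)
  show "\<bar>u (N + n)\<bar> < \<bar>u (N + Suc n)\<bar>"
    unfolding abs_tail[OF assms(1)] using u_decreasing[of n] \<open>u N \<noteq> 0\<close> tail_pos[OF assms(1)]
    by (simp add: ratio_swap[of q p])
next
  assume "poly p (int N) = poly q (int N)"
  moreover have "pnorm (p - q) < int N" using N pnorm_diff[of p q] by simp
  ultimately have "sgn (lead_coeff (p - q)) = 0"
    using sgn_poly_eq_lead_coeff[of "p - q" "int N"] by simp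
  then have "p - q = 0" by (simp only: sgn_0_0 leading_coeff_0_iff)
  then show "p = q" by simp
qed

lemma mono_tail:
  assumes N: "pnorm p + pnorm q < int N" and "u N \<noteq> 0"
  shows "poly q (int N) < poly p (int N) \<Longrightarrow> \<bar>u (N + n)\<bar> \<le> \<bar>u N\<bar>"
    and "poly p (int N) < poly q (int N) \<Longrightarrow> \<bar>u N\<bar> \<le> \<bar>u (N + n)\<bar>"
proof -
  show "\<bar>u (N + n)\<bar> \<le> \<bar>u N\<bar>" if "poly q (int N) < poly p (int N)"
  proof (induction n)
    case (Suc n)
    with increasing_or_decreasing(1)[OF N \<open>u N \<noteq> 0\<close> that, of n] show ?case by linarith
  qed simp
  show "\<bar>u N\<bar> \<le> \<bar>u (N + n)\<bar>" if "poly p (int N) < poly q (int N)"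
  proof (induction n)
    case (Suc n)
    with increasing_or_decreasing(2)[OF N \<open>u N \<noteq> 0\<close> that, of n] show ?case by linarith
  qed simp
qed

text \<open>The positive scale \<open>c\<close> clears denominators of the term and the target at
  once. The second equivalence is the reciprocal of the first: an upper bound on a growing
  sequence.\<close>

lemma bounded_below_iff:
  assumes N: "pnorm p + pnorm q < int N" and c: "c > 0"
    and v: "of_int v = c * \<bar>u N\<bar>" and w: "of_int w = c * \<tau>"
  shows "bounded_below p q v w N \<longleftrightarrow> poly q (int N) < poly p (int N) \<and> (\<forall>n. \<tau> \<le> \<bar>u (N + n)\<bar>)"
    and "bounded_below q p w v N \<longleftrightarrow> poly p (int N) < poly q (int N) \<and> (\<forall>n. \<bar>u (N + n)\<bar> \<le> \<tau>)"
proof -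
  have "of_int w \<le> of_int v * ratio p q N n \<longleftrightarrow> \<tau> \<le> \<bar>u (N + n)\<bar>" for n
    unfolding v w abs_tail[OF N] mult.assoc using c by (rule mult_le_cancel_left_pos)
  then show "bounded_below p q v w N \<longleftrightarrow> poly q (int N) < poly p (int N) \<and> (\<forall>n. \<tau> \<le> \<bar>u (N + n)\<bar>)"
    by (simp add: bounded_below_def)
  have "of_int v \<le> of_int w * ratio q p N n \<longleftrightarrow> \<bar>u (N + n)\<bar> \<le> \<tau>" for n
  proof -
    have "of_int v \<le> of_int w * ratio q p N n \<longleftrightarrow> \<bar>u N\<bar> \<le> \<tau> * inverse (ratio p q N n)"
      unfolding v w ratio_swap[of q p] mult.assoc using c by (rule mult_le_cancel_left_pos)
    also have "\<dots> \<longleftrightarrow> \<bar>u (N + n)\<bar> \<le> \<tau>"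
      unfolding abs_tail[OF N] using tail_pos[OF N, of n]
      by (simp add: pos_le_divide_eq flip: divide_inverse)
    finally show ?thesis .
  qed
  then show "bounded_below q p w v N \<longleftrightarrow> poly p (int N) < poly q (int N) \<and> (\<forall>n. \<bar>u (N + n)\<bar> \<le> \<tau>)"
    by (simp add: bounded_below_def)
qed

end

lemma limit_side_iff:
  assumes d: "squarefree d" "d < 0" and R: "relation_data d R"
    and monic: "lead_coeff (Poly ps) = 1" "lead_coeff (Poly qs) = 1"
    and splits: "splits_over (quadratic_field d) (Poly ps)" "splits_over (quadratic_field d) (Poly qs)"
  obtains N0 where "\<And>N v w. N \<ge> N0 \<Longrightarrow> v > 0 \<Longrightarrow> w > 0 \<Longrightarrow>
    limit_side R d ps qs v w N \<longleftrightarrow>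
      bounded_below (Poly ps) (Poly qs) v w N \<or> bounded_below (Poly qs) (Poly ps) w v N"
    and "\<And>N. N \<ge> N0 \<Longrightarrow> pnorm (Poly ps) + pnorm (Poly qs) < int N"
proof -
  obtain N1 where N1: "\<And>N v w. N \<ge> N1 \<Longrightarrow> v > 0 \<Longrightarrow> w > 0 \<Longrightarrow>
    bounded_below (Poly ps) (Poly qs) v w N \<Longrightarrow> bound_certificate R d ps qs v w N"
    using bound_certificate_complete[OF d R monic splits] by blast
  obtain N2 where N2: "\<And>N v w. N \<ge> N2 \<Longrightarrow> v > 0 \<Longrightarrow> w > 0 \<Longrightarrow>
    bounded_below (Poly qs) (Poly ps) v w N \<Longrightarrow> bound_certificate R d qs ps v w N"
    using bound_certificate_complete[OF d R monic(2,1) splits(2,1)] by blast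
  define N3 where "N3 = Suc (nat (pnorm (Poly ps) + pnorm (Poly qs)))"
  have N3: "pnorm (Poly ps) + pnorm (Poly qs) < int N" "pnorm (Poly qs) + pnorm (Poly ps) < int N"
    if "N \<ge> N3" for N using that unfolding N3_def by linarith+
  show ?thesis
  proof (rule that[of "max N3 (max N1 N2)"])
    fix N v w assume "N \<ge> max N3 (max N1 N2)" "v > (0::int)" "w > (0::int)"
    then show "limit_side R d ps qs v w N \<longleftrightarrow>
        bounded_below (Poly ps) (Poly qs) v w N \<or> bounded_below (Poly qs) (Poly ps) w v N"
      unfolding limit_side_def
      using N1[of N v w] N2[of N w v] N3[of N]
        bound_certificate_sound[OF d(2) R, of v w ps qs N]
        bound_certificate_sound[OF d(2) R, of w v qs ps N] monic by auto
  qed (use N3 in auto)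
qed

text \<open>\<open>Poly\<close> ignores trailing zeros, so \<open>inj\<close> is assumed to let
  equality of lists, which a program can test, represent equality of polynomials. Lists of the form
  \<open>coeffs p\<close> satisfy it.\<close>

locale split_instance =
  fixes d :: int and R and ps qs :: "int list" and a t :: rat
  assumes d: "squarefree d" "d < 0" and R: "relation_data d R"
    and monic: "lead_coeff (Poly ps) = 1" "lead_coeff (Poly qs) = 1"
    and splits: "splits_over (quadratic_field d) (Poly ps)" "splits_over (quadratic_field d) (Poly qs)"
    and inj: "Poly ps = Poly qs \<Longrightarrow> ps = qs"
    and p_nz: "\<And>n. poly (Poly ps) (int n) \<noteq> 0" and t: "t \<noteq> 0"
begin

abbreviation "u \<equiv> hypergeometric_seq (Poly ps) (Poly qs) a"

definition "x n = numer qs (fst (quotient_of a)) n * snd (quotient_of t)"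
definition "y n = fst (quotient_of t) * numer ps (snd (quotient_of a)) n"
definition "U n = real_of_rat (u n)"
definition "\<tau> = real_of_rat t"
definition "c n = real_of_int (numer ps (snd (quotient_of a)) n * snd (quotient_of t))"

lemma c_nz: "c n \<noteq> 0"
proof -
  have "(\<Prod>k<n. poly (Poly ps) (int k)) \<noteq> 0" using p_nz by simp
  then show ?thesis
    using quotient_of_denom_pos'[of a] quotient_of_denom_pos'[of t] by (simp add: c_def numer_def)
qed

lemma real_of_rat_quotient: "real_of_rat r = of_int (fst (quotient_of r)) / of_int (snd (quotient_of r))"
  using arg_cong[OF quotient_of_div[of r "fst (quotient_of r)" "snd (quotient_of r)"], of real_of_rat]
  by (simp add: of_rat_divide)

lemma y_eq: "of_int (y n) = c n * \<tau>"
  using quotient_of_denom_pos'[of t] by (simp add: y_def c_def \<tau>_def real_of_rat_quotient)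

lemma x_eq: "of_int (x n) = c n * U n"
proof (induction n)
  case 0
  then show ?case
    using quotient_of_denom_pos'[of a]
    by (simp add: x_def c_def U_def numer_def real_of_rat_quotient)
next
  case (Suc n)
  have "U (Suc n) = of_int (poly (Poly qs) (int n)) / of_int (poly (Poly ps) (int n)) * U n"
    by (simp add: U_def of_rat_mult of_rat_divide)
  moreover have "c (Suc n) = c n * of_int (poly (Poly ps) (int n))"
    by (simp add: c_def numer_def)
  moreover have "x (Suc n) = x n * poly (Poly qs) (int n)" by (simp add: x_def numer_def)
  ultimately show ?case using Suc p_nz[of n] by simp
qed

interpretation monic_hypergeometric "Poly ps" "Poly qs" U
  by standard (use monic p_nz in \<open>auto simp: U_def of_rat_mult of_rat_divide\<close>)

lemma \<tau>: "\<tau> \<noteq> 0" using t by (simp add: \<tau>_def)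

lemma x_eq_y: "x n = y n \<longleftrightarrow> U n = \<tau>"
proof -
  have "x n = y n \<longleftrightarrow> real_of_int (x n) = of_int (y n)" by simp
  then show ?thesis using c_nz[of n] by (simp only: x_eq y_eq mult_cancel_left) simp
qed

lemma x_eq_0: "x n = 0 \<longleftrightarrow> U n = 0"
proof -
  have "x n = 0 \<longleftrightarrow> real_of_int (x n) = 0" by simp
  then show ?thesis using c_nz[of n] by (simp only: x_eq mult_eq_0_iff) simp
qed

lemma abs_eq: "of_int \<bar>x n\<bar> = \<bar>c n\<bar> * \<bar>U n\<bar>" "of_int \<bar>y n\<bar> = \<bar>c n\<bar> * \<bar>\<tau>\<bar>"
  by (simp_all add: x_eq y_eq abs_mult)

lemma abs_less: "\<bar>x n\<bar> < \<bar>y n\<bar> \<longleftrightarrow> \<bar>U n\<bar> < \<bar>\<tau>\<bar>" "\<bar>y n\<bar> < \<bar>x n\<bar> \<longleftrightarrow> \<bar>\<tau>\<bar> < \<bar>U n\<bar>"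
proof -
  have "\<bar>x n\<bar> < \<bar>y n\<bar> \<longleftrightarrow> real_of_int \<bar>x n\<bar> < of_int \<bar>y n\<bar>"
    "\<bar>y n\<bar> < \<bar>x n\<bar> \<longleftrightarrow> real_of_int \<bar>y n\<bar> < of_int \<bar>x n\<bar>" by (simp_all only: of_int_less_iff)
  then show "\<bar>x n\<bar> < \<bar>y n\<bar> \<longleftrightarrow> \<bar>U n\<bar> < \<bar>\<tau>\<bar>" "\<bar>y n\<bar> < \<bar>x n\<bar> \<longleftrightarrow> \<bar>\<tau>\<bar> < \<bar>U n\<bar>"
    using c_nz[of n] by (simp_all only: abs_eq mult_less_cancel_left) auto
qed

lemma xy_neg: "x n * y n < 0 \<longleftrightarrow> U n * \<tau> < 0"
proof -
  have "real_of_int (x n * y n) = (c n)\<^sup>2 * (U n * \<tau>)"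
    by (simp add: x_eq y_eq power2_eq_square)
  moreover have "(c n)\<^sup>2 > 0" using c_nz[of n] by simp
  ultimately have "real_of_int (x n * y n) < 0 \<longleftrightarrow> U n * \<tau> < 0"
    by (simp add: mult_less_0_iff)
  then show ?thesis by (simp only: of_int_less_0_iff)
qed

text \<open>Multiplying by the possibly negative denominator turns the common factor into its square
  times the positive denominator of \<open>t\<close>.\<close>

lemma ge_iff: "y n * numer ps (snd (quotient_of a)) n \<le> x n * numer ps (snd (quotient_of a)) n \<longleftrightarrow> \<tau> \<le> U n"
proof -
  let ?e = "numer ps (snd (quotient_of a)) n"
  have "y n * ?e \<le> x n * ?e \<longleftrightarrow> real_of_int (y n * ?e) \<le> of_int (x n * ?e)"
    by (simp only: of_int_le_iff)
  also have "\<dots> \<longleftrightarrow> (c n * of_int ?e) * \<tau> \<le> (c n * of_int ?e) * U n"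
    by (simp add: x_eq y_eq mult_ac)
  also have "\<dots> \<longleftrightarrow> \<tau> \<le> U n"
  proof -
    have "c n * of_int ?e = (of_int ?e)\<^sup>2 * of_int (snd (quotient_of t))"
      by (simp add: c_def power2_eq_square)
    also have "\<dots> > 0"
      using c_nz[of n] quotient_of_denom_pos'[of t] by (auto simp: c_def)
    finally show ?thesis by (rule mult_le_cancel_left_pos)
  qed
  finally show ?thesis .
qed

lemma fst_t: "0 < fst (quotient_of t) \<longleftrightarrow> 0 < \<tau>" "fst (quotient_of t) < 0 \<longleftrightarrow> \<tau> < 0"
  using quotient_of_denom_pos'[of t]
  by (simp_all add: \<tau>_def real_of_rat_quotient zero_less_divide_iff divide_less_0_iff)

lemma limit_side_sound:
  assumes N: "pnorm (Poly ps) + pnorm (Poly qs) < int N" and "U N \<noteq> 0"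
    and "limit_side R d ps qs \<bar>x N\<bar> \<bar>y N\<bar> N"
  shows "poly (Poly qs) (int N) < poly (Poly ps) (int N) \<and> (\<forall>n. \<bar>\<tau>\<bar> \<le> \<bar>U (N + n)\<bar>) \<or>
    poly (Poly ps) (int N) < poly (Poly qs) (int N) \<and> (\<forall>n. \<bar>U (N + n)\<bar> \<le> \<bar>\<tau>\<bar>)"
proof -
  have pos: "\<bar>x N\<bar> > 0" "\<bar>y N\<bar> > 0"
    using \<open>U N \<noteq> 0\<close> x_eq_0[of N] y_eq[of N] c_nz[of N] \<tau> by auto
  have "bounded_below (Poly ps) (Poly qs) \<bar>x N\<bar> \<bar>y N\<bar> N \<or> bounded_below (Poly qs) (Poly ps) \<bar>y N\<bar> \<bar>x N\<bar> N"
    using assms(3) N unfolding limit_side_def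
    using bound_certificate_sound[OF d(2) R pos monic]
      bound_certificate_sound[OF d(2) R pos(2,1) monic(2,1)] by (auto simp: add.commute)
  moreover have "\<bar>c N\<bar> > 0" using c_nz[of N] by simp
  ultimately show ?thesis
    using bounded_below_iff[OF N _ abs_eq] by blast
qed

lemma limit_side_complete:
  obtains N0 where "\<And>N. N \<ge> N0 \<Longrightarrow> pnorm (Poly ps) + pnorm (Poly qs) < int N"
    and "\<And>N. N \<ge> N0 \<Longrightarrow> U N \<noteq> 0 \<Longrightarrow>
      poly (Poly qs) (int N) < poly (Poly ps) (int N) \<and> (\<forall>n. \<bar>\<tau>\<bar> \<le> \<bar>U (N + n)\<bar>) \<or>
      poly (Poly ps) (int N) < poly (Poly qs) (int N) \<and> (\<forall>n. \<bar>U (N + n)\<bar> \<le> \<bar>\<tau>\<bar>) \<Longrightarrow>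
      limit_side R d ps qs \<bar>x N\<bar> \<bar>y N\<bar> N"
proof -
  obtain N0 where N0: "\<And>N v w. N \<ge> N0 \<Longrightarrow> v > 0 \<Longrightarrow> w > 0 \<Longrightarrow>
    limit_side R d ps qs v w N \<longleftrightarrow>
      bounded_below (Poly ps) (Poly qs) v w N \<or> bounded_below (Poly qs) (Poly ps) w v N"
    and bound: "\<And>N. N \<ge> N0 \<Longrightarrow> pnorm (Poly ps) + pnorm (Poly qs) < int N"
    using limit_side_iff[OF d R monic splits] by metis
  show ?thesis
  proof (rule that[OF bound])
    fix N assume N: "N \<ge> N0" and "U N \<noteq> 0"
      and *: "poly (Poly qs) (int N) < poly (Poly ps) (int N) \<and> (\<forall>n. \<bar>\<tau>\<bar> \<le> \<bar>U (N + n)\<bar>) \<or>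
      poly (Poly ps) (int N) < poly (Poly qs) (int N) \<and> (\<forall>n. \<bar>U (N + n)\<bar> \<le> \<bar>\<tau>\<bar>)"
    have pos: "\<bar>x N\<bar> > 0" "\<bar>y N\<bar> > 0"
      using \<open>U N \<noteq> 0\<close> x_eq_0[of N] y_eq[of N] c_nz[of N] \<tau> by auto
    have "\<bar>c N\<bar> > 0" using c_nz[of N] by simp
    with * show "limit_side R d ps qs \<bar>x N\<bar> \<bar>y N\<bar> N"
      unfolding N0[OF N pos] using bounded_below_iff[OF bound[OF N] _ abs_eq] by blast
  qed
qed

text \<open>A tail of nonzero terms of nonconstant absolute value either passes \<bar>\<tau>\<bar>
  moving away from it, which one index certifies, or stays forever on the near side, which is what
  \<open>limit_side\<close> certifies.\<close>

lemma never_equal_iff: "never_equal R d ps qs (quotient_of a) (quotient_of t) \<longleftrightarrow> (\<forall>n. u n \<noteq> t)"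
proof -
  have "never_equal R d ps qs (quotient_of a) (quotient_of t) \<longleftrightarrow>
    (\<exists>N. (\<forall>n<N. U n \<noteq> \<tau>) \<and>
        (U N = 0 \<or> pnorm (Poly ps) + pnorm (Poly qs) < int N \<and> U N \<noteq> \<tau> \<and>
          (ps = qs \<or> U N * \<tau> < 0 \<or>
           poly (Poly ps) (int N) < poly (Poly qs) (int N) \<and> \<bar>\<tau>\<bar> < \<bar>U N\<bar> \<or>
           poly (Poly qs) (int N) < poly (Poly ps) (int N) \<and> \<bar>U N\<bar> < \<bar>\<tau>\<bar> \<or>
           limit_side R d ps qs \<bar>x N\<bar> \<bar>y N\<bar> N)))" (is "_ \<longleftrightarrow> (\<exists>N. ?S N)")
    unfolding never_equal_def Let_def x_def[symmetric] y_def[symmetric] x_eq_y x_eq_0 xy_neg abs_less ..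
  also have "\<dots> \<longleftrightarrow> (\<forall>n. U n \<noteq> \<tau>)"
  proof
    assume "\<exists>N. ?S N"
    then obtain N where before: "\<And>n. n < N \<Longrightarrow> U n \<noteq> \<tau>" and S: "?S N" by blast
    have after: "U (N + n) \<noteq> \<tau>" for n
    proof (cases "U N = 0")
      case True
      then show ?thesis using zero_tail[of N "N + n"] \<tau> by simp
    next
      case nz: False
      with S have N: "pnorm (Poly ps) + pnorm (Poly qs) < int N" and "U N \<noteq> \<tau>" by blast+
      consider "ps = qs" | "U N * \<tau> < 0"
        | "poly (Poly ps) (int N) < poly (Poly qs) (int N)" "\<bar>\<tau>\<bar> < \<bar>U N\<bar>"
        | "poly (Poly qs) (int N) < poly (Poly ps) (int N)" "\<bar>U N\<bar> < \<bar>\<tau>\<bar>"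
        | "poly (Poly qs) (int N) < poly (Poly ps) (int N)" "\<And>n. \<bar>\<tau>\<bar> \<le> \<bar>U (N + n)\<bar>"
        | "poly (Poly ps) (int N) < poly (Poly qs) (int N)" "\<And>n. \<bar>U (N + n)\<bar> \<le> \<bar>\<tau>\<bar>"
        using S nz limit_side_sound[OF N nz] by blast
      then show ?thesis
      proof cases
        case 1
        then show ?thesis using const_tail[of "N + n"] const_tail[of N] \<open>U N \<noteq> \<tau>\<close> by simp
      next
        case 2
        then have "sgn (U N) \<noteq> sgn \<tau>" by (auto simp: mult_less_0_iff sgn_if)
        then show ?thesis using sgn_tail[OF N, of n] by auto
      next
        case 3
        then show ?thesis using mono_tail(2)[OF N nz, of n] by auto
      next
        case 4
        then show ?thesis using mono_tail(1)[OF N nz, of n] by auto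
      next
        \<comment> \<open>The weak bound at the next index and strict decrease give a strict
          inequality at this index, even if the limit equals \<bar>\<tau>\<bar>. The following case
          is symmetric.\<close>
        case 5
        then show ?thesis using increasing_or_decreasing(1)[OF N nz, of n] 5(2)[of "Suc n"] by auto
      next
        case 6
        then show ?thesis using increasing_or_decreasing(2)[OF N nz, of n] 6(2)[of "Suc n"] by auto
      qed
    qed
    show "\<forall>n. U n \<noteq> \<tau>"
    proof
      fix n show "U n \<noteq> \<tau>"
        using before[of n] after[of "n - N"] by (cases "n < N") simp_all
    qed
  next
    assume ne: "\<forall>n. U n \<noteq> \<tau>"
    show "\<exists>N. ?S N"
    proof (cases "\<exists>N. U N = 0")
      case True
      then show ?thesis using ne by blast
    next
      case False
      then have nz: "U N \<noteq> 0" for N by blast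
      obtain N where bound: "\<And>M. M \<ge> N \<Longrightarrow> pnorm (Poly ps) + pnorm (Poly qs) < int M"
        and side: "\<And>M. M \<ge> N \<Longrightarrow> U M \<noteq> 0 \<Longrightarrow>
      poly (Poly qs) (int M) < poly (Poly ps) (int M) \<and> (\<forall>n. \<bar>\<tau>\<bar> \<le> \<bar>U (M + n)\<bar>) \<or>
      poly (Poly ps) (int M) < poly (Poly qs) (int M) \<and> (\<forall>n. \<bar>U (M + n)\<bar> \<le> \<bar>\<tau>\<bar>) \<Longrightarrow>
      limit_side R d ps qs \<bar>x M\<bar> \<bar>y M\<bar> M"
        using limit_side_complete by metis
      have "pnorm (Poly ps - Poly qs) < int N" "pnorm (Poly qs - Poly ps) < int N"
        using bound[of N] pnorm_diff[of "Poly ps" "Poly qs"] pnorm_diff[of "Poly qs" "Poly ps"] by simp_all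
      \<comment> \<open>The direction of monotonicity is settled from \<open>N\<close> on, so a
        certificate may be placed at any later index \<open>N + n\<close>.\<close>
      then have persist: "sgn (poly (Poly ps - Poly qs) (int (N + n))) = sgn (poly (Poly ps - Poly qs) (int N))" for n
        by (intro sgn_poly_eventually_const) auto
      consider "poly (Poly ps) (int N) = poly (Poly qs) (int N)"
        | "poly (Poly ps) (int N) < poly (Poly qs) (int N)"
        | "poly (Poly qs) (int N) < poly (Poly ps) (int N)" by linarith
      then show ?thesis
      proof cases
        case 1
        then have "ps = qs" using increasing_or_decreasing(3)[OF bound nz] inj by blast
        then show ?thesis using ne bound[of N] by blast
      next
        case 2
        have less: "poly (Poly ps) (int (N + n)) < poly (Poly qs) (int (N + n))" for n
          using persist[of n] 2 by (auto simp: sgn_if split: if_splits)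
        show ?thesis
        proof (cases "\<exists>n. \<bar>\<tau>\<bar> < \<bar>U (N + n)\<bar>")
          case True
          then obtain n where "\<bar>\<tau>\<bar> < \<bar>U (N + n)\<bar>" by blast
          then have "?S (N + n)" using ne bound[of "N + n"] less[of n] by auto
          then show ?thesis by blast
        next
          case False
          then have "limit_side R d ps qs \<bar>x N\<bar> \<bar>y N\<bar> N"
            using 2 by (intro side nz) (auto simp: not_less)
          then show ?thesis using ne bound[of N] by blast
        qed
      next
        case 3
        have less: "poly (Poly qs) (int (N + n)) < poly (Poly ps) (int (N + n))" for n
          using persist[of n] 3 by (auto simp: sgn_if split: if_splits)
        show ?thesis
        proof (cases "\<exists>n. \<bar>U (N + n)\<bar> < \<bar>\<tau>\<bar>")
          case True
          then obtain n where "\<bar>U (N + n)\<bar> < \<bar>\<tau>\<bar>" by blast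
          then have "?S (N + n)" using ne bound[of "N + n"] less[of n] by auto
          then show ?thesis by blast
        next
          case False
          then have "limit_side R d ps qs \<bar>x N\<bar> \<bar>y N\<bar> N"
            using 3 by (intro side nz) (auto simp: not_less)
          then show ?thesis using ne bound[of N] by blast
        qed
      qed
    qed
  qed
  finally show ?thesis by (simp add: U_def \<tau>_def)
qed

text \<open>When term and target differ in sign, or the absolute values move in the direction
  favourable for the sign of \<tau>, the inequality at \<open>N\<close> propagates. Only motion
  towards \<tau> with equal signs needs information on the limit.\<close>

lemma always_ge_iff: "always_ge R d ps qs (quotient_of a) (quotient_of t) \<longleftrightarrow> (\<forall>n. u n \<ge> t)"
proof -
  have "always_ge R d ps qs (quotient_of a) (quotient_of t) \<longleftrightarrow>
    (\<exists>N. (\<forall>n<Suc N. \<tau> \<le> U n) \<and>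
        (U N = 0 \<or> pnorm (Poly ps) + pnorm (Poly qs) < int N \<and>
          (ps = qs \<or> U N * \<tau> < 0 \<or>
           poly (Poly ps) (int N) < poly (Poly qs) (int N) \<and> 0 < \<tau> \<or>
           poly (Poly qs) (int N) < poly (Poly ps) (int N) \<and> \<tau> < 0 \<or>
           limit_side R d ps qs \<bar>x N\<bar> \<bar>y N\<bar> N)))" (is "_ \<longleftrightarrow> (\<exists>N. ?S N)")
    unfolding always_ge_def Let_def x_def[symmetric] y_def[symmetric] ge_iff x_eq_0 xy_neg fst_t ..
  also have "\<dots> \<longleftrightarrow> (\<forall>n. \<tau> \<le> U n)"
  proof
    assume "\<exists>N. ?S N"
    then obtain N where before: "\<And>n. n < Suc N \<Longrightarrow> \<tau> \<le> U n" and S: "?S N" by blast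
    have UN: "\<tau> \<le> U N" by (rule before) simp
    have after: "\<tau> \<le> U (N + n)" for n
    proof (cases "U N = 0")
      case True
      then show ?thesis using zero_tail[of N "N + n"] UN by simp
    next
      case nz: False
      with S have N: "pnorm (Poly ps) + pnorm (Poly qs) < int N" by blast
      have sgn: "U (N + n) > 0 \<longleftrightarrow> U N > 0" "U (N + n) < 0 \<longleftrightarrow> U N < 0"
        using sgn_tail[OF N, of n] by (auto simp: sgn_if split: if_splits)
      consider "ps = qs" | "U N * \<tau> < 0"
        | "poly (Poly ps) (int N) < poly (Poly qs) (int N)" "0 < \<tau>"
        | "poly (Poly qs) (int N) < poly (Poly ps) (int N)" "\<tau> < 0"
        | "poly (Poly qs) (int N) < poly (Poly ps) (int N)" "0 < \<tau>" "\<bar>\<tau>\<bar> \<le> \<bar>U (N + n)\<bar>"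
        | "poly (Poly ps) (int N) < poly (Poly qs) (int N)" "\<tau> < 0" "\<bar>U (N + n)\<bar> \<le> \<bar>\<tau>\<bar>"
        using S nz limit_side_sound[OF N nz] \<tau> by (metis linorder_neqE_linordered_idom)
      then show ?thesis
      proof cases
        case 1
        then show ?thesis using const_tail[of "N + n"] const_tail[of N] UN by simp
      next
        case 2
        then show ?thesis using sgn UN by (auto simp: mult_less_0_iff)
      next
        case 3
        then show ?thesis using mono_tail(2)[OF N nz, of n] sgn UN by auto
      next
        case 4
        then show ?thesis using mono_tail(1)[OF N nz, of n] sgn UN by linarith
      next
        case 5
        then show ?thesis using sgn UN by linarith
      next
        case 6
        then show ?thesis by linarith
      qed
    qed
    show "\<forall>n. \<tau> \<le> U n"
    proof
      fix n show "\<tau> \<le> U n"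
        using before[of n] after[of "n - N"] by (cases "n < N") simp_all
    qed
  next
    assume ge: "\<forall>n. \<tau> \<le> U n"
    show "\<exists>N. ?S N"
    proof (cases "\<exists>N. U N = 0")
      case True
      then show ?thesis using ge by blast
    next
      case False
      then have nz: "U N \<noteq> 0" for N by blast
      obtain N where bound: "\<And>M. M \<ge> N \<Longrightarrow> pnorm (Poly ps) + pnorm (Poly qs) < int M"
        and side: "\<And>M. M \<ge> N \<Longrightarrow> U M \<noteq> 0 \<Longrightarrow>
      poly (Poly qs) (int M) < poly (Poly ps) (int M) \<and> (\<forall>n. \<bar>\<tau>\<bar> \<le> \<bar>U (M + n)\<bar>) \<or>
      poly (Poly ps) (int M) < poly (Poly qs) (int M) \<and> (\<forall>n. \<bar>U (M + n)\<bar> \<le> \<bar>\<tau>\<bar>) \<Longrightarrow>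
      limit_side R d ps qs \<bar>x M\<bar> \<bar>y M\<bar> M"
        using limit_side_complete by metis
      have N: "pnorm (Poly ps) + pnorm (Poly qs) < int N" by (rule bound) simp
      have sgn: "U (N + n) > 0 \<longleftrightarrow> U N > 0" "U (N + n) < 0 \<longleftrightarrow> U N < 0" for n
        using sgn_tail[OF N, of n] by (auto simp: sgn_if split: if_splits)
      \<comment> \<open>Only the last two alternatives move towards \<tau>: negative terms growing
        in size, or positive terms shrinking. The assumed inequality then bounds the whole tail as
        \<open>limit_side\<close> requires.\<close>
      consider "poly (Poly ps) (int N) = poly (Poly qs) (int N)" | "U N * \<tau> < 0"
        | "poly (Poly ps) (int N) < poly (Poly qs) (int N)" "0 < \<tau>"
        | "poly (Poly qs) (int N) < poly (Poly ps) (int N)" "\<tau> < 0"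
        | "poly (Poly ps) (int N) < poly (Poly qs) (int N)" "\<tau> < 0" "U N < 0"
        | "poly (Poly qs) (int N) < poly (Poly ps) (int N)" "0 < \<tau>" "U N > 0"
        using nz[of N] \<tau> by (fastforce simp: mult_less_0_iff)
      then show ?thesis
      proof cases
        case 1
        then have "ps = qs" using increasing_or_decreasing(3)[OF N nz] inj by blast
        then show ?thesis using ge N by blast
      next
        case 5
        have "\<bar>U (N + n)\<bar> \<le> \<bar>\<tau>\<bar>" for n
          using 5 sgn[of n] ge[rule_format, of "N + n"] by linarith
        then have "limit_side R d ps qs \<bar>x N\<bar> \<bar>y N\<bar> N"
          using 5 by (intro side nz) auto
        then show ?thesis using ge N by blast
      next
        case 6
        have "\<bar>\<tau>\<bar> \<le> \<bar>U (N + n)\<bar>" for n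
          using 6 sgn[of n] ge[rule_format, of "N + n"] by linarith
        then have "limit_side R d ps qs \<bar>x N\<bar> \<bar>y N\<bar> N"
          using 6 by (intro side nz) auto
        then show ?thesis using ge N by blast
      qed (use ge N in blast)+
    qed
  qed
  finally show ?thesis by (simp add: U_def \<tau>_def of_rat_less_eq)
qed

end


section \<open>Computability of the certificate checks\<close>

declare computable_half [computable_intros] computable_id [computable_intros]
  computable_const [computable_intros]

lemma computable_poly_Poly [computable_intros]:
  assumes "computable A" and "computable K"
  shows "computable (\<lambda>x. poly (Poly (A x)) (K x) :: int)"
proof (rule computable_cong)
  show "poly (Poly (A x)) (K x) = foldr (\<lambda>a r. a + K x * r) (A x) 0" for x
  proof -
    have "poly (Poly as) k = foldr (\<lambda>a r. a + k * r) as 0" for as and k :: int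
      by (induction as) simp_all
    then show ?thesis .
  qed
  show "computable (\<lambda>x. foldr (\<lambda>a r. a + K x * r) (A x) 0)"
    \<comment> \<open>Under the binders of the fold, \<open>K\<close> is applied to a projection of
      the extended argument; the composed form of the assumption covers this, here and in the rules
      below.\<close>
    by (intro computable_compose[OF assms(2)] assms computable_intros)
qed

lemma computable_poly [computable_intros]: "computable K \<Longrightarrow> computable (\<lambda>x. poly p (K x) :: int)"
  using computable_poly_Poly[OF computable_const[of "coeffs p"]] by simp

lemma computable_pnorm [computable_intros]: "computable A \<Longrightarrow> computable (\<lambda>x. pnorm (Poly (A x)))"
proof (rule computable_cong)
  have "pnorm (Poly as) = (\<Sum>a\<leftarrow>as. \<bar>a\<bar>)" for as by (induction as) simp_all
  then show "pnorm (Poly (A x)) = (\<Sum>a\<leftarrow>A x. \<bar>a\<bar>)" for x .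
qed (intro computable_intros)

lemma computable_quad [computable_intros]:
  "computable r \<Longrightarrow> computable k \<Longrightarrow> computable (\<lambda>x. quad d (r x) (k x))"
  unfolding quad_def case_prod_beta power2_eq_square by (intro computable_intros)

lemma computable_quad_index [computable_intros]:
  "computable N \<Longrightarrow> computable r \<Longrightarrow> computable (\<lambda>x. quad_index (N x) (r x))"
  unfolding quad_index_def case_prod_beta by (intro computable_intros)

lemma computable_quad_weight [computable_intros]:
  assumes "computable N" and "computable r"
  shows "computable (\<lambda>x. quad_weight d (N x) (r x))"
  unfolding quad_weight_def
  by (intro computable_compose[OF assms(1)] computable_compose[OF assms(2)] assms computable_intros)

lemma computable_tau [computable_intros]:
  assumes "computable y" and "computable n"
  shows "computable (\<lambda>x. tau (y x) (n x) :: int)"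
proof (rule computable_cong)
  let ?r = "\<lambda>y::int. rec_nat (2, y) (\<lambda>_ s. (snd s, y * snd s - fst s))"
  have "?r y n = (tau y n, tau y (Suc n))" for y n
    by (induction n) simp_all
  then show "tau (y x) (n x) = fst (?r (y x) (n x))" for x by simp
  show "computable (\<lambda>x. fst (?r (y x) (n x)))"
    by (intro computable_compose[OF assms(1)] assms computable_intros)
qed

lemma computable_quad_num [computable_intros]:
  "computable y \<Longrightarrow> computable r \<Longrightarrow> computable (\<lambda>x. quad_num (y x) (r x) :: int)"
  unfolding quad_num_def case_prod_beta by (intro computable_intros)

lemma checkable_admissible [computable_intros]:
  assumes "computable N" and "computable rs"
  shows "checkable (\<lambda>x. admissible (N x) (rs x))"
proof (rule checkable_cong)
  show "admissible (N x) (rs x) \<longleftrightarrow> (\<forall>r\<in>set (rs x). fst r < 2 * int (N x) \<and> (snd r \<noteq> 0 \<or> even (fst r)))" for x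
    by (auto simp: admissible_def)
qed (intro computable_compose[OF assms(1)] assms computable_intros)

lemma computable_side [computable_intros]:
  assumes "computable N" and "computable v" and "computable P" and "computable Q" and "computable k"
  shows "computable (\<lambda>x. side d (N x) (v x) (P x) (Q x) (k x))"
  unfolding side_def
  by (intro computable_compose[OF assms(1)] computable_compose[OF assms(5)] assms computable_intros)

lemma checkable_quad_factors [computable_intros]:
  assumes "computable A" and "computable rs"
  shows "checkable (\<lambda>x. quad_factors d (A x) (rs x))"
  unfolding quad_factors_def power2_eq_square
  by (intro computable_compose[OF assms(1)] computable_compose[OF assms(2)] assms computable_intros)

lemma checkable_relation_check [computable_intros]:
  assumes "computable N" "computable v" "computable w" "computable P" "computable Q"
    "computable j1" "computable j2" "computable c" "computable h"
  shows "checkable (\<lambda>x. relation_check m g1 g2 d (N x) (v x) (w x) (P x) (Q x) (j1 x) (j2 x) (c x) (h x))"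
  unfolding relation_check_def
  by (intro assms[THEN computable_compose] assms computable_intros)

text \<open>The components of \<open>R\<close> are fixed and enter the program as constants. All
  unbounded quantifiers range over encoded types, and what remains under them is checkable.\<close>

lemma semidecidable_bound_certificate:
  assumes "computable A" "computable B" "computable v" "computable w" "computable N"
  shows "semidecidable (\<lambda>x. bound_certificate R d (A x) (B x) (v x) (w x) (N x))"
proof -
  obtain m g1 g2 l where R: "R = (m, g1, g2, l)" by (cases R)
  show ?thesis
    unfolding bound_certificate_def slack_certificate_def limit_certificate_def R prod.case Let_def
    by (intro semidecidable_conj semidecidable_disj semidecidable_ex semidecidable_checkable
        assms[THEN computable_compose] assms computable_intros)
qed

lemma semidecidable_limit_side:
  assumes "computable A" "computable B" "computable v" "computable w" "computable N"
  shows "semidecidable (\<lambda>x. limit_side R d (A x) (B x) (v x) (w x) (N x))"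
  unfolding limit_side_def
  by (intro semidecidable_disj semidecidable_bound_certificate assms)

lemma computable_numer [computable_intros]:
  assumes "computable A" "computable a" "computable n"
  shows "computable (\<lambda>x. numer (A x) (a x) (n x))"
  unfolding numer_def
  by (intro assms[THEN computable_compose] assms computable_intros)

section \<open>From instance codes to lists of coefficients, and the resulting searches\<close>

type_synonym list_data = "int list \<times> int list \<times> (int \<times> int) \<times> (int \<times> int)"

definition list_data :: "instance_data \<Rightarrow> list_data" where
  "list_data = (\<lambda>(p, q, a, t). (coeffs p, coeffs q, quotient_of a, quotient_of t))"

text \<open>The component codes already agree with \<open>enc\<close>; the program only rearranges
  the outer four-element list into nested pairs.\<close>

lemma computes_list_data: "\<exists>r. \<forall>x. computes r [instance_code x] (enc (list_data x))"
proof -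
  define head where "head l = (case l of [] \<Rightarrow> 0 | h # t \<Rightarrow> h)" for l :: "nat list"
  define rest where "rest l = (case l of [] \<Rightarrow> [] | h # t \<Rightarrow> t)" for l :: "nat list"
  have head: "computable (\<lambda>x. head (A x))" and rest: "computable (\<lambda>x. rest (A x))"
    if "computable A" for A :: "nat list \<Rightarrow> nat list"
    unfolding head_def rest_def by (intro computable_case_list that computable_intros)+
  define conv :: "nat list \<Rightarrow> list_data" where
    "conv l = (dec (head l), dec (head (rest l)), dec (head (rest (rest l))), dec (head (rest (rest (rest l)))))"
    for l
  have "computable conv"
    unfolding conv_def[abs_def] by (intro computable_intros head rest)
  then obtain r where r: "\<And>l. computes r [enc l] (enc (conv l))"
    unfolding computable_def by blast
  have "computes r [instance_code x] (enc (list_data x))" for x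
  proof -
    obtain p q a t where x: "x = (p, q, a, t)" by (cases x)
    let ?l = "[poly_code p, poly_code q, rat_code a, rat_code t]"
    have poly: "poly_code p = enc (coeffs p)" for p
      by (simp add: poly_code_def enc_list_def enc_int_def[abs_def])
    have rat: "rat_code a = enc (quotient_of a)" for a
      by (cases "quotient_of a") (simp add: rat_code_def enc_simps enc_int_def)
    have "enc ?l = instance_code x"
      by (simp add: instance_code_def x enc_list_def enc_nat_def[abs_def])
    moreover have "conv ?l = list_data x"
      by (simp add: conv_def head_def rest_def list_data_def x poly rat)
    ultimately show ?thesis using r[of ?l] by simp
  qed
  then show ?thesis by blast
qed

definition never_equal_data :: "int poly \<times> int poly \<times> int poly \<times> nat \<Rightarrow> int \<Rightarrow> list_data \<Rightarrow> bool" where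
  "never_equal_data R d x = never_equal R d (fst x) (fst (snd x)) (fst (snd (snd x))) (snd (snd (snd x)))"

definition always_ge_data :: "int poly \<times> int poly \<times> int poly \<times> nat \<Rightarrow> int \<Rightarrow> list_data \<Rightarrow> bool" where
  "always_ge_data R d x = always_ge R d (fst x) (fst (snd x)) (fst (snd (snd x))) (snd (snd (snd x)))"

lemma semidecidable_never_equal: "semidecidable (never_equal_data R d)"
  unfolding never_equal_data_def[abs_def] never_equal_def Let_def
  by (intro semidecidable_ex semidecidable_conj semidecidable_disj semidecidable_limit_side
      semidecidable_checkable computable_intros)

lemma semidecidable_always_ge: "semidecidable (always_ge_data R d)"
  unfolding always_ge_data_def[abs_def] always_ge_def Let_def
  by (intro semidecidable_ex semidecidable_conj semidecidable_disj semidecidable_limit_side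
      semidecidable_checkable computable_intros)

definition reaches :: "list_data \<Rightarrow> bool" where
  "reaches x \<longleftrightarrow> (\<exists>n. numer (fst (snd x)) (fst (fst (snd (snd x)))) n * snd (snd (snd (snd x)))
     = fst (snd (snd (snd x))) * numer (fst x) (snd (fst (snd (snd x)))) n)"

text \<open>As in \<open>always_ge\<close>, the extra factor on both sides makes the comparison
  independent of the sign of the denominator.\<close>

definition drops :: "list_data \<Rightarrow> bool" where
  "drops x \<longleftrightarrow> (\<exists>n. numer (fst (snd x)) (fst (fst (snd (snd x)))) n * snd (snd (snd (snd x)))
       * numer (fst x) (snd (fst (snd (snd x)))) n
     < fst (snd (snd (snd x))) * numer (fst x) (snd (fst (snd (snd x)))) n
       * numer (fst x) (snd (fst (snd (snd x)))) n)"

lemma semidecidable_reaches: "semidecidable reaches"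
  unfolding reaches_def[abs_def]
  by (intro semidecidable_ex semidecidable_checkable computable_intros)

lemma semidecidable_drops: "semidecidable drops"
  unfolding drops_def[abs_def]
  by (intro semidecidable_ex semidecidable_checkable computable_intros)

lemma instance_semantics:
  assumes d: "squarefree d" "d < 0" and R: "relation_data d R"
    and inst: "X \<in> monic_split_instances (quadratic_field d)"
  shows "membership_problem X \<longleftrightarrow> reaches (list_data X)"
    and "\<not> membership_problem X \<longleftrightarrow> never_equal_data R d (list_data X)"
    and "threshold_problem X \<longleftrightarrow> always_ge_data R d (list_data X)"
    and "\<not> threshold_problem X \<longleftrightarrow> drops (list_data X)"
proof -
  obtain p q a t v where X: "X = (p, q, a, t)" and hyp: "hypergeometric p q v" and t: "t \<noteq> 0"
    and monic: "lead_coeff p = 1" "lead_coeff q = 1"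
    and splits: "splits_over (quadratic_field d) p" "splits_over (quadratic_field d) q"
    using inst by (auto simp: monic_split_instances_def)
  have data: "list_data (p, q, a, t) = (coeffs p, coeffs q, quotient_of a, quotient_of t)"
    by (simp add: list_data_def)
  have nz: "poly (Poly (coeffs p)) (int n) \<noteq> 0" for n
    using hyp by (simp add: hypergeometric_def)
  interpret split_instance d R "coeffs p" "coeffs q" a t
    by standard (use d R monic splits nz t in auto)
  have eq: "numer (coeffs q) (fst (quotient_of a)) n * snd (quotient_of t)
      = fst (quotient_of t) * numer (coeffs p) (snd (quotient_of a)) n
      \<longleftrightarrow> hypergeometric_seq p q a n = t" for n
    using x_eq_y[of n] by (simp add: x_def y_def U_def \<tau>_def)
  have ge: "fst (quotient_of t) * numer (coeffs p) (snd (quotient_of a)) n * numer (coeffs p) (snd (quotient_of a)) n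
      \<le> numer (coeffs q) (fst (quotient_of a)) n * snd (quotient_of t) * numer (coeffs p) (snd (quotient_of a)) n
      \<longleftrightarrow> t \<le> hypergeometric_seq p q a n" for n
    using ge_iff[of n] by (simp add: x_def y_def U_def \<tau>_def of_rat_less_eq)
  show "membership_problem X \<longleftrightarrow> reaches (list_data X)"
    by (simp add: reaches_def membership_problem_def X data eq)
  show "\<not> membership_problem X \<longleftrightarrow> never_equal_data R d (list_data X)"
    using never_equal_iff by (simp add: never_equal_data_def membership_problem_def X data)
  show "threshold_problem X \<longleftrightarrow> always_ge_data R d (list_data X)"
    using always_ge_iff by (simp add: always_ge_data_def threshold_problem_def X data)
  show "\<not> threshold_problem X \<longleftrightarrow> drops (list_data X)"
    by (simp add: drops_def threshold_problem_def X data not_le flip: ge)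
qed

theorem theorem12:
  fixes d :: int
  assumes "squarefree d" and "d < 0"
  shows "decidable_on instance_code (monic_split_instances (quadratic_field d)) membership_problem \<and>
         decidable_on instance_code (monic_split_instances (quadratic_field d)) threshold_problem"
proof -
  obtain R where R: "relation_data d R" using ex_relation_data by blast
  have conv: "\<exists>r. \<forall>x\<in>monic_split_instances (quadratic_field d). computes r [instance_code x] (enc (list_data x))"
    using computes_list_data by blast
  note sem = instance_semantics[OF assms R]
  show ?thesis
    using decidable_on_if_semidecidable[OF conv semidecidable_reaches semidecidable_never_equal sem(1,2)]
      decidable_on_if_semidecidable[OF conv semidecidable_always_ge semidecidable_drops sem(3,4)]
    by blast
qed

end
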